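(* Let $(M^{n+m}=B^n\times_f F^m,\ g=g_B+f^2g_F,\ h,\ \rho)$ be a nontrivial warped product Yamabe gradient soliton, $n\ge 2$, with complete base $(B^n,g_B)$. Suppose that for some $A\in\mathbb{R}$, $$\inf_{|\nabla^B h|\neq 0}\left[\frac{n+m-1}{n-1}\,{}^{B}\mathrm{Ric}\!\left(\frac{\nabla^B h}{|\nabla^B h|},\frac{\nabla^B h}{|\nabla^B h|}\right)-\frac{1}{2(n+m-1)}\operatorname{Hess} h\!\left(\frac{\nabla^B h}{|\nabla^B h|},\frac{\nabla^B h}{|\nabla^B h|}\right)\right]=A .$$ Then the scalar curvature $R$ of $(M^{n+m},g)$ is bounded from below, and there exists a positive constant $C$ such that: (1) if $\rho\ge 0$ then $R\ge -(n+m-1)C|A|$; (2) if $\rho<0$ then $R\ge -(n+m-1)C|A|+\rho$.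
   Context: A Riemannian metric $g$ on a connected smooth manifold $M$ is a Yamabe gradient soliton, denoted $(M,g,h,\rho)$, if there are a smooth function $h:M\to\mathbb{R}$ (the soliton function) and a constant $\rho\in\mathbb{R}$ with $\operatorname{Hess} h=(R-\rho)g$ on $M$, where $R$ is the scalar curvature of $g$. It is trivial if $h$ is constant, and nontrivial otherwise. Given Riemannian manifolds $(B^n,g_B)$ (the base) and $(F^m,g_F)$ (the fiber) and a nonconstant positive smooth function $f:B\to(0,\infty)$ (the warping function), the warped product $M=B\times_f F$ is $B\times F$ with the metric $g=\pi^*g_B+(f\circ\pi)^2\eta^*g_F$, where $\pi:M\to B$ and $\eta:M\to F$ are the projections; this is written $g=g_B+f^2g_F$. A warped product Yamabe gradient soliton is a Yamabe gradient soliton $(M,g,h,\rho)$ such that $(M,g)$ is a warped product of this kind. For a nontrivial warped product Yamabe gradient soliton the soliton function depends only on the base, and $h$ is identified with the corresponding function on $B$; $\nabla^B h$ is its gradient on $(B,g_B)$ and ${}^{B}\mathrm{Ric}$ is the Ricci tensor of $(B,g_B)$. The infimum is over points of $B$ where $|\nabla^B h|\ne0$. *)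

theory Defs
  imports "HOL-Analysis.Analysis"
begin

section \<open>Smooth functions on open subsets of Euclidean spaces\<close>

abbreviation dir_deriv ::
    "('e::euclidean_space \<Rightarrow> 'f::real_normed_vector) \<Rightarrow> 'e \<Rightarrow> 'e \<Rightarrow> 'f"
  where "dir_deriv F x v \<equiv> frechet_derivative F (at x) v"

primrec Ck_on ::
    "nat \<Rightarrow> 'e::euclidean_space set \<Rightarrow> ('e \<Rightarrow> 'f::real_normed_vector) \<Rightarrow> bool"
  where
    "Ck_on 0 S F \<longleftrightarrow> continuous_on S F"
  | "Ck_on (Suc k) S F \<longleftrightarrow>
       F differentiable_on S \<and> (\<forall>v. Ck_on k S (\<lambda>x. dir_deriv F x v))"

definition smooth_on ::
    "'e::euclidean_space set \<Rightarrow> ('e \<Rightarrow> 'f::real_normed_vector) \<Rightarrow> bool"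
  where "smooth_on S F \<longleftrightarrow> open S \<and> (\<forall>k. Ck_on k S F)"


section \<open>Riemannian manifolds\<close>

text \<open>
  A manifold is a whole type \<open>'a\<close> with its topology. Its smooth structure is given by an
  atlas in which every point \<open>p\<close> has a designated chart
  \<open>chart_map M p : chart_dom M p \<rightarrow> 'e\<close> around it (charts of different points may coincide,
  and every atlas can be presented in this way). The dimension is \<open>DIM('e)\<close>.

  The tangent space at \<open>p\<close> is identified with \<open>'e\<close> by the differential at \<open>p\<close> of the chart
  designated for \<open>p\<close>. So \<open>metric M p v w\<close> is the inner product of the tangent vectors at
  \<open>p\<close> whose coordinates in the chart of \<open>p\<close> are \<open>v\<close> and \<open>w\<close>.
\<close>

record ('a, 'e) riem =
  chart_dom :: "'a \<Rightarrow> 'a set"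
  chart_map :: "'a \<Rightarrow> 'a \<Rightarrow> 'e"
  metric :: "'a \<Rightarrow> 'e \<Rightarrow> 'e \<Rightarrow> real"

definition chart_img :: "('a, 'e) riem \<Rightarrow> 'a \<Rightarrow> 'e set"
  where "chart_img M p = chart_map M p ` chart_dom M p"

definition param :: "('a, 'e) riem \<Rightarrow> 'a \<Rightarrow> 'e \<Rightarrow> 'a"
  where "param M p = inv_into (chart_dom M p) (chart_map M p)"

text \<open>
  The metric in the coordinates of the chart of \<open>p\<close>: at \<open>x = chart_map M p q\<close>, the vectors
  \<open>v\<close> and \<open>w\<close> are carried to the chart of \<open>q\<close> by the differential of the transition map.
\<close>

definition coord_metric ::
    "('a, 'e::euclidean_space) riem \<Rightarrow> 'a \<Rightarrow> 'e \<Rightarrow> 'e \<Rightarrow> 'e \<Rightarrow> real"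
  where "coord_metric M p x v w =
    (let q = param M p x; D = dir_deriv (chart_map M q \<circ> param M p) x
     in metric M q (D v) (D w))"

definition smooth_manifold ::
    "('a::{t2_space, second_countable_topology}, 'e::euclidean_space) riem \<Rightarrow> bool"
  where "smooth_manifold M \<longleftrightarrow>
    (\<forall>p. p \<in> chart_dom M p \<and> open (chart_dom M p) \<and> open (chart_img M p) \<and>
         homeomorphism (chart_dom M p) (chart_img M p) (chart_map M p) (param M p)) \<and>
    (\<forall>p q. smooth_on (chart_map M p ` (chart_dom M p \<inter> chart_dom M q))
             (chart_map M q \<circ> param M p))"

definition riemannian_manifold ::
    "('a::{t2_space, second_countable_topology}, 'e::euclidean_space) riem \<Rightarrow> bool"
  where "riemannian_manifold M \<longleftrightarrow>
    smooth_manifold M \<and>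
    (\<forall>p. bilinear (metric M p) \<and>
         (\<forall>v w. metric M p v w = metric M p w v) \<and>
         (\<forall>v. v \<noteq> 0 \<longrightarrow> metric M p v v > 0)) \<and>
    (\<forall>p v w. smooth_on (chart_img M p) (\<lambda>x. coord_metric M p x v w))"

definition smooth_fun :: "('a, 'e::euclidean_space) riem \<Rightarrow> ('a \<Rightarrow> real) \<Rightarrow> bool"
  where "smooth_fun M u \<longleftrightarrow> (\<forall>p. smooth_on (chart_img M p) (u \<circ> param M p))"

definition tnorm :: "('a, 'e) riem \<Rightarrow> 'a \<Rightarrow> 'e \<Rightarrow> real"
  where "tnorm M p v = sqrt (metric M p v v)"


section \<open>Curvature of a metric on an open subset of a Euclidean space\<close>

text \<open>
  Here \<open>G x v w\<close> is a metric in coordinates. The vector dual to a covector \<open>\<alpha>\<close>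
  (raising an index) replaces contraction with the inverse matrix \<open>g\<^sup>i\<^sup>j\<close>.
\<close>

definition sharp :: "('e::euclidean_space \<Rightarrow> 'e \<Rightarrow> 'e \<Rightarrow> real) \<Rightarrow> 'e \<Rightarrow> ('e \<Rightarrow> real) \<Rightarrow> 'e"
  where "sharp G x \<alpha> = (THE z. \<forall>w. G x z w = \<alpha> w)"

text \<open>
  Koszul's formula for \<open>\<nabla>\<^sub>v w\<close> with \<open>v\<close> and \<open>w\<close> constant vector fields. The coordinates of
  \<open>christoffel G x i j\<close> for basis vectors \<open>i\<close>, \<open>j\<close> are the usual Christoffel symbols.
\<close>

definition christoffel ::
    "('e::euclidean_space \<Rightarrow> 'e \<Rightarrow> 'e \<Rightarrow> real) \<Rightarrow> 'e \<Rightarrow> 'e \<Rightarrow> 'e \<Rightarrow> 'e"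
  where "christoffel G x v w = sharp G x (\<lambda>z.
    (dir_deriv (\<lambda>y. G y w z) x v + dir_deriv (\<lambda>y. G y v z) x w
       - dir_deriv (\<lambda>y. G y v w) x z) / 2)"

text \<open>
  \<open>riemann G x u v w = R(u, v) w = \<nabla>\<^sub>u \<nabla>\<^sub>v w - \<nabla>\<^sub>v \<nabla>\<^sub>u w\<close> for constant (hence commuting)
  vector fields, and \<open>Ric(v, w)\<close> is the trace of \<open>u \<mapsto> R(u, v) w\<close>; with these signs round
  spheres have positive curvature.
\<close>

definition riemann ::
    "('e::euclidean_space \<Rightarrow> 'e \<Rightarrow> 'e \<Rightarrow> real) \<Rightarrow> 'e \<Rightarrow> 'e \<Rightarrow> 'e \<Rightarrow> 'e \<Rightarrow> 'e"
  where "riemann G x u v w =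
    dir_deriv (\<lambda>y. christoffel G y v w) x u - dir_deriv (\<lambda>y. christoffel G y u w) x v
    + christoffel G x u (christoffel G x v w) - christoffel G x v (christoffel G x u w)"

definition ricci :: "('e::euclidean_space \<Rightarrow> 'e \<Rightarrow> 'e \<Rightarrow> real) \<Rightarrow> 'e \<Rightarrow> 'e \<Rightarrow> 'e \<Rightarrow> real"
  where "ricci G x v w = (\<Sum>b\<in>Basis. riemann G x b v w \<bullet> b)"

definition scalar :: "('e::euclidean_space \<Rightarrow> 'e \<Rightarrow> 'e \<Rightarrow> real) \<Rightarrow> 'e \<Rightarrow> real"
  where "scalar G x = (\<Sum>b\<in>Basis. sharp G x (ricci G x b) \<bullet> b)"

definition gradient ::
    "('e::euclidean_space \<Rightarrow> 'e \<Rightarrow> 'e \<Rightarrow> real) \<Rightarrow> ('e \<Rightarrow> real) \<Rightarrow> 'e \<Rightarrow> 'e"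
  where "gradient G u x = sharp G x (dir_deriv u x)"

definition hessian ::
    "('e::euclidean_space \<Rightarrow> 'e \<Rightarrow> 'e \<Rightarrow> real) \<Rightarrow> ('e \<Rightarrow> real) \<Rightarrow> 'e \<Rightarrow> 'e \<Rightarrow> 'e \<Rightarrow> real"
  where "hessian G u x v w =
    dir_deriv (\<lambda>y. dir_deriv u y w) x v - dir_deriv u x (christoffel G x v w)"


section \<open>The same notions on a Riemannian manifold\<close>

text \<open>Everything at \<open>p\<close> is computed in the chart of \<open>p\<close>, consistently with the
  identification of the tangent space at \<open>p\<close>.\<close>

definition Ric :: "('a, 'e::euclidean_space) riem \<Rightarrow> 'a \<Rightarrow> 'e \<Rightarrow> 'e \<Rightarrow> real"
  where "Ric M p = ricci (coord_metric M p) (chart_map M p p)"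

definition scalar_curvature :: "('a, 'e::euclidean_space) riem \<Rightarrow> 'a \<Rightarrow> real"
  where "scalar_curvature M p = scalar (coord_metric M p) (chart_map M p p)"

definition grad :: "('a, 'e::euclidean_space) riem \<Rightarrow> ('a \<Rightarrow> real) \<Rightarrow> 'a \<Rightarrow> 'e"
  where "grad M u p = gradient (coord_metric M p) (u \<circ> param M p) (chart_map M p p)"

definition Hess :: "('a, 'e::euclidean_space) riem \<Rightarrow> ('a \<Rightarrow> real) \<Rightarrow> 'a \<Rightarrow> 'e \<Rightarrow> 'e \<Rightarrow> real"
  where "Hess M u p = hessian (coord_metric M p) (u \<circ> param M p) (chart_map M p p)"

definition geodesic :: "('a, 'e::euclidean_space) riem \<Rightarrow> (real \<Rightarrow> 'a) \<Rightarrow> bool"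
  where "geodesic M \<gamma> \<longleftrightarrow>
    (\<forall>p. let c = chart_map M p \<circ> \<gamma>; c' = (\<lambda>t. vector_derivative c (at t)) in
       smooth_on (\<gamma> -` chart_dom M p) c \<and>
       (\<forall>t\<in>\<gamma> -` chart_dom M p.
          vector_derivative c' (at t) + christoffel (coord_metric M p) (c t) (c' t) (c' t) = 0))"

text \<open>Completeness is geodesic completeness: all geodesics extend to the whole real line.\<close>

definition complete_manifold :: "('a, 'e::euclidean_space) riem \<Rightarrow> bool"
  where "complete_manifold M \<longleftrightarrow>
    (\<forall>p v. \<exists>\<gamma>. geodesic M \<gamma> \<and> \<gamma> 0 = p \<and> vector_derivative (chart_map M p \<circ> \<gamma>) (at 0) = v)"


section \<open>Warped products and Yamabe gradient solitons\<close>

text \<open>The metric is \<open>g\<^sub>B + f\<^sup>2 g\<^sub>F\<close>; its manifold carries the product charts.\<close>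

definition warped_product ::
    "('a, 'e::euclidean_space) riem \<Rightarrow> ('a \<Rightarrow> real) \<Rightarrow> ('b, 'd::euclidean_space) riem
     \<Rightarrow> ('a \<times> 'b, 'e \<times> 'd) riem"
  where "warped_product B f F =
    \<lparr> chart_dom = (\<lambda>(x, y). chart_dom B x \<times> chart_dom F y),
      chart_map = (\<lambda>(x, y). map_prod (chart_map B x) (chart_map F y)),
      metric = (\<lambda>(x, y) (v, v') (w, w'). metric B x v w + (f x)\<^sup>2 * metric F y v' w') \<rparr>"

definition warping_function :: "('a, 'e::euclidean_space) riem \<Rightarrow> ('a \<Rightarrow> real) \<Rightarrow> bool"
  where "warping_function B f \<longleftrightarrow>
    smooth_fun B f \<and> (\<forall>x. f x > 0) \<and> \<not> f constant_on UNIV"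

definition yamabe_gradient_soliton ::
    "('a::{t2_space, second_countable_topology}, 'e::euclidean_space) riem
     \<Rightarrow> ('a \<Rightarrow> real) \<Rightarrow> real \<Rightarrow> bool"
  where "yamabe_gradient_soliton M h \<rho> \<longleftrightarrow>
    riemannian_manifold M \<and> connected (UNIV :: 'a set) \<and> smooth_fun M h \<and>
    (\<forall>p v w. Hess M h p v w = (scalar_curvature M p - \<rho>) * metric M p v w)"

definition trivial_soliton :: "('a \<Rightarrow> real) \<Rightarrow> bool"
  where "trivial_soliton h \<longleftrightarrow> h constant_on UNIV"

text \<open>The function on the base corresponding to a soliton function \<open>h\<close> that does not
  depend on the fiber: its restriction to the slice through a fiber point \<open>y\<close>.\<close>

definition base_function :: "('a \<times> 'b \<Rightarrow> real) \<Rightarrow> 'b \<Rightarrow> 'a \<Rightarrow> real"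
  where "base_function h y = (\<lambda>x. h (x, y))"

definition unit_grad :: "('a, 'e::euclidean_space) riem \<Rightarrow> ('a \<Rightarrow> real) \<Rightarrow> 'a \<Rightarrow> 'e"
  where "unit_grad M u p = grad M u p /\<^sub>R tnorm M p (grad M u p)"

end

theory Submission
  imports Defs
begin

text \<open>
  Put \<open>N = n + m\<close> and \<open>\<phi> = R - \<rho>\<close>, so that \<open>Hess h = \<phi> g\<close>; the claim follows from \<open>\<phi> \<ge> min 0 (- \<rho>)\<close>.
  Commuting derivatives of \<open>X = \<nabla>h\<close> gives \<open>Rm(u, v)X = d\<phi>(u) v - d\<phi>(v) u\<close>. Hence \<open>d\<phi> = \<mu> dh\<close>
  wherever \<open>X \<noteq> 0\<close>, and with the second Bianchi identity
  \<open>\<mu> |X|\<^sup>2 = - 2 \<phi> (\<phi> + \<rho>) - 2 (N - 1) (X(\<mu>) + N \<mu> \<phi>)\<close>.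

  This identity, together with completeness of the base, shows that \<open>h\<close> does not depend on the fibre. The
  fibre part of the soliton equation is then \<open>df(X) = \<phi> f\<close>. A critical point of \<open>h\<close> therefore has
  \<open>\<phi> = 0\<close>. Any other point lies on a complete unit speed geodesic of the base tangent to \<open>X\<close>, along
  which \<open>|X|\<close> is a positive constant times \<open>f\<close>. So \<open>u = |X|\<close> is positive on the whole real line, where
  \<open>u' = \<phi>\<close>, \<open>\<phi>' = \<mu> u\<close> and the identity above is a differential equation for \<open>\<mu>\<close>. If \<open>\<phi> < min 0 (- \<rho>)\<close>
  somewhere, then either \<open>u\<close> becomes negative in forward time or it blows up in finite backward time.
\<close>

section \<open>Calculus of smooth functions\<close>

text \<open>Near a point with X \<noteq> 0 the metric splits as \<open>dt^2 + u^2 g_N\<close>, where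
  u = |X| depends on t only and g_N is a metric on the level set of h. The consequences of this
  splitting are obtained here without constructing it. With p = N - 1, the quantity
  \<open>u^2 (\<phi> + \<rho>) + 2 p u^2 \<mu> + p (p - 1) \<phi>^2\<close> is the scalar curvature
  of g_N; it is constant along the geodesic and drives the blow-up in backward time.

  Two obstacles shape the proof. Only the base is complete, so the geodesics of M known to exist for
  all time are the lifts of base geodesics, and the equation closes up along them only if X is
  tangent to the base; hence the independence of the fibre has to be settled beforehand. Moreover,
  curvature, gradient and Hessian at a point are defined through the chart designated for that
  point, while the equation runs along curves that leave every chart. Each quantity is therefore
  computed in a single chart and transported by its invariance under transition maps.\<close>

lemma differentiable_onD_open:
  assumes "open S" "F differentiable_on S" "x \<in> S"
  shows "F differentiable (at x)"
  using assms by (simp add: differentiable_on_eq_differentiable_at)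

lemma dir_deriv_eq: "(F has_derivative F') (at x) \<Longrightarrow> dir_deriv F x v = F' v"
  using frechet_derivative_at by fastforce

lemma has_dir_deriv: "F differentiable (at x) \<Longrightarrow> (F has_derivative dir_deriv F x) (at x)"
  by (simp add: frechet_derivative_works)

text \<open>\<open>frechet_derivative\<close> is a choice among all derivatives. Both functions have
  the same derivatives at \<open>x\<close>, so the choices coincide even where neither function is
  differentiable.\<close>

lemma dir_deriv_cong:
  assumes "open S" "x \<in> S" "\<And>y. y \<in> S \<Longrightarrow> F y = G y"
  shows "dir_deriv F x = dir_deriv G x"
proof -
  have "(F has_derivative D) (at x) \<longleftrightarrow> (G has_derivative D) (at x)" for D
    using has_derivative_transform_within_open[OF _ assms(1,2)] assms(3) by metis
  then show ?thesis unfolding frechet_derivative_def by simp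
qed

lemma dir_deriv_apply_cong:
  "open S \<Longrightarrow> x \<in> S \<Longrightarrow> (\<And>y. y \<in> S \<Longrightarrow> F y = G y) \<Longrightarrow> dir_deriv F x u = dir_deriv G x u"
  by (rule fun_cong[OF dir_deriv_cong])

section \<open>Closure properties of C^k and smooth maps\<close>

lemma Ck_on_cong:
  assumes "open S" "\<And>x. x \<in> S \<Longrightarrow> F x = G x" "Ck_on k S F"
  shows "Ck_on k S G"
  using assms(2,3)
proof (induction k arbitrary: F G)
  case 0
  then show ?case using continuous_on_cong[of S S F G] by simp
next
  case (Suc k)
  have "G differentiable_on S"
    unfolding differentiable_on_eq_differentiable_at[OF assms(1)]
  proof
    fix x assume x: "x \<in> S"
    then have "(F has_derivative dir_deriv F x) (at x)"
      using Suc.prems differentiable_onD_open[OF assms(1)] by (auto intro: has_dir_deriv)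
    then have "(G has_derivative dir_deriv F x) (at x)"
      by (rule has_derivative_transform_within_open[OF _ assms(1) x]) (rule Suc.prems)
    then show "G differentiable (at x)" by (auto simp: differentiable_def)
  qed
  moreover have "Ck_on k S (\<lambda>x. dir_deriv G x v)" for v
    by (rule Suc.IH[of "\<lambda>x. dir_deriv F x v"])
      (use Suc.prems dir_deriv_cong[OF \<open>open S\<close>, of _ F G] in auto)
  ultimately show ?case by simp
qed

lemma Ck_on_Suc_imp: "Ck_on (Suc k) S F \<Longrightarrow> Ck_on k S F"
proof (induction k arbitrary: F)
  case 0
  then show ?case by (simp add: differentiable_imp_continuous_on)
next
  case (Suc k)
  then show ?case by (metis Ck_on.simps(2))
qed

lemma Ck_on_subset: "Ck_on k S F \<Longrightarrow> T \<subseteq> S \<Longrightarrow> Ck_on k T F"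
proof (induction k arbitrary: F)
  case 0
  then show ?case by (auto intro: continuous_on_subset)
next
  case (Suc k)
  then show ?case by (auto intro: differentiable_on_subset)
qed

lemma Ck_on_const: "Ck_on k S (\<lambda>x. c)"
proof (induction k arbitrary: c)
  case (Suc k)
  have "dir_deriv (\<lambda>x. c) x v = 0" for x v :: 'a
    by (rule dir_deriv_eq) simp
  then show ?case using Suc by simp
qed simp

lemma Ck_on_bounded_linear:
  assumes "bounded_linear L" "open S" "Ck_on k S F"
  shows "Ck_on k S (\<lambda>x. L (F x))"
  using assms(3)
proof (induction k arbitrary: F)
  case 0
  then show ?case
    using bounded_linear.continuous_on[OF assms(1)] by simp
next
  case (Suc k)
  have hd: "((\<lambda>x. L (F x)) has_derivative (\<lambda>v. L (dir_deriv F x v))) (at x)" if "x \<in> S" for x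
    using Suc.prems that differentiable_onD_open[OF \<open>open S\<close>]
    by (auto intro!: bounded_linear.has_derivative[OF assms(1)] has_dir_deriv)
  have "Ck_on k S (\<lambda>x. dir_deriv (\<lambda>x. L (F x)) x v)" for v
    by (rule Ck_on_cong[OF \<open>open S\<close>, of "\<lambda>x. L (dir_deriv F x v)"])
      (use Suc dir_deriv_eq[OF hd] in auto)
  then show ?case using hd
    by (auto simp: differentiable_on_eq_differentiable_at[OF \<open>open S\<close>] differentiable_def)
qed

lemma Ck_on_add:
  assumes "open S" "Ck_on k S F" "Ck_on k S G"
  shows "Ck_on k S (\<lambda>x. F x + G x)"
  using assms(2,3)
proof (induction k arbitrary: F G)
  case (Suc k)
  have hd: "((\<lambda>x. F x + G x) has_derivative (\<lambda>v. dir_deriv F x v + dir_deriv G x v)) (at x)"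
    if "x \<in> S" for x
    using Suc.prems that differentiable_onD_open[OF \<open>open S\<close>]
    by (auto intro!: has_derivative_add has_dir_deriv)
  have "Ck_on k S (\<lambda>x. dir_deriv (\<lambda>x. F x + G x) x v)" for v
    by (rule Ck_on_cong[OF \<open>open S\<close>, of "\<lambda>x. dir_deriv F x v + dir_deriv G x v"])
      (use Suc dir_deriv_eq[OF hd] in auto)
  then show ?case using hd
    by (auto simp: differentiable_on_eq_differentiable_at[OF \<open>open S\<close>] differentiable_def)
qed (simp add: continuous_on_add)

lemma Ck_on_diff:
  assumes "open S" "Ck_on k S F" "Ck_on k S G"
  shows "Ck_on k S (\<lambda>x. F x - G x)"
  using Ck_on_add[OF assms(1,2) Ck_on_bounded_linear[OF bounded_linear_minus[OF bounded_linear_ident] assms(1,3)]]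
  by simp

lemma Ck_on_bounded_bilinear:
  assumes B: "bounded_bilinear B" and "open S" "Ck_on k S F" "Ck_on k S G"
  shows "Ck_on k S (\<lambda>x. B (F x) (G x))"
  using assms(3,4)
proof (induction k arbitrary: F G)
  case 0
  then show ?case using bounded_bilinear.continuous_on[OF B] by simp
next
  case (Suc k)
  have hd: "((\<lambda>x. B (F x) (G x)) has_derivative
      (\<lambda>v. B (F x) (dir_deriv G x v) + B (dir_deriv F x v) (G x))) (at x)"
    if "x \<in> S" for x
  proof -
    have "F differentiable (at x)" "G differentiable (at x)"
      using Suc.prems differentiable_onD_open[OF \<open>open S\<close> _ that] by auto
    then show ?thesis by (intro bounded_bilinear.FDERIV[OF B] has_dir_deriv)
  qed
  have "Ck_on k S (\<lambda>x. dir_deriv (\<lambda>x. B (F x) (G x)) x v)" for v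
  proof (rule Ck_on_cong[OF \<open>open S\<close>])
    show "Ck_on k S (\<lambda>x. B (F x) (dir_deriv G x v) + B (dir_deriv F x v) (G x))"
      by (intro Ck_on_add[OF \<open>open S\<close>] Suc.IH) (use Suc.prems Ck_on_Suc_imp in auto)
  qed (use dir_deriv_eq[OF hd] in auto)
  then show ?case using hd
    by (auto simp: differentiable_on_eq_differentiable_at[OF \<open>open S\<close>] differentiable_def)
qed

lemma Ck_on_sum:
  assumes "open S" "finite I" "\<And>i. i \<in> I \<Longrightarrow> Ck_on k S (F i)"
  shows "Ck_on k S (\<lambda>x. \<Sum>i\<in>I. F i x)"
  using assms(2,3)
proof (induction I rule: finite_induct)
  case empty
  then show ?case by (simp add: Ck_on_const)
next
  case (insert i I)
  then show ?case by (simp add: Ck_on_add[OF \<open>open S\<close>])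
qed

lemma linear_basis_sum:
  fixes T :: "'e::euclidean_space \<Rightarrow> 'f::real_vector"
  assumes "linear T"
  shows "T y = (\<Sum>b\<in>Basis. (y \<bullet> b) *\<^sub>R T b)"
proof -
  have "T (\<Sum>b\<in>Basis. (y \<bullet> b) *\<^sub>R b) = (\<Sum>b\<in>Basis. (y \<bullet> b) *\<^sub>R T b)"
    using assms by (simp add: linear_sum linear_cmul)
  then show ?thesis by (simp add: euclidean_representation)
qed

lemma smooth_on_open: "smooth_on S F \<Longrightarrow> open S"
  by (simp add: smooth_on_def)

lemma smooth_on_dir_deriv: "smooth_on S F \<Longrightarrow> smooth_on S (\<lambda>x. dir_deriv F x v)"
  unfolding smooth_on_def by (metis Ck_on.simps(2))

lemma smooth_on_differentiable: "smooth_on S F \<Longrightarrow> x \<in> S \<Longrightarrow> F differentiable (at x)"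
  unfolding smooth_on_def using differentiable_onD_open Ck_on.simps(2) by metis

lemma smooth_on_has_derivative:
  "smooth_on S F \<Longrightarrow> x \<in> S \<Longrightarrow> (F has_derivative dir_deriv F x) (at x)"
  by (intro has_dir_deriv smooth_on_differentiable)

lemma smooth_on_continuous: "smooth_on S F \<Longrightarrow> continuous_on S F"
  unfolding smooth_on_def using Ck_on.simps(1) by metis

lemma smooth_on_cong: "smooth_on S F \<Longrightarrow> (\<And>x. x \<in> S \<Longrightarrow> F x = G x) \<Longrightarrow> smooth_on S G"
  unfolding smooth_on_def using Ck_on_cong by metis

lemma smooth_on_subset: "smooth_on S F \<Longrightarrow> T \<subseteq> S \<Longrightarrow> open T \<Longrightarrow> smooth_on T F"
  unfolding smooth_on_def using Ck_on_subset by metis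

lemma smooth_on_const: "open S \<Longrightarrow> smooth_on S (\<lambda>x. c)"
  unfolding smooth_on_def using Ck_on_const by metis

lemma smooth_on_add: "smooth_on S F \<Longrightarrow> smooth_on S G \<Longrightarrow> smooth_on S (\<lambda>x. F x + G x)"
  unfolding smooth_on_def using Ck_on_add by metis

lemma smooth_on_bounded_linear: "bounded_linear L \<Longrightarrow> smooth_on S F \<Longrightarrow> smooth_on S (\<lambda>x. L (F x))"
  unfolding smooth_on_def using Ck_on_bounded_linear by metis

lemmas smooth_on_inner_left = smooth_on_bounded_linear[OF bounded_linear_inner_left]

lemma smooth_on_diff: "smooth_on S F \<Longrightarrow> smooth_on S G \<Longrightarrow> smooth_on S (\<lambda>x. F x - G x)"
  unfolding smooth_on_def using Ck_on_diff by metis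

lemma smooth_on_sum:
  "open S \<Longrightarrow> finite I \<Longrightarrow> (\<And>i. i \<in> I \<Longrightarrow> smooth_on S (F i)) \<Longrightarrow> smooth_on S (\<lambda>x. \<Sum>i\<in>I. F i x)"
  unfolding smooth_on_def by (intro conjI allI Ck_on_sum) auto

lemma sum_scaleR_Basis_inner:
  fixes L :: "'e::euclidean_space \<Rightarrow> real"
  assumes "linear L"
  shows "(\<Sum>b\<in>Basis. L b *\<^sub>R b) \<bullet> w = L w"
proof -
  have "(\<Sum>b\<in>Basis. L b *\<^sub>R b) \<bullet> w = (\<Sum>b\<in>Basis. (w \<bullet> b) *\<^sub>R L b)"
    unfolding inner_sum_left by (intro sum.cong refl) (simp add: inner_commute)
  then show ?thesis using linear_basis_sum[OF assms, of w] by simp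
qed

lemma linear_dir_deriv: "F differentiable (at x) \<Longrightarrow> linear (dir_deriv F x)"
  using has_dir_deriv has_derivative_bounded_linear bounded_linear.linear by blast

section \<open>Tensors applied to varying arguments\<close>

lemma Ck_on_linear_apply:
  fixes T :: "'e::euclidean_space \<Rightarrow> 'g::euclidean_space \<Rightarrow> 'f::real_normed_vector"
  assumes "open S" "\<And>y. y \<in> S \<Longrightarrow> linear (T y)" "\<And>v. Ck_on k S (\<lambda>y. T y v)" "Ck_on k S Y"
  shows "Ck_on k S (\<lambda>y. T y (Y y))"
proof (rule Ck_on_cong[OF assms(1)])
  show "Ck_on k S (\<lambda>y. \<Sum>b\<in>Basis. (Y y \<bullet> b) *\<^sub>R T y b)"
    by (intro Ck_on_sum Ck_on_bounded_bilinear[OF bounded_bilinear_scaleR]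
        Ck_on_bounded_linear[OF bounded_linear_inner_left] assms) auto
  show "(\<Sum>b\<in>Basis. (Y y \<bullet> b) *\<^sub>R T y b) = T y (Y y)" if "y \<in> S" for y
    using linear_basis_sum[OF assms(2)[OF that], of "Y y"] by simp
qed

lemma smooth_on_linear_apply:
  fixes T :: "'e::euclidean_space \<Rightarrow> 'g::euclidean_space \<Rightarrow> 'f::real_normed_vector"
  assumes "open S" "\<And>y. y \<in> S \<Longrightarrow> linear (T y)" "\<And>v. smooth_on S (\<lambda>y. T y v)" "smooth_on S Y"
  shows "smooth_on S (\<lambda>y. T y (Y y))"
  using assms(3,4) Ck_on_linear_apply[OF assms(1,2)] assms(1) unfolding smooth_on_def by simp

text \<open>Tensors are curried functions whose derivatives are known for constant arguments only.
  Expanding the argument in the standard basis gives the Leibniz rule for varying ones.\<close>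

lemma has_derivative_linear_apply:
  fixes T :: "'e::real_normed_vector \<Rightarrow> 'g::euclidean_space \<Rightarrow> 'f::real_normed_vector"
  assumes "open S" "x \<in> S" "\<And>y. y \<in> S \<Longrightarrow> linear (T y)"
    and T': "\<And>v. ((\<lambda>y. T y v) has_derivative T' v) (at x)" and Y: "(Y has_derivative Y') (at x)"
  shows "((\<lambda>y. T y (Y y)) has_derivative (\<lambda>u. T' (Y x) u + T x (Y' u))) (at x)"
proof (rule has_derivative_transform_within_open[OF _ assms(1,2)])
  let ?S = "\<lambda>y. \<Sum>b\<in>Basis. (Y y \<bullet> b) *\<^sub>R T y b"
  \<comment> \<open>Linearity of \<open>T'\<close> in its first argument is not assumed. It follows
    from uniqueness of the derivative, with the vector frozen at \<open>Y x\<close>.\<close>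
  have "((\<lambda>y. T y (\<Sum>b\<in>Basis. (Y x \<bullet> b) *\<^sub>R b)) has_derivative (\<lambda>u. \<Sum>b\<in>Basis. (Y x \<bullet> b) *\<^sub>R T' b u)) (at x)"
    by (rule has_derivative_transform_within_open[OF _ assms(1,2),
          where f = "\<lambda>y. \<Sum>b\<in>Basis. (Y x \<bullet> b) *\<^sub>R T y b"])
      (auto intro!: derivative_eq_intros T' simp: linear_sum[OF assms(3)] linear_cmul[OF assms(3)])
  then have T'Y: "(\<Sum>b\<in>Basis. (Y x \<bullet> b) *\<^sub>R T' b u) = T' (Y x) u" for u
    using fun_cong[OF has_derivative_unique[OF _ T'[of "Y x"]]] by (simp add: euclidean_representation)
  have "(?S has_derivative (\<lambda>u. \<Sum>b\<in>Basis. (Y x \<bullet> b) *\<^sub>R T' b u + (Y' u \<bullet> b) *\<^sub>R T x b)) (at x)"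
    by (auto intro!: derivative_eq_intros T' Y)
  then show "(?S has_derivative (\<lambda>u. T' (Y x) u + T x (Y' u))) (at x)"
    by (simp add: sum.distrib T'Y flip: linear_basis_sum[OF assms(3)[OF assms(2)]])
  show "?S y = T y (Y y)" if "y \<in> S" for y
    using linear_basis_sum[OF assms(3)[OF that], of "Y y"] by simp
qed

lemma has_derivative_bilinear_apply:
  fixes T :: "'e::real_normed_vector \<Rightarrow> 'g::euclidean_space \<Rightarrow> 'h::euclidean_space \<Rightarrow> 'f::real_normed_vector"
  assumes "open S" "x \<in> S" "\<And>y. y \<in> S \<Longrightarrow> bilinear (T y)"
    and T': "\<And>v w. ((\<lambda>y. T y v w) has_derivative T' v w) (at x)"
    and Y: "(Y has_derivative Y') (at x)" and Z: "(Z has_derivative Z') (at x)"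
  shows "((\<lambda>y. T y (Y y) (Z y)) has_derivative
    (\<lambda>u. T' (Y x) (Z x) u + T x (Y' u) (Z x) + T x (Y x) (Z' u))) (at x)"
proof -
  have "((\<lambda>y. T y (Y y) w) has_derivative (\<lambda>u. T' (Y x) w u + T x (Y' u) w)) (at x)" for w
    using has_derivative_linear_apply[OF assms(1,2), of "\<lambda>y v. T y v w" "\<lambda>v. T' v w" Y Y'] assms
    by (auto simp: bilinear_def)
  then show ?thesis
    using has_derivative_linear_apply[OF assms(1,2), of "\<lambda>y. T y (Y y)" "\<lambda>w u. T' (Y x) w u + T x (Y' u) w" Z Z'] assms
    by (auto simp: bilinear_def)
qed

lemma along_curve:
  fixes F :: "'e::real_normed_vector \<Rightarrow> 'f::real_normed_vector"
  assumes "(F has_derivative F') (at (C t))" "(C has_vector_derivative c) (at t)"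
  shows "((\<lambda>s. F (C s)) has_vector_derivative F' c) (at t)"
  using has_derivative_compose[OF assms(2)[unfolded has_vector_derivative_def] assms(1)]
    linear_cmul[OF bounded_linear.linear[OF has_derivative_bounded_linear[OF assms(1)]]]
  by (simp add: has_vector_derivative_def)

section \<open>Symmetry of second derivatives\<close>

lemma second_difference_mean_value:
  fixes F :: "'e::euclidean_space \<Rightarrow> real"
  assumes F: "\<And>y. y \<in> ball x r \<Longrightarrow> F differentiable (at y)"
    and DF: "\<And>y. y \<in> ball x r \<Longrightarrow> (\<lambda>z. dir_deriv F z u) differentiable (at y)"
    and s: "0 < s" "s * (norm u + norm v) < r"
  shows "\<exists>y. dist x y \<le> s * (norm u + norm v) \<and>
     F (x + s *\<^sub>R u + s *\<^sub>R v) - F (x + s *\<^sub>R u) - F (x + s *\<^sub>R v) + F x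
       = s * s * dir_deriv (\<lambda>z. dir_deriv F z u) y v"
proof -
  have near: "x + a *\<^sub>R u + b *\<^sub>R v \<in> ball x r" "dist x (x + a *\<^sub>R u + b *\<^sub>R v) \<le> s * (norm u + norm v)"
    if "0 \<le> a" "a \<le> s" "0 \<le> b" "b \<le> s" for a b
  proof -
    have "norm (a *\<^sub>R u + b *\<^sub>R v) \<le> a * norm u + b * norm v"
      using norm_triangle_ineq[of "a *\<^sub>R u" "b *\<^sub>R v"] that by simp
    also have "\<dots> \<le> s * norm u + s * norm v"
      using that by (intro add_mono mult_right_mono) auto
    finally have *: "norm (a *\<^sub>R u + b *\<^sub>R v) \<le> s * (norm u + norm v)" by (simp add: algebra_simps)
    moreover have "dist x (x + a *\<^sub>R u + b *\<^sub>R v) = norm (a *\<^sub>R u + b *\<^sub>R v)"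
      by (simp add: dist_norm norm_minus_commute algebra_simps)
    ultimately show "x + a *\<^sub>R u + b *\<^sub>R v \<in> ball x r" "dist x (x + a *\<^sub>R u + b *\<^sub>R v) \<le> s * (norm u + norm v)"
      using s by auto
  qed
  define g where "g a = F (x + a *\<^sub>R u + s *\<^sub>R v) - F (x + a *\<^sub>R u)" for a
  have der: "((\<lambda>a. F (x + a *\<^sub>R u + b *\<^sub>R v)) has_real_derivative dir_deriv F (x + a *\<^sub>R u + b *\<^sub>R v) u) (at a)"
    if "0 \<le> a" "a \<le> s" "0 \<le> b" "b \<le> s" for a b
  proof -
    have "(F has_derivative dir_deriv F (x + a *\<^sub>R u + b *\<^sub>R v)) (at (x + a *\<^sub>R u + b *\<^sub>R v))"
      by (intro has_dir_deriv F near that)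
    moreover have "((\<lambda>a. x + a *\<^sub>R u + b *\<^sub>R v) has_derivative (\<lambda>h. h *\<^sub>R u)) (at a)"
      by (auto intro!: derivative_eq_intros)
    ultimately have "((\<lambda>a. F (x + a *\<^sub>R u + b *\<^sub>R v)) has_derivative (\<lambda>h. dir_deriv F (x + a *\<^sub>R u + b *\<^sub>R v) (h *\<^sub>R u))) (at a)"
      using has_derivative_compose by blast
    then show ?thesis
      using linear_cmul[OF linear_dir_deriv[OF F[OF near(1)[OF that]]]]
      by (simp add: has_field_derivative_def mult.commute[of _ "dir_deriv _ _ _"] mult_commute_abs)
  qed
  \<comment> \<open>The mean value theorem is applied to the increment of \<open>F\<close> in
    direction \<open>s v\<close> as a function of the distance travelled along \<open>u\<close>; a
    second application, to the derivative in direction \<open>u\<close>, then runs along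
    \<open>v\<close>.\<close>
  have "\<exists>a. 0 < a \<and> a < s \<and> g s - g 0 = (s - 0) * (dir_deriv F (x + a *\<^sub>R u + s *\<^sub>R v) u - dir_deriv F (x + a *\<^sub>R u) u)"
  proof (rule MVT2)
    fix a assume "0 \<le> a" "a \<le> s"
    then show "(g has_real_derivative dir_deriv F (x + a *\<^sub>R u + s *\<^sub>R v) u - dir_deriv F (x + a *\<^sub>R u) u) (at a)"
      unfolding g_def using der[of a s] der[of a 0] s by (auto intro!: DERIV_diff)
  qed (use s in auto)
  then obtain a where a: "0 < a" "a < s"
    "g s - g 0 = s * (dir_deriv F (x + a *\<^sub>R u + s *\<^sub>R v) u - dir_deriv F (x + a *\<^sub>R u) u)" by auto
  define k where "k b = dir_deriv F (x + a *\<^sub>R u + b *\<^sub>R v) u" for b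
  have "\<exists>b. 0 < b \<and> b < s \<and> k s - k 0 = (s - 0) * dir_deriv (\<lambda>z. dir_deriv F z u) (x + a *\<^sub>R u + b *\<^sub>R v) v"
  proof (rule MVT2)
    fix b assume b: "0 \<le> b" "b \<le> s"
    let ?y = "x + a *\<^sub>R u + b *\<^sub>R v"
    have y: "?y \<in> ball x r" using near a b by auto
    have "((\<lambda>z. dir_deriv F z u) has_derivative dir_deriv (\<lambda>z. dir_deriv F z u) ?y) (at ?y)"
      by (intro has_dir_deriv DF y)
    moreover have "((\<lambda>b. x + a *\<^sub>R u + b *\<^sub>R v) has_derivative (\<lambda>h. h *\<^sub>R v)) (at b)"
      by (auto intro!: derivative_eq_intros)
    ultimately have "(k has_derivative (\<lambda>h. dir_deriv (\<lambda>z. dir_deriv F z u) ?y (h *\<^sub>R v))) (at b)"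
      unfolding k_def using has_derivative_compose by blast
    then show "(k has_real_derivative dir_deriv (\<lambda>z. dir_deriv F z u) ?y v) (at b)"
      using linear_cmul[OF linear_dir_deriv[OF DF[OF y]]]
      by (simp add: has_field_derivative_def mult.commute[of _ "dir_deriv _ _ _"] mult_commute_abs)
  qed (use s in auto)
  then obtain b where b: "0 < b" "b < s"
    "k s - k 0 = s * dir_deriv (\<lambda>z. dir_deriv F z u) (x + a *\<^sub>R u + b *\<^sub>R v) v" by auto
  show ?thesis
    using near(2)[of a b] a b by (intro exI[of _ "x + a *\<^sub>R u + b *\<^sub>R v"]) (auto simp: g_def k_def)
qed

text \<open>The second difference is symmetric in \<open>u\<close> and \<open>v\<close>. Divided by
  \<open>s * s\<close>, it is a value of either mixed derivative at some point close to
  \<open>x\<close>, and continuity at \<open>x\<close> closes the gap.\<close>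

lemma dir_deriv_commute_real:
  fixes F :: "'e::euclidean_space \<Rightarrow> real"
  assumes F: "smooth_on S F" and x: "x \<in> S"
  shows "dir_deriv (\<lambda>z. dir_deriv F z u) x v = dir_deriv (\<lambda>z. dir_deriv F z v) x u"
proof -
  define p where "p y = dir_deriv (\<lambda>z. dir_deriv F z u) y v" for y
  define q where "q y = dir_deriv (\<lambda>z. dir_deriv F z v) y u" for y
  obtain r where r: "0 < r" "ball x r \<subseteq> S"
    using smooth_on_open[OF F] x openE by blast
  have cont: "isCont p x" "isCont q x"
    unfolding p_def q_def
    using smooth_on_continuous[OF smooth_on_dir_deriv[OF smooth_on_dir_deriv[OF F]]] smooth_on_open[OF F] x
    by (auto simp: continuous_on_eq_continuous_at)
  have "\<bar>p x - q x\<bar> \<le> e" if "0 < e" for e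
  proof -
    obtain d1 where d1: "0 < d1" "\<And>y. dist y x < d1 \<Longrightarrow> dist (p y) (p x) < e / 2"
      using cont(1) \<open>0 < e\<close> unfolding continuous_at_eps_delta dist_norm by (meson half_gt_zero)
    obtain d2 where d2: "0 < d2" "\<And>y. dist y x < d2 \<Longrightarrow> dist (q y) (q x) < e / 2"
      using cont(2) \<open>0 < e\<close> unfolding continuous_at_eps_delta dist_norm by (meson half_gt_zero)
    define \<delta> where "\<delta> = min r (min d1 d2)"
    define s where "s = \<delta> / (norm u + norm v + 1)"
    have n: "norm u + norm v + 1 > 0" using norm_ge_zero[of u] norm_ge_zero[of v] by linarith
    have \<delta>: "0 < \<delta>" using r d1 d2 by (simp add: \<delta>_def)
    have s: "0 < s" using \<delta> n by (simp add: s_def)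
    have "s * (norm u + norm v) < s * (norm u + norm v + 1)" using s by simp
    also have "\<dots> = \<delta>" using n by (simp add: s_def)
    finally have s\<delta>: "s * (norm u + norm v) < \<delta>" .
    have dF: "F differentiable (at y)" "(\<lambda>z. dir_deriv F z w) differentiable (at y)" if "y \<in> ball x r" for y w
      using that r smooth_on_differentiable[OF F] smooth_on_differentiable[OF smooth_on_dir_deriv[OF F]] by auto
    have sr: "s * (norm u + norm v) < r" "s * (norm v + norm u) < r"
      using s\<delta> by (auto simp: \<delta>_def add.commute)
    obtain y where y: "dist x y \<le> s * (norm u + norm v)"
      "F (x + s *\<^sub>R u + s *\<^sub>R v) - F (x + s *\<^sub>R u) - F (x + s *\<^sub>R v) + F x = s * s * p y"
      using second_difference_mean_value[OF dF s sr(1)] unfolding p_def by blast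
    obtain y' where y': "dist x y' \<le> s * (norm v + norm u)"
      "F (x + s *\<^sub>R v + s *\<^sub>R u) - F (x + s *\<^sub>R v) - F (x + s *\<^sub>R u) + F x = s * s * q y'"
      using second_difference_mean_value[OF dF s sr(2)] unfolding q_def by blast
    have "x + s *\<^sub>R v + s *\<^sub>R u = x + s *\<^sub>R u + s *\<^sub>R v"
      by (simp only: add.assoc add.commute[of "s *\<^sub>R v"])
    then have "F (x + s *\<^sub>R v + s *\<^sub>R u) = F (x + s *\<^sub>R u + s *\<^sub>R v)" by (rule arg_cong)
    with y(2) y'(2) have "s * s * p y = s * s * q y'"
      by (simp only:)
    then have "p y = q y'" using s by simp
    moreover have "dist (p y) (p x) < e / 2" "dist (q y') (q x) < e / 2"
      using d1(2)[of y] d2(2)[of y'] y(1) y'(1) s\<delta> by (auto simp: \<delta>_def dist_commute add.commute)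
    ultimately have "dist (p x) (q x) \<le> e / 2 + e / 2"
      using dist_triangle3[of "p x" "q x" "p y"] by simp
    then show ?thesis by (simp add: dist_real_def)
  qed
  then have "\<bar>p x - q x\<bar> \<le> 0" using field_le_epsilon[of "\<bar>p x - q x\<bar>" 0] by simp
  then show ?thesis by (simp add: p_def q_def)
qed

lemma dir_deriv_bounded_linear:
  assumes "bounded_linear L" "F differentiable (at x)"
  shows "dir_deriv (\<lambda>y. L (F y)) x v = L (dir_deriv F x v)"
  by (intro dir_deriv_eq bounded_linear.has_derivative[OF assms(1)] has_dir_deriv assms)

lemma dir_deriv_commute:
  fixes F :: "'e::euclidean_space \<Rightarrow> 'f::euclidean_space"
  assumes F: "smooth_on S F" and x: "x \<in> S"
  shows "dir_deriv (\<lambda>z. dir_deriv F z u) x v = dir_deriv (\<lambda>z. dir_deriv F z v) x u"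
proof (rule euclidean_eqI)
  fix b :: 'f
  have *: "dir_deriv (\<lambda>z. dir_deriv (\<lambda>y. F y \<bullet> b) z u) x v = dir_deriv (\<lambda>z. dir_deriv F z u) x v \<bullet> b" for u v
  proof -
    have "dir_deriv (\<lambda>z. dir_deriv (\<lambda>y. F y \<bullet> b) z u) x v = dir_deriv (\<lambda>z. dir_deriv F z u \<bullet> b) x v"
      by (rule arg_cong2[where f = "\<lambda>a b. a b", OF dir_deriv_cong[OF smooth_on_open[OF F] x] refl])
        (intro dir_deriv_bounded_linear[OF bounded_linear_inner_left] smooth_on_differentiable[OF F])
    then show ?thesis
      by (simp add: dir_deriv_bounded_linear[OF bounded_linear_inner_left]
          smooth_on_differentiable[OF smooth_on_dir_deriv[OF F] x])
  qed
  show "dir_deriv (\<lambda>z. dir_deriv F z u) x v \<bullet> b = dir_deriv (\<lambda>z. dir_deriv F z v) x u \<bullet> b"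
    using dir_deriv_commute_real[OF smooth_on_inner_left[OF F] x] by (simp flip: *)
qed

lemma linear_dir_deriv_param:
  fixes T :: "'e::euclidean_space \<Rightarrow> 'g::real_vector \<Rightarrow> 'f::real_normed_vector"
  assumes "open S" "x \<in> S" "\<And>y. y \<in> S \<Longrightarrow> linear (T y)" "\<And>v. (\<lambda>y. T y v) differentiable (at x)"
  shows "linear (\<lambda>v. dir_deriv (\<lambda>y. T y v) x u)"
proof
  fix v w
  have "dir_deriv (\<lambda>y. T y (v + w)) x u = dir_deriv (\<lambda>y. T y v + T y w) x u"
    by (rule dir_deriv_apply_cong[OF assms(1,2)]) (rule linear_add[OF assms(3)])
  also have "\<dots> = dir_deriv (\<lambda>y. T y v) x u + dir_deriv (\<lambda>y. T y w) x u"
    by (rule dir_deriv_eq[OF has_derivative_add[OF has_dir_deriv has_dir_deriv]]) (rule assms)+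
  finally show "dir_deriv (\<lambda>y. T y (v + w)) x u = dir_deriv (\<lambda>y. T y v) x u + dir_deriv (\<lambda>y. T y w) x u" .
next
  fix r v
  have "dir_deriv (\<lambda>y. T y (r *\<^sub>R v)) x u = dir_deriv (\<lambda>y. r *\<^sub>R T y v) x u"
    by (rule dir_deriv_apply_cong[OF assms(1,2)]) (rule linear_cmul[OF assms(3)])
  also have "\<dots> = r *\<^sub>R dir_deriv (\<lambda>y. T y v) x u"
    by (rule dir_deriv_bounded_linear[OF bounded_linear_scaleR_right assms(4)])
  finally show "dir_deriv (\<lambda>y. T y (r *\<^sub>R v)) x u = r *\<^sub>R dir_deriv (\<lambda>y. T y v) x u" .
qed

section \<open>Traces of linear maps\<close>

definition tr :: "('e::euclidean_space \<Rightarrow> 'e) \<Rightarrow> real"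
  where "tr L = (\<Sum>b\<in>Basis. L b \<bullet> b)"

lemma tr_add: "tr (\<lambda>u. L u + M u) = tr L + tr M"
  and tr_diff: "tr (\<lambda>u. L u - M u) = tr L - tr M"
  and tr_scaleR: "tr (\<lambda>u. r *\<^sub>R L u) = r * tr L"
  by (simp_all add: tr_def inner_add_left inner_diff_left sum.distrib sum_subtractf sum_distrib_left)

lemma tr_id: "tr (\<lambda>u :: 'e::euclidean_space. u) = DIM('e)"
  by (simp add: tr_def)

lemma tr_rank_one:
  fixes v :: "'e::euclidean_space" and \<alpha> :: "'e \<Rightarrow> real"
  assumes "linear \<alpha>"
  shows "tr (\<lambda>u. \<alpha> u *\<^sub>R v) = \<alpha> v"
  by (simp add: tr_def linear_basis_sum[OF assms, of v] mult.commute)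

text \<open>Cyclicity serves twice: it cancels the Christoffel terms when curvature identities are
  traced, and it makes traces independent of coordinates.\<close>

lemma tr_commute:
  fixes L M :: "'e::euclidean_space \<Rightarrow> 'e"
  assumes "linear L" "linear M"
  shows "tr (\<lambda>u. L (M u)) = tr (\<lambda>u. M (L u))"
proof -
  have *: "L (M b) \<bullet> b = (\<Sum>c\<in>Basis. (M b \<bullet> c) * (L c \<bullet> b))" if "linear L" for L M :: "'e \<Rightarrow> 'e" and b
    by (subst linear_basis_sum[OF that, of "M b"]) (simp add: inner_sum_left)
  have "tr (\<lambda>u. L (M u)) = (\<Sum>b\<in>Basis. \<Sum>c\<in>Basis. (M b \<bullet> c) * (L c \<bullet> b))"
    unfolding tr_def by (simp add: *[OF assms(1)])
  also have "\<dots> = (\<Sum>c\<in>Basis. \<Sum>b\<in>Basis. (M b \<bullet> c) * (L c \<bullet> b))" by (rule sum.swap)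
  also have "\<dots> = tr (\<lambda>u. M (L u))"
    unfolding tr_def by (simp add: *[OF assms(2)] mult.commute)
  finally show ?thesis .
qed

lemma tr_cong: "(\<And>u. L u = M u) \<Longrightarrow> tr L = tr M"
  by (simp add: tr_def)

section \<open>Riemannian metrics in coordinates\<close>

locale metric_on =
  fixes U :: "'e::euclidean_space set" and G :: "'e \<Rightarrow> 'e \<Rightarrow> 'e \<Rightarrow> real"
  assumes open_U: "open U"
    and smooth_G: "smooth_on U (\<lambda>x. G x v w)"
    and bilinear_G: "x \<in> U \<Longrightarrow> bilinear (G x)"
    and sym_G: "x \<in> U \<Longrightarrow> G x v w = G x w v"
    and pos_G: "x \<in> U \<Longrightarrow> v \<noteq> 0 \<Longrightarrow> G x v v > 0"
begin

lemma linear_G: "x \<in> U \<Longrightarrow> linear (G x v)" "x \<in> U \<Longrightarrow> linear (\<lambda>v. G x v w)"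
  using bilinear_G by (auto simp: bilinear_def)

lemma G_simps:
  assumes "x \<in> U"
  shows "G x (a + b) c = G x a c + G x b c" "G x (a - b) c = G x a c - G x b c"
    "G x c (a + b) = G x c a + G x c b" "G x c (a - b) = G x c a - G x c b"
    "G x (r *\<^sub>R a) c = r * G x a c" "G x c (r *\<^sub>R a) = r * G x c a"
    "G x 0 c = 0" "G x c 0 = 0" "G x (- a) c = - G x a c" "G x c (- a) = - G x c a"
  using linear_G[OF assms, THEN linear_add] linear_G[OF assms, THEN linear_diff]
    linear_G[OF assms, THEN linear_cmul] linear_G[OF assms, THEN linear_0] linear_G[OF assms, THEN linear_neg]
  by auto

lemma nondegenerate:
  assumes "x \<in> U" "\<And>w. G x a w = G x b w"
  shows "a = b"
proof (rule ccontr)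
  assume "a \<noteq> b"
  then have "G x (a - b) (a - b) > 0" using pos_G[OF assms(1)] by simp
  then show False using assms by (simp add: G_simps)
qed

section \<open>Raising an index and its smooth dependence on the point\<close>

definition flat :: "'e \<Rightarrow> 'e \<Rightarrow> 'e"
  where "flat x a = (\<Sum>b\<in>Basis. G x a b *\<^sub>R b)"

lemma flat_inner: "x \<in> U \<Longrightarrow> flat x a \<bullet> w = G x a w"
  unfolding flat_def by (rule sum_scaleR_Basis_inner) (rule linear_G)

lemma linear_flat: "x \<in> U \<Longrightarrow> linear (flat x)"
  by (auto simp: flat_def G_simps sum.distrib scaleR_left_distrib scaleR_sum_right intro!: linearI)

lemma ex1_sharp:
  assumes "x \<in> U" "linear \<alpha>"
  shows "\<exists>!z. \<forall>w. G x z w = \<alpha> w"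
proof -
  have "inj (flat x)"
    by (rule injI, rule nondegenerate[OF assms(1)]) (metis flat_inner assms(1))
  then have "surj (flat x)"
    using linear_flat[OF assms(1)] linear_injective_imp_surjective by blast
  then obtain z where z: "flat x z = (\<Sum>b\<in>Basis. \<alpha> b *\<^sub>R b)" by (metis surjD)
  have "G x z w = \<alpha> w" for w
    using flat_inner[OF assms(1), of z w] sum_scaleR_Basis_inner[OF assms(2), of w] z by simp
  then show ?thesis using nondegenerate[OF assms(1)] by metis
qed

lemma G_sharp: "x \<in> U \<Longrightarrow> linear \<alpha> \<Longrightarrow> G x (sharp G x \<alpha>) w = \<alpha> w"
  unfolding sharp_def using theI'[OF ex1_sharp] by blast

lemma sharp_eq:
  assumes "x \<in> U" "\<And>w. G x z w = \<alpha> w"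
  shows "sharp G x \<alpha> = z"
proof -
  have "\<alpha> = G x z" using assms(2) by auto
  then have "linear \<alpha>" using linear_G(1)[OF assms(1)] by metis
  then show ?thesis using G_sharp[OF assms(1)] nondegenerate[OF assms(1)] assms(2) by metis
qed

abbreviation dG :: "'e \<Rightarrow> 'e \<Rightarrow> 'e \<Rightarrow> 'e \<Rightarrow> real"
  where "dG x u v w \<equiv> dir_deriv (\<lambda>y. G y v w) x u"

lemma G_differentiable: "x \<in> U \<Longrightarrow> (\<lambda>y. G y v w) differentiable (at x)"
  by (rule smooth_on_differentiable[OF smooth_G])

lemma linear_dG:
  assumes "x \<in> U"
  shows "linear (\<lambda>u. dG x u v w)" "linear (\<lambda>v. dG x u v w)" "linear (\<lambda>w. dG x u v w)"
    by (rule linear_dir_deriv[OF G_differentiable[OF assms]])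
      (intro linear_dir_deriv_param[OF open_U assms] linear_G G_differentiable[OF assms]; assumption)+

lemma dG_simps:
  assumes "x \<in> U"
  shows "dG x (a + b) v w = dG x a v w + dG x b v w" "dG x (a - b) v w = dG x a v w - dG x b v w"
    "dG x (r *\<^sub>R a) v w = r * dG x a v w"
    "dG x u (a + b) w = dG x u a w + dG x u b w" "dG x u (r *\<^sub>R a) w = r * dG x u a w"
    "dG x u v (a + b) = dG x u v a + dG x u v b" "dG x u v (r *\<^sub>R a) = r * dG x u v a"
  using linear_dG[OF assms, THEN linear_add] linear_dG(1)[OF assms, THEN linear_diff]
    linear_dG[OF assms, THEN linear_cmul] by auto

lemma dG_sym: "x \<in> U \<Longrightarrow> dG x u v w = dG x u w v"
  by (rule dir_deriv_apply_cong[OF open_U]) (auto intro: sym_G)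

text \<open>In place of a formula for the inverse matrix,
  \<open>(x, a) \<mapsto> (x, flat x a)\<close> is treated as a continuous bijection of
  \<open>U \<times> UNIV\<close> with inverse \<open>g\<close>. Invariance of domain makes
  \<open>g\<close> continuous, and the rule for derivatives of inverse maps then makes it
  differentiable.\<close>

lemma sharp_pair_regular:
  defines "g \<equiv> \<lambda>(x, c). (x, sharp G x (\<lambda>w. c \<bullet> w))"
  shows "continuous_on (U \<times> UNIV) g"
    and "x \<in> U \<Longrightarrow> g differentiable (at (x, c))"
proof -
  define \<Theta> where "\<Theta> = (\<lambda>(x, a). (x, flat x a))"
  have op: "open (U \<times> (UNIV :: 'e set))" using open_U by (intro open_Times) auto
  have lin: "linear (\<lambda>w. c \<bullet> w)" for c :: 'e
    by (simp add: bounded_linear.linear bounded_linear_inner_right)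
  have \<Theta>g: "\<Theta> (g p) = p" if "p \<in> U \<times> UNIV" for p
  proof -
    obtain x c where p0: "p = (x, c)" by (cases p)
    with that have p: "p = (x, c)" "x \<in> U" by auto
    have "flat x (sharp G x (\<lambda>w. c \<bullet> w)) = c"
      by (rule euclidean_eqI) (simp add: flat_inner p G_sharp lin)
    then show ?thesis by (simp add: p \<Theta>_def g_def)
  qed
  have g\<Theta>: "g (\<Theta> p) = p" if "p \<in> U \<times> UNIV" for p
    using that by (auto simp: \<Theta>_def g_def flat_inner intro!: sharp_eq)
  have dflat: "((\<lambda>p. flat (fst p) (snd p)) has_derivative
      (\<lambda>h. (\<Sum>b\<in>Basis. dG x (fst h) a b *\<^sub>R b) + flat x (snd h))) (at (x, a))" if "x \<in> U" for x a
  proof -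
    have f: "((\<lambda>p. flat (fst p) v) has_derivative (\<lambda>h. \<Sum>b\<in>Basis. dG x (fst h) v b *\<^sub>R b)) (at (x, a))" for v
      unfolding flat_def
      by (intro has_derivative_sum has_derivative_scaleR_left)
        (rule has_derivative_compose[OF has_derivative_fst[OF has_derivative_ident]],
         simp add: smooth_on_has_derivative[OF smooth_G that])
    have "((\<lambda>p. (\<lambda>p v. flat (fst p) v) p (snd p)) has_derivative
       (\<lambda>h. (\<lambda>v h. \<Sum>b\<in>Basis. dG x (fst h) v b *\<^sub>R b) (snd (x, a)) h + flat (fst (x, a)) (snd h))) (at (x, a))"
      by (rule has_derivative_linear_apply[OF op])
        (use that linear_flat f in \<open>auto intro!: derivative_eq_intros\<close>)
    then show ?thesis by simp
  qed
  have cont\<Theta>: "continuous_on (U \<times> UNIV) \<Theta>"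
  proof -
    have "isCont (\<lambda>p. flat (fst p) (snd p)) p" if "p \<in> U \<times> UNIV" for p
      using dflat[of "fst p" "snd p"] has_derivative_continuous that by fastforce
    then have "continuous_on (U \<times> UNIV) (\<lambda>p. (fst p, flat (fst p) (snd p)))"
      by (intro continuous_on_Pair continuous_on_fst continuous_on_id continuous_at_imp_continuous_on) auto
    then show ?thesis by (simp add: \<Theta>_def case_prod_beta')
  qed
  have img: "\<Theta> ` (U \<times> UNIV) = U \<times> UNIV"
  proof
    show "\<Theta> ` (U \<times> UNIV) \<subseteq> U \<times> UNIV" by (auto simp: \<Theta>_def)
    have "g p \<in> U \<times> UNIV" if "p \<in> U \<times> UNIV" for p using that by (auto simp: g_def)
    then show "U \<times> UNIV \<subseteq> \<Theta> ` (U \<times> UNIV)" using \<Theta>g by (metis image_eqI subsetI)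
  qed
  have "inj_on \<Theta> (U \<times> UNIV)" using g\<Theta> by (metis inj_onI)
  then obtain k where k: "homeomorphism (U \<times> UNIV) (\<Theta> ` (U \<times> UNIV)) \<Theta> k"
    using invariance_of_domain_homeomorphism[OF op cont\<Theta>] by auto
  have kg: "k p = g p" if "p \<in> U \<times> UNIV" for p
  proof -
    have "p \<in> \<Theta> ` (U \<times> UNIV)" using that img by simp
    then obtain q where q: "p = \<Theta> q" "q \<in> U \<times> UNIV" by (rule imageE)
    then have "k p = q" using homeomorphism_apply1[OF k] by simp
    then show ?thesis using g\<Theta>[OF q(2)] q(1) by simp
  qed
  have "continuous_on (U \<times> UNIV) k" using k img by (simp add: homeomorphism_def)
  then show cg: "continuous_on (U \<times> UNIV) g" by (rule continuous_on_eq) (rule kg)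
  assume x: "x \<in> U"
  define a where "a = sharp G x (\<lambda>w. c \<bullet> w)"
  \<comment> \<open>Candidate from differentiating \<open>G x a w = c \<bullet> w\<close>: the
    variation \<open>a'\<close> satisfies
    \<open>G x a' w = c' \<bullet> w - dG x x' a w\<close>.\<close>
  let ?g' = "\<lambda>h. (fst h, sharp G x (\<lambda>w. snd h \<bullet> w - dG x (fst h) a w))"
  have l2: "linear (\<lambda>w. snd h \<bullet> w - dG x (fst h) a w)" for h :: "'e \<times> 'e"
    by (rule linear_compose_sub[OF lin linear_dG(3)[OF x]])
  have "(g has_derivative ?g') (at (x, c))"
  proof (rule has_derivative_inverse_basic[where f = \<Theta>])
    have "g (x, c) = (x, a)" by (simp add: g_def a_def)
    moreover have "((\<lambda>p. (fst p, flat (fst p) (snd p))) has_derivative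
        (\<lambda>h. (fst h, (\<Sum>b\<in>Basis. dG x (fst h) a b *\<^sub>R b) + flat x (snd h)))) (at (x, a))"
      by (intro has_derivative_Pair dflat[OF x] has_derivative_fst has_derivative_ident)
    ultimately show "(\<Theta> has_derivative
        (\<lambda>h. (fst h, (\<Sum>b\<in>Basis. dG x (fst h) a b *\<^sub>R b) + flat x (snd h)))) (at (g (x, c)))"
      by (simp add: \<Theta>_def case_prod_beta')
    have "linear ?g'"
    proof
      fix h k :: "'e \<times> 'e" and r
      have "sharp G x (\<lambda>w. snd (h + k) \<bullet> w - dG x (fst (h + k)) a w)
         = sharp G x (\<lambda>w. snd h \<bullet> w - dG x (fst h) a w) + sharp G x (\<lambda>w. snd k \<bullet> w - dG x (fst k) a w)"
        by (rule sharp_eq[OF x]) (simp add: G_simps G_sharp l2 x dG_simps inner_add_left)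
      then show "?g' (h + k) = ?g' h + ?g' k" by simp
      have "sharp G x (\<lambda>w. snd (r *\<^sub>R h) \<bullet> w - dG x (fst (r *\<^sub>R h)) a w)
         = r *\<^sub>R sharp G x (\<lambda>w. snd h \<bullet> w - dG x (fst h) a w)"
        by (rule sharp_eq[OF x]) (simp add: G_simps G_sharp l2 x dG_simps algebra_simps)
      then show "?g' (r *\<^sub>R h) = r *\<^sub>R ?g' h" by simp
    qed
    then show "bounded_linear ?g'" by (simp add: linear_conv_bounded_linear)
    show "?g' \<circ> (\<lambda>h. (fst h, (\<Sum>b\<in>Basis. dG x (fst h) a b *\<^sub>R b) + flat x (snd h))) = id"
      by (auto simp: fun_eq_iff inner_add_left sum_scaleR_Basis_inner[OF linear_dG(3)[OF x]]
          flat_inner[OF x] intro!: sharp_eq[OF x])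
    show "continuous (at (x, c)) g"
      using cg op x by (simp add: continuous_on_eq_continuous_at)
  qed (use op x \<Theta>g in auto)
  then show "g differentiable (at (x, c))" by (auto simp: differentiable_def)
qed

lemma sharp_continuous:
  assumes "\<And>x. x \<in> U \<Longrightarrow> linear (\<alpha> x)" "\<And>w. continuous_on U (\<lambda>x. \<alpha> x w)"
  shows "continuous_on U (\<lambda>x. sharp G x (\<alpha> x))"
proof -
  let ?c = "\<lambda>x. \<Sum>b\<in>Basis. \<alpha> x b *\<^sub>R b"
  have "continuous_on U (\<lambda>x. (\<lambda>(x, c). (x, sharp G x (\<lambda>w. c \<bullet> w))) (x, ?c x))"
    by (rule continuous_on_compose2[OF sharp_pair_regular(1)])
      (auto intro!: continuous_intros assms)
  then have "continuous_on U (\<lambda>x. sharp G x (\<lambda>w. ?c x \<bullet> w))"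
    using continuous_on_snd by fastforce
  then show ?thesis
    by (rule continuous_on_eq) (rule arg_cong[where f = "sharp G _"], simp add: fun_eq_iff sum_scaleR_Basis_inner assms(1))
qed

lemma sharp_differentiable:
  assumes x: "x \<in> U" and lin: "\<And>x. x \<in> U \<Longrightarrow> linear (\<alpha> x)" and d: "\<And>w. (\<lambda>x. \<alpha> x w) differentiable (at x)"
  shows "(\<lambda>x. sharp G x (\<alpha> x)) differentiable (at x)"
proof -
  let ?c = "\<lambda>x. \<Sum>b\<in>Basis. \<alpha> x b *\<^sub>R b"
  let ?g = "\<lambda>(x, c). (x, sharp G x (\<lambda>w. c \<bullet> w))"
  have "(?c has_derivative (\<lambda>h. \<Sum>b\<in>Basis. dir_deriv (\<lambda>x. \<alpha> x b) x h *\<^sub>R b)) (at x)"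
    by (intro has_derivative_sum has_derivative_scaleR_left has_dir_deriv d)
  then have "(\<lambda>x. (x, ?c x)) differentiable (at x)"
    using has_derivative_Pair[OF has_derivative_ident] differentiable_def by blast
  then obtain D where "((\<lambda>y. ?g (y, ?c y)) has_derivative D) (at x)"
    using differentiable_compose[of ?g "\<lambda>x. (x, ?c x)" x UNIV, OF sharp_pair_regular(2)[OF x]]
    by (auto simp: differentiable_def)
  then have D: "((\<lambda>y. snd (?g (y, ?c y))) has_derivative (\<lambda>h. snd (D h))) (at x)"
    by (rule has_derivative_snd)
  have "((\<lambda>x. sharp G x (\<alpha> x)) has_derivative (\<lambda>h. snd (D h))) (at x)"
    by (rule has_derivative_transform_within_open[OF D open_U x])
      (simp, rule arg_cong[where f = "sharp G _"], simp add: fun_eq_iff sum_scaleR_Basis_inner lin)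
  then show ?thesis by (auto simp: differentiable_def)
qed

lemma dir_deriv_G:
  assumes x: "x \<in> U" and Y: "Y differentiable (at x)" and Z: "Z differentiable (at x)"
  shows "dir_deriv (\<lambda>y. G y (Y y) (Z y)) x u = dG x u (Y x) (Z x)
     + G x (dir_deriv Y x u) (Z x) + G x (Y x) (dir_deriv Z x u)"
  by (rule dir_deriv_eq[OF has_derivative_bilinear_apply[OF open_U x bilinear_G
        has_dir_deriv[OF G_differentiable[OF x]] has_dir_deriv[OF Y] has_dir_deriv[OF Z]]])

lemma dir_deriv_sharp:
  assumes x: "x \<in> U" and lin: "\<And>x. x \<in> U \<Longrightarrow> linear (\<alpha> x)" and d: "\<And>w. (\<lambda>x. \<alpha> x w) differentiable (at x)"
  shows "dir_deriv (\<lambda>x. sharp G x (\<alpha> x)) x u =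
     sharp G x (\<lambda>w. dir_deriv (\<lambda>x. \<alpha> x w) x u - dG x u (sharp G x (\<alpha> x)) w)"
proof (rule sharp_eq[OF x, symmetric])
  fix w
  have "dir_deriv (\<lambda>y. G y (sharp G y (\<alpha> y)) w) x u = dir_deriv (\<lambda>y. \<alpha> y w) x u"
    using dir_deriv_cong[OF open_U x, of "\<lambda>y. G y (sharp G y (\<alpha> y)) w" "\<lambda>y. \<alpha> y w"]
    by (simp add: G_sharp lin)
  moreover have "dir_deriv (\<lambda>y. w) x u = 0" by (rule dir_deriv_eq) simp
  ultimately show "G x (dir_deriv (\<lambda>x. sharp G x (\<alpha> x)) x u) w
      = dir_deriv (\<lambda>x. \<alpha> x w) x u - dG x u (sharp G x (\<alpha> x)) w"
    using dir_deriv_G[OF x sharp_differentiable[OF x lin d] differentiable_const[of w], of u]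
    by (simp add: G_simps[OF x])
qed

text \<open>By \<open>dir_deriv_sharp\<close>, a derivative of \<open>sharp\<close> is
  \<open>sharp\<close> of a covector made of the derivative of \<open>\<alpha>\<close>, of
  \<open>dG\<close> and of \<open>sharp\<close> itself. That covector is C^k by the induction
  hypothesis, so the hypothesis applies a second time, to the new covector.\<close>

lemma Ck_on_sharp:
  assumes "\<And>x. x \<in> U \<Longrightarrow> linear (\<alpha> x)" "\<And>w. Ck_on k U (\<lambda>x. \<alpha> x w)"
  shows "Ck_on k U (\<lambda>x. sharp G x (\<alpha> x))"
  using assms
proof (induction k arbitrary: \<alpha>)
  case 0
  then show ?case using sharp_continuous by simp
next
  case (Suc k)
  have d: "(\<lambda>x. \<alpha> x w) differentiable (at x)" if "x \<in> U" for x w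
    using Suc.prems(2)[of w] differentiable_onD_open[OF open_U _ that] by auto
  have a: "Ck_on k U (\<lambda>x. sharp G x (\<alpha> x))"
    by (rule Suc.IH[OF Suc.prems(1) Ck_on_Suc_imp[OF Suc.prems(2)]])
  have b: "Ck_on k U (\<lambda>x. dG x u v w)" for u v w
    using smooth_on_dir_deriv[OF smooth_G] by (simp add: smooth_on_def)
  have *: "Ck_on k U (\<lambda>x. dG x u (sharp G x (\<alpha> x)) w)" for u w
    by (rule Ck_on_linear_apply[where T = "\<lambda>x v. dG x u v w", OF open_U linear_dG(2) b a])
  have **: "Ck_on k U (\<lambda>x. dir_deriv (\<lambda>x. \<alpha> x w) x u - dG x u (sharp G x (\<alpha> x)) w)" for u w
    by (rule Ck_on_diff[OF open_U _ *]) (use Suc.prems(2)[of w] in simp)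
  have "Ck_on k U (\<lambda>x. sharp G x (\<lambda>w. dir_deriv (\<lambda>x. \<alpha> x w) x u - dG x u (sharp G x (\<alpha> x)) w))" for u
    by (rule Suc.IH[OF _ **])
      (intro linear_compose_sub linear_dG linear_dir_deriv_param[OF open_U] Suc.prems d; assumption)
  then have "Ck_on k U (\<lambda>x. dir_deriv (\<lambda>x. sharp G x (\<alpha> x)) x u)" for u
    by (rule Ck_on_cong[OF open_U, rotated]) (rule dir_deriv_sharp[symmetric], auto intro: Suc.prems d)
  moreover have "(\<lambda>x. sharp G x (\<alpha> x)) differentiable_on U"
    using sharp_differentiable Suc.prems(1) d
    by (auto simp: differentiable_on_eq_differentiable_at[OF open_U])
  ultimately show ?case by simp
qed

lemma smooth_on_sharp:
  assumes "\<And>x. x \<in> U \<Longrightarrow> linear (\<alpha> x)" "\<And>w. smooth_on U (\<lambda>x. \<alpha> x w)"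
  shows "smooth_on U (\<lambda>x. sharp G x (\<alpha> x))"
  using assms Ck_on_sharp unfolding smooth_on_def by blast

section \<open>Curvature\<close>

abbreviation \<Gamma> :: "'e \<Rightarrow> 'e \<Rightarrow> 'e \<Rightarrow> 'e"
  where "\<Gamma> \<equiv> christoffel G"

abbreviation d\<Gamma> :: "'e \<Rightarrow> 'e \<Rightarrow> 'e \<Rightarrow> 'e \<Rightarrow> 'e"
  where "d\<Gamma> x u v w \<equiv> dir_deriv (\<lambda>y. \<Gamma> y v w) x u"

abbreviation R :: "'e \<Rightarrow> 'e \<Rightarrow> 'e \<Rightarrow> 'e \<Rightarrow> 'e"
  where "R \<equiv> riemann G"

abbreviation dR :: "'e \<Rightarrow> 'e \<Rightarrow> 'e \<Rightarrow> 'e \<Rightarrow> 'e \<Rightarrow> 'e"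
  where "dR x z u v w \<equiv> dir_deriv (\<lambda>y. R y u v w) x z"

text \<open>The Christoffel symbols of the first kind, as a covector in \<open>z\<close>.\<close>

definition koszul :: "'e \<Rightarrow> 'e \<Rightarrow> 'e \<Rightarrow> 'e \<Rightarrow> real"
  where "koszul x v w z = (dG x v w z + dG x w v z - dG x z v w) / 2"

lemma linear_koszul: "x \<in> U \<Longrightarrow> linear (koszul x v w)"
  unfolding koszul_def by (rule linearI) (simp_all add: dG_simps field_simps)

lemma christoffel_koszul: "\<Gamma> x v w = sharp G x (koszul x v w)"
  unfolding christoffel_def koszul_def ..

lemma G_christoffel: "x \<in> U \<Longrightarrow> G x (\<Gamma> x v w) z = koszul x v w z"
  unfolding christoffel_koszul by (simp add: G_sharp linear_koszul)

lemma christoffel_eq: "x \<in> U \<Longrightarrow> (\<And>z. G x a z = koszul x v w z) \<Longrightarrow> \<Gamma> x v w = a"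
  by (rule nondegenerate[of x]) (simp_all only: G_christoffel)

lemma christoffel_sym: "x \<in> U \<Longrightarrow> \<Gamma> x v w = \<Gamma> x w v"
  by (rule christoffel_eq) (simp_all add: G_christoffel koszul_def dG_sym[where v = v and w = w])

lemma christoffel_simps:
  assumes "x \<in> U"
  shows "\<Gamma> x (a + b) w = \<Gamma> x a w + \<Gamma> x b w" "\<Gamma> x (r *\<^sub>R a) w = r *\<^sub>R \<Gamma> x a w"
    "\<Gamma> x w (a + b) = \<Gamma> x w a + \<Gamma> x w b" "\<Gamma> x w (r *\<^sub>R a) = r *\<^sub>R \<Gamma> x w a"
  using assms by (auto intro!: christoffel_eq simp: G_simps G_christoffel koszul_def dG_simps field_simps)

lemma bilinear_christoffel: "x \<in> U \<Longrightarrow> bilinear (\<Gamma> x)"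
  by (auto simp: bilinear_def christoffel_simps intro!: linearI)

lemma linear_christoffel:
  assumes "x \<in> U" shows "linear (\<Gamma> x v)" "linear (\<lambda>v. \<Gamma> x v w)"
  using bilinear_christoffel[OF assms] by (auto simp: bilinear_def)

lemma christoffel_diff:
  assumes "x \<in> U"
  shows "\<Gamma> x (a - b) w = \<Gamma> x a w - \<Gamma> x b w" "\<Gamma> x w (a - b) = \<Gamma> x w a - \<Gamma> x w b"
  using linear_christoffel[OF assms, THEN linear_diff] by auto

lemma metric_compatible: "x \<in> U \<Longrightarrow> dG x u v w = G x (\<Gamma> x u v) w + G x v (\<Gamma> x u w)"
  by (simp add: sym_G[of x v "\<Gamma> x u w"] G_christoffel koszul_def dG_sym[where v = w and w = v]
      dG_sym[where v = w and w = u] dG_sym[where v = v and w = u] field_simps)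

lemma smooth_christoffel: "smooth_on U (\<lambda>x. \<Gamma> x v w)"
proof -
  have "smooth_on U (\<lambda>x. koszul x v w z)" for z
    using smooth_on_bounded_linear[OF bounded_linear_divide smooth_on_diff[OF smooth_on_add[OF
      smooth_on_dir_deriv[OF smooth_G[of w z]] smooth_on_dir_deriv[OF smooth_G[of v z]]] smooth_on_dir_deriv[OF smooth_G[of v w]]]]
    by (simp add: koszul_def)
  then show ?thesis
    unfolding christoffel_koszul by (intro smooth_on_sharp linear_koszul)
qed

lemma christoffel_differentiable: "x \<in> U \<Longrightarrow> (\<lambda>y. \<Gamma> y v w) differentiable (at x)"
  by (rule smooth_on_differentiable[OF smooth_christoffel])

lemma d\<Gamma>_sym: "x \<in> U \<Longrightarrow> d\<Gamma> x u v w = d\<Gamma> x u w v"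
  by (rule dir_deriv_apply_cong[OF open_U]) (auto intro: christoffel_sym)

lemma linear_d\<Gamma>:
  assumes "x \<in> U"
  shows "linear (\<lambda>u. d\<Gamma> x u v w)" "linear (\<lambda>v. d\<Gamma> x u v w)" "linear (\<lambda>w. d\<Gamma> x u v w)"
    by (rule linear_dir_deriv[OF christoffel_differentiable[OF assms]])
      (intro linear_dir_deriv_param[OF open_U assms] linear_christoffel christoffel_differentiable[OF assms]; assumption)+

lemma d\<Gamma>_simps:
  assumes "x \<in> U"
  shows "d\<Gamma> x (a + b) v w = d\<Gamma> x a v w + d\<Gamma> x b v w" "d\<Gamma> x (r *\<^sub>R a) v w = r *\<^sub>R d\<Gamma> x a v w"
    "d\<Gamma> x u (a + b) w = d\<Gamma> x u a w + d\<Gamma> x u b w" "d\<Gamma> x u (r *\<^sub>R a) w = r *\<^sub>R d\<Gamma> x u a w"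
    "d\<Gamma> x u v (a + b) = d\<Gamma> x u v a + d\<Gamma> x u v b" "d\<Gamma> x u v (r *\<^sub>R a) = r *\<^sub>R d\<Gamma> x u v a"
  using linear_d\<Gamma>[OF assms, THEN linear_add] linear_d\<Gamma>[OF assms, THEN linear_cmul] by auto

lemma has_derivative_christoffel:
  assumes x: "x \<in> U" and Y: "(Y has_derivative Y') (at x)" and Z: "(Z has_derivative Z') (at x)"
  shows "((\<lambda>y. \<Gamma> y (Y y) (Z y)) has_derivative
    (\<lambda>u. d\<Gamma> x u (Y x) (Z x) + \<Gamma> x (Y' u) (Z x) + \<Gamma> x (Y x) (Z' u))) (at x)"
  by (rule has_derivative_bilinear_apply[OF open_U x bilinear_christoffel
        has_dir_deriv[OF christoffel_differentiable[OF x]] Y Z])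

lemma riemann_simps:
  assumes "x \<in> U"
  shows "R x (a + b) v w = R x a v w + R x b v w" "R x (r *\<^sub>R a) v w = r *\<^sub>R R x a v w"
    "R x u (a + b) w = R x u a w + R x u b w" "R x u (r *\<^sub>R a) w = r *\<^sub>R R x u a w"
    "R x u v (a + b) = R x u v a + R x u v b" "R x u v (r *\<^sub>R a) = r *\<^sub>R R x u v a"
  using assms by (auto simp: riemann_def d\<Gamma>_simps christoffel_simps scaleR_add_right scaleR_diff_right)

lemma linear_riemann:
  assumes "x \<in> U"
  shows "linear (\<lambda>u. R x u v w)" "linear (\<lambda>v. R x u v w)" "linear (\<lambda>w. R x u v w)"
  using assms by (auto intro!: linearI simp: riemann_simps)

lemma riemann_diff:
  assumes "x \<in> U"
  shows "R x (a - b) v w = R x a v w - R x b v w" "R x u (a - b) w = R x u a w - R x u b w"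
  using linear_riemann(1,2)[OF assms, THEN linear_diff] by auto

lemma riemann_antisym: "R x u v w = - R x v u w"
  by (simp add: riemann_def)

lemma first_bianchi: "x \<in> U \<Longrightarrow> R x u v w + R x v w u + R x w u v = 0"
  by (simp add: riemann_def d\<Gamma>_sym[where v = w and w = u] d\<Gamma>_sym[where v = w and w = v]
      d\<Gamma>_sym[where v = v and w = u] christoffel_sym[of x w u] christoffel_sym[of x w v] christoffel_sym[of x v u])

text \<open>Differentiating metric compatibility twice expresses the second derivatives of
  \<open>G y w z\<close> through \<open>\<Gamma>\<close> and \<open>d\<Gamma>\<close>. These second
  derivatives are symmetric in \<open>u\<close> and \<open>v\<close>, and the antisymmetric part is
  exactly the claim.\<close>

lemma riemann_skew:
  assumes x: "x \<in> U"
  shows "G x (R x u v w) z = - G x w (R x u v z)"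
proof -
  have D: "dir_deriv (\<lambda>y. dG y v w z) x u = G x (\<Gamma> x u (\<Gamma> x v w)) z + G x (\<Gamma> x v w) (\<Gamma> x u z)
     + G x (d\<Gamma> x u v w) z + G x (\<Gamma> x u w) (\<Gamma> x v z) + G x w (\<Gamma> x u (\<Gamma> x v z)) + G x w (d\<Gamma> x u v z)" for u v
  proof -
    let ?a = "\<lambda>y. G y (\<Gamma> y v w) z" and ?b = "\<lambda>y. G y w (\<Gamma> y v z)"
    have 1: "(?a has_derivative (\<lambda>u. dG x u (\<Gamma> x v w) z + G x (d\<Gamma> x u v w) z + G x (\<Gamma> x v w) 0)) (at x)"
      by (rule has_derivative_bilinear_apply[OF open_U x bilinear_G has_dir_deriv[OF G_differentiable[OF x]]
            has_dir_deriv[OF christoffel_differentiable[OF x]] has_derivative_const])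
    have 2: "(?b has_derivative (\<lambda>u. dG x u w (\<Gamma> x v z) + G x 0 (\<Gamma> x v z) + G x w (d\<Gamma> x u v z))) (at x)"
      by (rule has_derivative_bilinear_apply[OF open_U x bilinear_G has_dir_deriv[OF G_differentiable[OF x]]
            has_derivative_const has_dir_deriv[OF christoffel_differentiable[OF x]]])
    have "dir_deriv (\<lambda>y. dG y v w z) x u = dir_deriv (\<lambda>y. ?a y + ?b y) x u"
      by (rule dir_deriv_apply_cong[OF open_U x]) (rule metric_compatible)
    also have "\<dots> = dG x u (\<Gamma> x v w) z + G x (d\<Gamma> x u v w) z + G x (\<Gamma> x v w) 0
        + (dG x u w (\<Gamma> x v z) + G x 0 (\<Gamma> x v z) + G x w (d\<Gamma> x u v z))"
      by (rule dir_deriv_eq[OF has_derivative_add[OF 1 2]])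
    finally show ?thesis by (simp add: metric_compatible[OF x] G_simps[OF x])
  qed
  have "dir_deriv (\<lambda>y. dG y v w z) x u = dir_deriv (\<lambda>y. dG y u w z) x v"
    by (rule dir_deriv_commute[OF smooth_G x])
  then show ?thesis
    unfolding D riemann_def by (simp add: G_simps[OF x])
qed

lemma riemann_pair_sym:
  assumes x: "x \<in> U"
  shows "G x (R x u v w) z = G x (R x w z u) v"
proof -
  define Q where "Q a b c d = G x (R x a b c) d" for a b c d
  have 1: "Q a b c d = - Q b a c d" for a b c d
    unfolding Q_def using riemann_antisym[of x a b c] by (simp add: G_simps[OF x])
  have 2: "Q a b c d = - Q a b d c" for a b c d
    unfolding Q_def using riemann_skew[OF x, of a b c d] sym_G[OF x] by simp
  have 3: "Q a b c d + Q b c a d + Q c a b d = 0" for a b c d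
    unfolding Q_def using first_bianchi[OF x, of a b c] G_simps[OF x] by metis
  \<comment> \<open>The classical octahedron argument: four instances of the first Bianchi identity,
    combined through the two skew symmetries.\<close>
  have "Q u v w z = Q w z u v"
    using 3[of u v w z] 3[of v w z u] 3[of w z u v] 3[of z u v w]
      1[of v w u z] 1[of w u v z] 2[of v w z u] 1[of w z v u] 2[of z v w u] 1[of v z w u]
      2[of w z u v] 1[of z u w v] 2[of u w z v] 2[of z u v w] 2[of u v z w] 1[of v z u w] 2[of v z u w] 
      2[of w u v z] 1[of u w v z] 1[of u z w v] 2[of u z w v] 2[of z u w v]
      2[of w z v u]
    by argo
  then show ?thesis by (simp add: Q_def)
qed

lemma smooth_riemann: "smooth_on U (\<lambda>x. R x u v w)"
  unfolding riemann_def
  by (intro smooth_on_add smooth_on_diff smooth_on_dir_deriv smooth_christoffel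
      smooth_on_linear_apply[where T = "\<lambda>x. \<Gamma> x u" for u, OF open_U linear_christoffel(1) smooth_christoffel])

lemma riemann_differentiable: "x \<in> U \<Longrightarrow> (\<lambda>y. R y u v w) differentiable (at x)"
  by (rule smooth_on_differentiable[OF smooth_riemann])

lemma dR_eq:
  assumes x: "x \<in> U"
  shows "dR x z u v w = dir_deriv (\<lambda>y. d\<Gamma> y u v w) x z - dir_deriv (\<lambda>y. d\<Gamma> y v u w) x z
    + (d\<Gamma> x z u (\<Gamma> x v w) + \<Gamma> x u (d\<Gamma> x z v w)) - (d\<Gamma> x z v (\<Gamma> x u w) + \<Gamma> x v (d\<Gamma> x z u w))"
proof -
  have 1: "((\<lambda>y. \<Gamma> y u (\<Gamma> y v w)) has_derivative
     (\<lambda>z. d\<Gamma> x z u (\<Gamma> x v w) + \<Gamma> x 0 (\<Gamma> x v w) + \<Gamma> x u (d\<Gamma> x z v w))) (at x)" for u v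
    by (rule has_derivative_christoffel[OF x has_derivative_const has_dir_deriv[OF christoffel_differentiable[OF x]]])
  have 2: "((\<lambda>y. d\<Gamma> y u v w) has_derivative dir_deriv (\<lambda>y. d\<Gamma> y u v w) x) (at x)" for u v
    by (rule smooth_on_has_derivative[OF smooth_on_dir_deriv[OF smooth_christoffel] x])
  have "dR x z u v w = dir_deriv (\<lambda>y. d\<Gamma> y u v w) x z - dir_deriv (\<lambda>y. d\<Gamma> y v u w) x z
    + (d\<Gamma> x z u (\<Gamma> x v w) + \<Gamma> x 0 (\<Gamma> x v w) + \<Gamma> x u (d\<Gamma> x z v w))
    - (d\<Gamma> x z v (\<Gamma> x u w) + \<Gamma> x 0 (\<Gamma> x u w) + \<Gamma> x v (d\<Gamma> x z u w))"
    unfolding riemann_def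
    by (rule dir_deriv_eq[OF has_derivative_diff[OF has_derivative_add[OF has_derivative_diff[OF 2 2] 1] 1]])
  then show ?thesis using linear_christoffel(2)[OF x, THEN linear_0] by simp
qed

lemma dR_antisym: "x \<in> U \<Longrightarrow> dR x z u v w = - dR x z v u w"
  by (simp add: dR_eq)

text \<open>Stated with plain derivatives of \<open>R\<close> on constant fields. Of the Christoffel
  corrections that make up the covariant derivative, those in the two antisymmetric slots cancel in
  the cyclic sum because \<open>\<Gamma>\<close> is symmetric; the others are written out.\<close>

lemma second_bianchi:
  assumes x: "x \<in> U"
  shows "dR x z u v w + dR x u v z w + dR x v z u w
    + \<Gamma> x z (R x u v w) + \<Gamma> x u (R x v z w) + \<Gamma> x v (R x z u w)
    - R x u v (\<Gamma> x z w) - R x v z (\<Gamma> x u w) - R x z u (\<Gamma> x v w) = 0"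
proof -
  \<comment> \<open>Second derivatives of \<open>\<Gamma>\<close> cancel by the symmetry
    \<open>c\<close>; the products named \<open>E\<close>, \<open>F\<close> and \<open>H\<close>
    cancel in the cyclic sum.\<close>
  define D where "D a b c = dir_deriv (\<lambda>y. d\<Gamma> y a b w) x c" for a b c
  have c: "D a b c = D c b a" for a b c
    unfolding D_def by (rule dir_deriv_commute[OF smooth_christoffel x])
  have dR: "dR x z u v w = D u v z - D v u z
    + (d\<Gamma> x z u (\<Gamma> x v w) + \<Gamma> x u (d\<Gamma> x z v w)) - (d\<Gamma> x z v (\<Gamma> x u w) + \<Gamma> x v (d\<Gamma> x z u w))"
    for z u v unfolding D_def by (rule dR_eq[OF x])
  define E where "E a b c = d\<Gamma> x a b (\<Gamma> x c w)" for a b c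
  define F where "F a b c = \<Gamma> x a (d\<Gamma> x b c w)" for a b c
  define H where "H a b c = \<Gamma> x a (\<Gamma> x b (\<Gamma> x c w))" for a b c
  have cyc: "\<Gamma> x z (R x u v w) - R x u v (\<Gamma> x z w) = F z u v - F z v u + H z u v - H z v u
     - (E u v z - E v u z + H u v z - H v u z)" for z u v
    by (simp add: riemann_def E_def F_def H_def christoffel_simps[OF x] christoffel_diff[OF x])
  have "dR x z u v w + dR x u v z w + dR x v z u w
    + (\<Gamma> x z (R x u v w) - R x u v (\<Gamma> x z w)) + (\<Gamma> x u (R x v z w) - R x v z (\<Gamma> x u w))
    + (\<Gamma> x v (R x z u w) - R x z u (\<Gamma> x v w)) = 0"
    unfolding cyc dR E_def[symmetric] F_def[symmetric]
    by (simp add: c[of u v z] c[of u z v] c[of v u z])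
  then show ?thesis by (simp add: algebra_simps)
qed

section \<open>Gradient and Hessian\<close>

lemma smooth_gradient: "smooth_on U u \<Longrightarrow> smooth_on U (gradient G u)"
  unfolding gradient_def
  by (rule smooth_on_sharp) (auto intro: linear_dir_deriv smooth_on_differentiable smooth_on_dir_deriv)

lemma G_gradient: "smooth_on U u \<Longrightarrow> x \<in> U \<Longrightarrow> G x (gradient G u x) w = dir_deriv u x w"
  unfolding gradient_def by (rule G_sharp) (auto intro: linear_dir_deriv smooth_on_differentiable)

lemma gradient_differentiable: "smooth_on U u \<Longrightarrow> x \<in> U \<Longrightarrow> gradient G u differentiable (at x)"
  by (rule smooth_on_differentiable[OF smooth_gradient])

text \<open>The Hessian with one index raised. As an endomorphism it can be fed to
  \<open>tr\<close>, which yields the Laplacian.\<close>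

definition nabla_gradient :: "('e \<Rightarrow> real) \<Rightarrow> 'e \<Rightarrow> 'e \<Rightarrow> 'e"
  where "nabla_gradient u x v = dir_deriv (gradient G u) x v + \<Gamma> x v (gradient G u x)"

lemma G_nabla_gradient:
  assumes u: "smooth_on U u" and x: "x \<in> U"
  shows "G x (nabla_gradient u x v) w = hessian G u x v w"
proof -
  have "dir_deriv (\<lambda>y. dir_deriv u y w) x v = dir_deriv (\<lambda>y. G y (gradient G u y) w) x v"
    by (rule dir_deriv_apply_cong[OF open_U x]) (simp add: G_gradient u)
  also have "\<dots> = dG x v (gradient G u x) w + G x (dir_deriv (gradient G u) x v) w
      + G x (gradient G u x) (dir_deriv (\<lambda>y. w) x v)"
    by (rule dir_deriv_G[OF x gradient_differentiable[OF u x] differentiable_const])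
  also have "dir_deriv (\<lambda>y. w) x v = 0" by (rule dir_deriv_eq) simp
  finally show ?thesis
    by (simp add: hessian_def nabla_gradient_def metric_compatible[OF x] G_simps[OF x] G_gradient[OF u x])
qed

lemma hessian_sym:
  assumes u: "smooth_on U u" and x: "x \<in> U"
  shows "hessian G u x v w = hessian G u x w v"
  by (simp add: hessian_def dir_deriv_commute[OF u x, of w v] christoffel_sym[OF x, of v w])

lemma linear_nabla_gradient:
  assumes "smooth_on U u" and x: "x \<in> U"
  shows "linear (nabla_gradient u x)"
  unfolding nabla_gradient_def
  using linear_compose_add[OF linear_dir_deriv[OF gradient_differentiable[OF assms]] linear_christoffel(2)[OF x]]
  by simp

section \<open>Ricci and scalar curvature\<close>

lemma linear_ricci:
  assumes "x \<in> U" shows "linear (ricci G x v)" "linear (\<lambda>v. ricci G x v w)"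
  using assms by (auto intro!: linearI simp: ricci_def riemann_simps inner_add_left sum.distrib sum_distrib_left)

lemma ricci_tr: "ricci G x v w = tr (\<lambda>u. R x u v w)"
  by (simp add: ricci_def tr_def)

lemma smooth_ricci: "smooth_on U (\<lambda>x. ricci G x v w)"
  unfolding ricci_def by (intro smooth_on_sum open_U smooth_on_inner_left smooth_riemann) simp

lemma smooth_scalar: "smooth_on U (scalar G)"
proof -
  have "smooth_on U (\<lambda>x. scalar G x)"
    unfolding scalar_def
    by (intro smooth_on_sum open_U smooth_on_inner_left smooth_on_sharp linear_ricci smooth_ricci) auto
  then show ?thesis by simp
qed

text \<open>The Ricci tensor as an endomorphism, so that the scalar curvature is a trace in the
  sense of \<open>tr\<close> and cyclicity applies to it.\<close>

definition ricci_op :: "'e \<Rightarrow> 'e \<Rightarrow> 'e"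
  where "ricci_op x v = sharp G x (ricci G x v)"

lemma G_ricci_op: "x \<in> U \<Longrightarrow> G x (ricci_op x v) w = ricci G x v w"
  unfolding ricci_op_def by (rule G_sharp) (auto intro: linear_ricci)

lemma linear_ricci_op: "x \<in> U \<Longrightarrow> linear (ricci_op x)"
  by (rule linearI; rule nondegenerate[of x])
    (simp_all add: G_simps G_ricci_op linear_add[OF linear_ricci(2)] linear_cmul[OF linear_ricci(2)])

lemma scalar_tr: "scalar G x = tr (ricci_op x)"
  by (simp add: scalar_def tr_def ricci_op_def)

lemma smooth_ricci_op: "smooth_on U (\<lambda>x. ricci_op x v)"
  unfolding ricci_op_def by (rule smooth_on_sharp) (auto intro: linear_ricci smooth_ricci)

section \<open>Derivatives along curves\<close>

lemma G_along_curve: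
  assumes "C t \<in> U" "(C has_vector_derivative c) (at t)"
    "(V has_vector_derivative v) (at t)" "(W has_vector_derivative w) (at t)"
  shows "((\<lambda>s. G (C s) (V s) (W s)) has_real_derivative
    dG (C t) c (V t) (W t) + G (C t) v (W t) + G (C t) (V t) w) (at t)"
proof -
  \<comment> \<open>The triple is a point of a product space. There the pointwise Leibniz rule
    applies, with \<open>G\<close> depending on the first component only.\<close>
  let ?x = "(C t, V t, W t)"
  have "((\<lambda>p. G (fst p) (fst (snd p)) (snd (snd p))) has_derivative
     (\<lambda>h. dG (C t) (fst h) (fst (snd ?x)) (snd (snd ?x)) + G (fst ?x) (fst (snd h)) (snd (snd ?x))
       + G (fst ?x) (fst (snd ?x)) (snd (snd h)))) (at ?x)"
  proof (rule has_derivative_bilinear_apply[where T = "\<lambda>p. G (fst p)" and T' = "\<lambda>a b h. dG (C t) (fst h) a b" and S = "U \<times> UNIV"])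
    show "open (U \<times> (UNIV :: ('e \<times> 'e) set))" by (intro open_Times open_U) simp
    show "((\<lambda>y. G (fst y) a b) has_derivative (\<lambda>h. dG (C t) (fst h) a b)) (at ?x)" for a b
      by (rule has_derivative_compose[OF has_derivative_fst[OF has_derivative_ident]])
        (simp add: has_dir_deriv[OF G_differentiable] assms(1))
  qed (use assms(1) bilinear_G in \<open>auto intro!: derivative_eq_intros\<close>)
  moreover have "((\<lambda>s. (C s, V s, W s)) has_derivative (\<lambda>h. (h *\<^sub>R c, h *\<^sub>R v, h *\<^sub>R w))) (at t)"
    using assms(2-4) unfolding has_vector_derivative_def by (intro has_derivative_Pair)
  ultimately have "((\<lambda>s. G (C s) (V s) (W s)) has_derivative
      (\<lambda>h. dG (C t) (h *\<^sub>R c) (V t) (W t) + G (C t) (h *\<^sub>R v) (W t) + G (C t) (V t) (h *\<^sub>R w))) (at t)"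
    by (auto dest: has_derivative_compose)
  then show ?thesis
    unfolding has_field_derivative_def
    by (rule has_derivative_eq_rhs) (simp add: fun_eq_iff dG_simps assms(1) G_simps algebra_simps)
qed

lemma norm2_parallel:
  assumes "C t \<in> U" "(C has_vector_derivative c) (at t)" "(V has_vector_derivative - \<Gamma> (C t) c (V t)) (at t)"
  shows "((\<lambda>s. G (C s) (V s) (V s)) has_real_derivative 0) (at t)"
  using G_along_curve[OF assms(1,2,3,3)] by (simp add: metric_compatible assms(1) G_simps)

text \<open>The differentiated function is the first derivative of \<open>u\<close> along the curve.
  Since the velocity is parallel, only the Hessian term survives.\<close>

lemma second_derivative_along_geodesic:
  assumes u: "smooth_on U u" and x: "C t \<in> U" and C: "(C has_vector_derivative c t) (at t)"
    and c: "(c has_vector_derivative - \<Gamma> (C t) (c t) (c t)) (at t)"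
  shows "((\<lambda>s. G (C s) (gradient G u (C s)) (c s)) has_real_derivative hessian G u (C t) (c t) (c t)) (at t)"
proof -
  note D = G_along_curve[OF x C along_curve[OF has_dir_deriv[OF gradient_differentiable[OF u x]] C] c]
  show ?thesis
    using D by (simp add: metric_compatible[OF x] G_simps[OF x] nabla_gradient_def add.commute flip: G_nabla_gradient[OF u x])
qed

end

section \<open>Conformal gradient fields\<close>

locale conformal_gradient = metric_on U G
  for U :: "'e::euclidean_space set" and G +
  fixes H \<phi> :: "'e \<Rightarrow> real"
  assumes smooth_H: "smooth_on U H" and smooth_\<phi>: "smooth_on U \<phi>"
    and hessian_H: "x \<in> U \<Longrightarrow> hessian G H x v w = \<phi> x * G x v w"
begin

abbreviation X :: "'e \<Rightarrow> 'e" where "X \<equiv> gradient G H"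
abbreviation Y :: "'e \<Rightarrow> 'e" where "Y \<equiv> gradient G \<phi>"
abbreviation d\<phi> :: "'e \<Rightarrow> 'e \<Rightarrow> real" where "d\<phi> \<equiv> dir_deriv \<phi>"
abbreviation nY :: "'e \<Rightarrow> 'e \<Rightarrow> 'e" where "nY \<equiv> nabla_gradient \<phi>"

lemmas G_X = G_gradient[OF smooth_H] and G_Y = G_gradient[OF smooth_\<phi>]

lemma linear_d\<phi>: "x \<in> U \<Longrightarrow> linear (d\<phi> x)"
  by (rule linear_dir_deriv[OF smooth_on_differentiable[OF smooth_\<phi>]])

text \<open>The Hessian equation with an index raised is
  \<open>\<nabla>\<^sub>v X = \<phi> v\<close>; here it is solved for the coordinate derivative of
  \<open>X\<close>.\<close>

lemma dX: "x \<in> U \<Longrightarrow> dir_deriv X x v = \<phi> x *\<^sub>R v - \<Gamma> x v (X x)"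
  using G_nabla_gradient[OF smooth_H, of x v] hessian_H[of x v]
  by (intro nondegenerate[of x]) (simp_all add: nabla_gradient_def G_simps eq_diff_eq)

lemma has_derivative_X: "x \<in> U \<Longrightarrow> (X has_derivative (\<lambda>v. \<phi> x *\<^sub>R v - \<Gamma> x v (X x))) (at x)"
  using has_dir_deriv[OF gradient_differentiable[OF smooth_H]] dX by (simp add: fun_eq_iff[symmetric])

lemma has_derivative_\<phi>: "x \<in> U \<Longrightarrow> (\<phi> has_derivative d\<phi> x) (at x)"
  by (rule smooth_on_has_derivative[OF smooth_\<phi>])

lemma has_derivative_norm2:
  assumes x: "x \<in> U"
  shows "((\<lambda>y. G y (X y) (X y)) has_derivative (\<lambda>v. 2 * \<phi> x * dir_deriv H x v)) (at x)"
proof -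
  have "((\<lambda>y. G y (X y) (X y)) has_derivative (\<lambda>v. dG x v (X x) (X x)
     + G x (\<phi> x *\<^sub>R v - \<Gamma> x v (X x)) (X x) + G x (X x) (\<phi> x *\<^sub>R v - \<Gamma> x v (X x)))) (at x)"
    by (rule has_derivative_bilinear_apply[OF open_U x bilinear_G has_dir_deriv[OF G_differentiable[OF x]]
          has_derivative_X[OF x] has_derivative_X[OF x]])
  then show ?thesis
    by (simp add: metric_compatible[OF x] G_simps[OF x] G_X[OF x] sym_G[OF x, of _ "X x"] algebra_simps)
qed

lemma riemann_X:
  assumes x: "x \<in> U"
  shows "R x v w (X x) = d\<phi> x v *\<^sub>R w - d\<phi> x w *\<^sub>R v"
proof -
  have "dir_deriv (\<lambda>y. dir_deriv X y w) x v = d\<phi> x v *\<^sub>R w - (d\<Gamma> x v w (X x) + \<Gamma> x w (dir_deriv X x v))" for v w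
  proof -
    have "dir_deriv (\<lambda>y. dir_deriv X y w) x v = dir_deriv (\<lambda>y. \<phi> y *\<^sub>R w - \<Gamma> y w (X y)) x v"
      by (rule dir_deriv_apply_cong[OF open_U x]) (rule dX)
    also have "\<dots> = d\<phi> x v *\<^sub>R w - (d\<Gamma> x v w (X x) + \<Gamma> x 0 (X x) + \<Gamma> x w (dir_deriv X x v))"
      by (rule dir_deriv_eq[OF has_derivative_diff[OF has_derivative_scaleR_left[OF has_derivative_\<phi>[OF x]]
            has_derivative_christoffel[OF x has_derivative_const has_dir_deriv[OF gradient_differentiable[OF smooth_H x]]]]])
    finally show ?thesis using linear_christoffel(2)[OF x, THEN linear_0] by simp
  qed
  then have "d\<phi> x v *\<^sub>R w - (d\<Gamma> x v w (X x) + \<Gamma> x w (dir_deriv X x v))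
      = d\<phi> x w *\<^sub>R v - (d\<Gamma> x w v (X x) + \<Gamma> x v (dir_deriv X x w))"
    using dir_deriv_commute[OF smooth_gradient[OF smooth_H] x] by metis
  then show ?thesis
    by (simp add: dX[OF x] riemann_def christoffel_diff[OF x] christoffel_simps[OF x] christoffel_sym[OF x, of v w])
       (simp add: algebra_simps)
qed

text \<open>\<open>R(v, w)\<close> is skew for the metric, so pairing \<open>riemann_X\<close> with
  \<open>X\<close> gives zero.\<close>

lemma d\<phi>_parallel_dH:
  assumes x: "x \<in> U"
  shows "d\<phi> x v * dir_deriv H x w = d\<phi> x w * dir_deriv H x v"
proof -
  have "G x (R x v w (X x)) (X x) = 0"
    using riemann_skew[OF x, of v w "X x" "X x"] sym_G[OF x, of "X x"] by simp
  then show ?thesis by (simp add: riemann_X[OF x] G_simps[OF x] sym_G[OF x, of _ "X x"] G_X[OF x])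
qed

text \<open>Pair symmetry and skewness move \<open>X\<close> from the third slot of
  \<open>riemann_X\<close> to the first.\<close>

lemma riemann_X_left:
  assumes x: "x \<in> U"
  shows "R x (X x) v w = d\<phi> x w *\<^sub>R v - G x v w *\<^sub>R Y x"
proof (rule nondegenerate[OF x])
  fix z
  show "G x (R x (X x) v w) z = G x (d\<phi> x w *\<^sub>R v - G x v w *\<^sub>R Y x) z"
    unfolding riemann_pair_sym[OF x, of "X x"]
    using riemann_skew[OF x, of w z "X x" v]
    by (simp add: riemann_pair_sym[OF x, of "X x"] riemann_skew[OF x, of w z "X x"] riemann_X[OF x]
        G_simps[OF x] G_Y[OF x] sym_G[OF x, of z v] sym_G[OF x, of w v] mult.commute)
qed

lemma dR_X_left:
  assumes x: "x \<in> U"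
  shows "dR x u (X x) v w = dir_deriv (\<lambda>y. d\<phi> y w) x u *\<^sub>R v - dG x u v w *\<^sub>R Y x
      - G x v w *\<^sub>R dir_deriv Y x u - R x (\<phi> x *\<^sub>R u - \<Gamma> x u (X x)) v w"
proof -
  have "((\<lambda>y. R y (X y) v w) has_derivative
      (\<lambda>u. dR x u (X x) v w + R x (\<phi> x *\<^sub>R u - \<Gamma> x u (X x)) v w)) (at x)"
    by (rule has_derivative_linear_apply[where T = "\<lambda>y u. R y u v w", OF open_U x linear_riemann(1)
          has_dir_deriv[OF riemann_differentiable[OF x]] has_derivative_X[OF x]])
  then have "dR x u (X x) v w + R x (\<phi> x *\<^sub>R u - \<Gamma> x u (X x)) v w = dir_deriv (\<lambda>y. R y (X y) v w) x u"
    by (rule dir_deriv_eq[symmetric])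
  also have "\<dots> = dir_deriv (\<lambda>y. d\<phi> y w *\<^sub>R v - G y v w *\<^sub>R Y y) x u"
    by (rule dir_deriv_apply_cong[OF open_U x]) (rule riemann_X_left)
  also have "\<dots> = dir_deriv (\<lambda>y. d\<phi> y w) x u *\<^sub>R v
      - (G x v w *\<^sub>R dir_deriv Y x u + dG x u v w *\<^sub>R Y x)"
    by (rule dir_deriv_eq[OF has_derivative_diff[OF
          has_derivative_scaleR_left[OF smooth_on_has_derivative[OF smooth_on_dir_deriv[OF smooth_\<phi>] x]]
          has_derivative_scaleR[OF has_dir_deriv[OF G_differentiable[OF x]]
            has_dir_deriv[OF gradient_differentiable[OF smooth_\<phi> x]]]]])
  finally show ?thesis by (simp add: algebra_simps)
qed

text \<open>The second Bianchi identity trades the derivative along \<open>X\<close> for derivatives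
  in directions \<open>u\<close> and \<open>v\<close> of the curvature with \<open>X\<close> in a
  slot, which \<open>riemann_X_left\<close> makes explicit. The outcome is the infinitesimal change
  of curvature under the conformal flow of \<open>X\<close>: a multiple \<open>- 2 \<phi>\<close> of
  \<open>R\<close> and Hessian terms of \<open>\<phi>\<close>, besides the Christoffel
  corrections.\<close>

lemma dR_along_X:
  assumes x: "x \<in> U"
  shows "dR x (X x) u v w = R x (\<Gamma> x (X x) u) v w - \<Gamma> x (X x) (R x u v w)
      + R x u (\<Gamma> x (X x) v) w + R x u v (\<Gamma> x (X x) w) - (2 * \<phi> x) *\<^sub>R R x u v w
      + hessian G \<phi> x u w *\<^sub>R v - hessian G \<phi> x v w *\<^sub>R u
      + G x u w *\<^sub>R nY x v - G x v w *\<^sub>R nY x u"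
proof -
  have 1: "dR x u v (X x) w = - dR x u (X x) v w" "R x v (X x) w = - R x (X x) v w"
    "R x v (X x) (\<Gamma> x u w) = - R x (X x) v (\<Gamma> x u w)" "R x (\<Gamma> x v (X x)) u w = - R x u (\<Gamma> x v (X x)) w"
    "R x v u w = - R x u v w"
    by (rule dR_antisym[OF x], rule riemann_antisym, rule riemann_antisym, rule riemann_antisym, rule riemann_antisym)
  have "dR x (X x) u v w = dR x u (X x) v w - dR x v (X x) u w
     - \<Gamma> x (X x) (R x u v w) + \<Gamma> x u (R x (X x) v w) - \<Gamma> x v (R x (X x) u w)
     + R x u v (\<Gamma> x (X x) w) - R x (X x) v (\<Gamma> x u w) + R x (X x) u (\<Gamma> x v w)"
    using second_bianchi[OF x, where z = "X x" and u = u and v = v and w = w] linear_christoffel(1)[OF x, of u, THEN linear_neg]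
    by (simp add: 1 algebra_simps)
  then show ?thesis
    by (rule trans) 
      (rule euclidean_eqI, simp add: dR_X_left[OF x] riemann_X_left[OF x] hessian_def nabla_gradient_def 1 christoffel_diff[OF x]
        christoffel_simps[OF x] riemann_diff[OF x] riemann_simps[OF x] metric_compatible[OF x]
        christoffel_sym[OF x, of u "X x"] christoffel_sym[OF x, of v "X x"] inner_simps algebra_simps
        sym_G[OF x, of v "\<Gamma> x u w"] christoffel_sym[OF x, of u v] sym_G[OF x, of u "\<Gamma> x v w"]
        riemann_antisym[of x "\<Gamma> x (X x) v" u w])
qed

text \<open>Trace of \<open>dR_along_X\<close> in \<open>u\<close>. Each of the two rank one terms
  contributes one Hessian of \<open>\<phi>\<close>, the identity contributes minus the dimension of
  them, whence the factor \<open>DIM('e) - 2\<close>.\<close>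

lemma dricci_along_X:
  assumes x: "x \<in> U"
  shows "dir_deriv (\<lambda>y. ricci G y v w) x (X x) = ricci G x (\<Gamma> x (X x) v) w + ricci G x v (\<Gamma> x (X x) w)
      - 2 * \<phi> x * ricci G x v w - (real DIM('e) - 2) * hessian G \<phi> x v w - tr (nY x) * G x v w"
proof -
  have "dir_deriv (\<lambda>y. ricci G y v w) x (X x) = tr (\<lambda>u. dR x (X x) u v w)"
    unfolding ricci_def tr_def
    by (rule dir_deriv_eq[OF has_derivative_sum[OF has_derivative_inner_left[OF has_dir_deriv[OF riemann_differentiable[OF x]]]]])
  also have "\<dots> = tr (\<lambda>u. R x (\<Gamma> x (X x) u) v w) - tr (\<lambda>u. \<Gamma> x (X x) (R x u v w))
     + ricci G x (\<Gamma> x (X x) v) w + ricci G x v (\<Gamma> x (X x) w) - 2 * \<phi> x * ricci G x v w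
     + tr (\<lambda>u. hessian G \<phi> x u w *\<^sub>R v) - hessian G \<phi> x v w * tr (\<lambda>u :: 'e. u)
     + tr (\<lambda>u. G x u w *\<^sub>R nY x v) - G x v w * tr (nY x)"
    by (simp add: dR_along_X[OF x] tr_add tr_diff tr_scaleR ricci_tr)
  also have "tr (\<lambda>u. R x (\<Gamma> x (X x) u) v w) = tr (\<lambda>u. \<Gamma> x (X x) (R x u v w))"
    by (rule tr_commute[OF linear_riemann(1)[OF x] linear_christoffel(1)[OF x]])
  also have "tr (\<lambda>u. hessian G \<phi> x u w *\<^sub>R v) = hessian G \<phi> x v w"
    by (rule tr_rank_one)
      (simp add: linear_compose[OF linear_nabla_gradient[OF smooth_\<phi> x] linear_G(2)[OF x], unfolded o_def]
         flip: G_nabla_gradient[OF smooth_\<phi> x])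
  also have "tr (\<lambda>u. G x u w *\<^sub>R nY x v) = hessian G \<phi> x v w"
    by (simp add: tr_rank_one[OF linear_G(2)[OF x]] G_nabla_gradient[OF smooth_\<phi> x])
  finally show ?thesis by (simp add: tr_id algebra_simps)
qed

text \<open>A second trace, taken of \<open>ricci_op\<close>. This is the classical formula
  \<open>X(R) = - 2 \<phi> R - 2 (N - 1) \<Delta>\<phi>\<close> for a conformal field.\<close>

lemma dscalar_along_X:
  assumes x: "x \<in> U"
  shows "dir_deriv (scalar G) x (X x) = - 2 * \<phi> x * scalar G x - 2 * (real DIM('e) - 1) * tr (nY x)"
proof -
  let ?A = "ricci_op x"
  have dA: "dir_deriv (\<lambda>y. ricci_op y v) x (X x) = ?A (\<Gamma> x (X x) v) - \<Gamma> x (X x) (?A v)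
      - (2 * \<phi> x) *\<^sub>R ?A v - (real DIM('e) - 2) *\<^sub>R nY x v - tr (nY x) *\<^sub>R v" for v
  proof (rule nondegenerate[OF x])
    fix w
    have "dir_deriv (\<lambda>y. ricci G y v w) x (X x) = dir_deriv (\<lambda>y. G y (ricci_op y v) w) x (X x)"
      by (rule dir_deriv_apply_cong[OF open_U x]) (simp add: G_ricci_op)
    also have "\<dots> = dG x (X x) (?A v) w + G x (dir_deriv (\<lambda>y. ricci_op y v) x (X x)) w
        + G x (?A v) (dir_deriv (\<lambda>y. w) x (X x))"
      by (rule dir_deriv_G[OF x smooth_on_differentiable[OF smooth_ricci_op x] differentiable_const])
    also have "dir_deriv (\<lambda>y. w) x (X x) = 0" by (rule dir_deriv_eq) simp
    finally show "G x (dir_deriv (\<lambda>y. ricci_op y v) x (X x)) w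
      = G x (?A (\<Gamma> x (X x) v) - \<Gamma> x (X x) (?A v) - (2 * \<phi> x) *\<^sub>R ?A v
          - (real DIM('e) - 2) *\<^sub>R nY x v - tr (nY x) *\<^sub>R v) w"
      by (simp add: dricci_along_X[OF x] metric_compatible[OF x] G_simps[OF x] G_ricci_op[OF x]
          G_nabla_gradient[OF smooth_\<phi> x])
  qed
  have "dir_deriv (scalar G) x (X x) = tr (\<lambda>v. dir_deriv (\<lambda>y. ricci_op y v) x (X x))"
    unfolding scalar_tr[abs_def] tr_def
    by (rule dir_deriv_eq[OF has_derivative_sum[OF has_derivative_inner_left[OF smooth_on_has_derivative[OF smooth_ricci_op x]]]])
  also have "\<dots> = tr (\<lambda>v. ?A (\<Gamma> x (X x) v)) - tr (\<lambda>v. \<Gamma> x (X x) (?A v)) - 2 * \<phi> x * scalar G x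
     - (real DIM('e) - 2) * tr (nY x) - tr (nY x) * tr (\<lambda>v :: 'e. v)"
    by (simp add: dA tr_diff tr_scaleR scalar_tr)
  also have "tr (\<lambda>v. ?A (\<Gamma> x (X x) v)) = tr (\<lambda>v. \<Gamma> x (X x) (?A v))"
    by (rule tr_commute[OF linear_ricci_op[OF x] linear_christoffel(1)[OF x]])
  finally show ?thesis by (simp add: tr_id algebra_simps)
qed

lemma dH_parallel:
  assumes "C t \<in> U" "(C has_vector_derivative c) (at t)" "(V has_vector_derivative - \<Gamma> (C t) c (V t)) (at t)"
  shows "((\<lambda>s. G (C s) (X (C s)) (V s)) has_real_derivative \<phi> (C t) * G (C t) c (V t)) (at t)"
  using G_along_curve[OF assms(1,2) along_curve[OF has_derivative_X[OF assms(1)] assms(2)] assms(3)]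
  by (simp add: metric_compatible assms(1) G_simps)

abbreviation P :: "'e \<Rightarrow> real" where "P x \<equiv> G x (X x) (X x)"

text \<open>The factor in \<open>d\<phi> = \<mu> dH\<close>, found by evaluating both sides on
  \<open>X\<close>. At critical points of \<open>H\<close> the quotient is only the default value of
  division by zero, so the lemmas on \<open>\<mu>\<close> ask for
  \<open>P x \<noteq> 0\<close>.\<close>

definition \<mu> :: "'e \<Rightarrow> real" where "\<mu> x = d\<phi> x (X x) / P x"

lemma d\<phi>_\<mu>:
  assumes x: "x \<in> U" "P x \<noteq> 0"
  shows "d\<phi> x v = \<mu> x * dir_deriv H x v"
  using d\<phi>_parallel_dH[OF x(1), of v "X x"] x G_X[OF x(1), of "X x"] by (simp add: \<mu>_def field_simps)

lemma \<mu>_differentiable: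
  assumes x: "x \<in> U" "P x \<noteq> 0"
  shows "\<mu> differentiable (at x)"
proof -
  have "((\<lambda>y. d\<phi> y (X y)) has_derivative (\<lambda>u. dir_deriv (\<lambda>y. d\<phi> y (X x)) x u + d\<phi> x (dir_deriv X x u))) (at x)"
    by (rule has_derivative_linear_apply[OF open_U x(1) linear_d\<phi>
        smooth_on_has_derivative[OF smooth_on_dir_deriv[OF smooth_\<phi>] x(1)]
        has_dir_deriv[OF gradient_differentiable[OF smooth_H x(1)]]])
  then show ?thesis
    unfolding \<mu>_def[abs_def] using has_derivative_divide[OF _ has_derivative_norm2[OF x(1)] x(2)]
    by (auto simp: differentiable_def)
qed

lemma open_regular: "open {x \<in> U. P x \<noteq> 0}"
proof -
  have "continuous_on U P"
    by (rule continuous_at_imp_continuous_on) (blast intro: has_derivative_continuous[OF has_derivative_norm2])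
  then have "open (U \<inter> P -` (- {0}))"
    by (rule continuous_open_preimage[OF _ open_U]) (simp add: open_Compl)
  then show ?thesis by (simp add: vimage_def Int_def)
qed

text \<open>On the open set of regular points the gradient of \<open>\<phi>\<close> is
  \<open>\<mu> X\<close>; the product rule and \<open>\<nabla>\<^sub>v X = \<phi> v\<close> do the
  rest.\<close>

lemma nabla_Y:
  assumes x: "x \<in> U" "P x \<noteq> 0"
  shows "nY x v = dir_deriv \<mu> x v *\<^sub>R X x + (\<mu> x * \<phi> x) *\<^sub>R v"
proof -
  have Y: "Y y = \<mu> y *\<^sub>R X y" if "y \<in> {x \<in> U. P x \<noteq> 0}" for y
    using that by (intro nondegenerate[of y]) (auto simp: G_simps G_Y G_X d\<phi>_\<mu>)
  have "dir_deriv Y x v = dir_deriv (\<lambda>y. \<mu> y *\<^sub>R X y) x v"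
    by (rule dir_deriv_apply_cong[OF open_regular]) (use x Y in auto)
  also have "\<dots> = \<mu> x *\<^sub>R dir_deriv X x v + dir_deriv \<mu> x v *\<^sub>R X x"
    by (rule dir_deriv_eq[OF has_derivative_scaleR[OF has_dir_deriv[OF \<mu>_differentiable[OF x]]
        has_dir_deriv[OF gradient_differentiable[OF smooth_H x(1)]]]])
  finally show ?thesis
    using Y[of x] x by (simp add: nabla_gradient_def dX christoffel_simps algebra_simps)
qed

text \<open>In \<open>nabla_Y\<close> the multiple of the identity is symmetric, so symmetry of the
  Hessian of \<open>\<phi>\<close> makes the product of \<open>d\<mu>\<close> and \<open>dH\<close>
  symmetric.\<close>

lemma d\<mu>_parallel_dH:
  assumes x: "x \<in> U" "P x \<noteq> 0"
  shows "dir_deriv \<mu> x v * dir_deriv H x w = dir_deriv \<mu> x w * dir_deriv H x v"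
  using hessian_sym[OF smooth_\<phi> x(1), of v w] sym_G[OF x(1), of v w]
  by (simp add: nabla_Y[OF x] G_simps x G_X flip: G_nabla_gradient[OF smooth_\<phi>])

lemma tr_nabla_Y:
  assumes x: "x \<in> U" "P x \<noteq> 0"
  shows "tr (nY x) = dir_deriv \<mu> x (X x) + real DIM('e) * \<mu> x * \<phi> x"
proof -
  have "tr (nY x) = tr (\<lambda>v. dir_deriv \<mu> x v *\<^sub>R X x + (\<mu> x * \<phi> x) *\<^sub>R v)"
    using nabla_Y[OF x] by (intro tr_cong)
  also have "\<dots> = dir_deriv \<mu> x (X x) + (\<mu> x * \<phi> x) * real DIM('e)"
    by (simp add: tr_add tr_scaleR tr_id tr_rank_one[OF linear_dir_deriv[OF \<mu>_differentiable[OF x]]])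
  finally show ?thesis by simp
qed

end

section \<open>Gradient solitons in coordinates\<close>

locale coordinate_soliton = conformal_gradient +
  fixes \<rho> :: real
  assumes scalar_eq: "x \<in> U \<Longrightarrow> scalar G x = \<phi> x + \<rho>"
begin

lemma soliton_identity:
  assumes x: "x \<in> U" "P x \<noteq> 0"
  shows "\<mu> x * P x = - 2 * \<phi> x * (\<phi> x + \<rho>)
    - 2 * (real DIM('a) - 1) * (dir_deriv \<mu> x (X x) + real DIM('a) * \<mu> x * \<phi> x)"
proof -
  have "dir_deriv (scalar G) x (X x) = dir_deriv (\<lambda>y. \<phi> y + \<rho>) x (X x)"
    by (rule dir_deriv_apply_cong[OF open_U x(1)]) (rule scalar_eq)
  also have "\<dots> = d\<phi> x (X x)"
    by (rule dir_deriv_eq) (auto intro!: derivative_eq_intros has_derivative_\<phi> x)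
  also have "\<dots> = \<mu> x * P x" using x by (simp add: \<mu>_def)
  finally show ?thesis using dscalar_along_X[OF x(1)] by (simp add: scalar_eq[OF x(1)] tr_nabla_Y[OF x])
qed

text \<open>Along a curve with \<open>X = u c\<close> and \<open>c\<close> of unit length,
  \<open>P\<close> becomes \<open>u^2\<close> and \<open>X(\<mu>)\<close> becomes \<open>u\<close>
  times the derivative of \<open>\<mu>\<close>. The identity thus involves one real variable
  only.\<close>

lemma soliton_ode:
  assumes "C t \<in> U" "(C has_vector_derivative c) (at t)" "X (C t) = u *\<^sub>R c" "G (C t) c c = 1" "u \<noteq> 0"
  shows "((\<lambda>s. \<phi> (C s)) has_real_derivative \<mu> (C t) * u) (at t)"
    and "\<exists>m. ((\<lambda>s. \<mu> (C s)) has_real_derivative m) (at t) \<and>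
      \<mu> (C t) * u\<^sup>2 = - 2 * \<phi> (C t) * (\<phi> (C t) + \<rho>)
        - 2 * (real DIM('a) - 1) * (u * m + real DIM('a) * \<mu> (C t) * \<phi> (C t))"
proof -
  have P: "P (C t) = u\<^sup>2" using assms by (simp add: G_simps power2_eq_square)
  have reg: "P (C t) \<noteq> 0" using assms(5) P by simp
  have "dir_deriv H (C t) c = u"
    using assms(3,4) G_X[OF assms(1), of c] by (simp add: G_simps assms(1))
  then show "((\<lambda>s. \<phi> (C s)) has_real_derivative \<mu> (C t) * u) (at t)"
    using along_curve[OF has_derivative_\<phi>[OF assms(1)] assms(2)]
    by (simp add: d\<phi>_\<mu>[OF assms(1) reg] has_real_derivative_iff_has_vector_derivative)
  have "((\<lambda>s. \<mu> (C s)) has_real_derivative dir_deriv \<mu> (C t) c) (at t)"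
    using along_curve[OF has_dir_deriv[OF \<mu>_differentiable[OF assms(1) reg]] assms(2)]
    by (simp add: has_real_derivative_iff_has_vector_derivative)
  moreover have "dir_deriv \<mu> (C t) (X (C t)) = u * dir_deriv \<mu> (C t) c"
    unfolding assms(3) using linear_cmul[OF linear_dir_deriv[OF \<mu>_differentiable[OF assms(1) reg]]] by simp
  ultimately show "\<exists>m. ((\<lambda>s. \<mu> (C s)) has_real_derivative m) (at t) \<and>
      \<mu> (C t) * u\<^sup>2 = - 2 * \<phi> (C t) * (\<phi> (C t) + \<rho>)
        - 2 * (real DIM('a) - 1) * (u * m + real DIM('a) * \<mu> (C t) * \<phi> (C t))"
    using soliton_identity[OF assms(1) reg] P by auto
qed

text \<open>If \<open>\<mu>\<close> is constant in a direction \<open>w\<close> along which \<open>H\<close> is not, then \<open>\<mu>\<close> is locally constant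
  and differentiating the soliton identity twice in this direction forces \<open>\<mu> = 0\<close>.\<close>

lemma \<mu>_eq_0:
  assumes W: "open W" "W \<subseteq> U" and z: "z \<in> W"
    and H: "\<And>x. x \<in> W \<Longrightarrow> dir_deriv H x w \<noteq> 0" and \<mu>: "\<And>x. x \<in> W \<Longrightarrow> dir_deriv \<mu> x w = 0"
  shows "\<mu> z = 0"
proof -
  let ?N = "real DIM('a)"
  let ?c = "(?N - 1) * ?N"
  have reg: "x \<in> U" "P x \<noteq> 0" if "x \<in> W" for x
  proof -
    show x: "x \<in> U" using W that by auto
    have "X x \<noteq> 0" using H[OF that] G_X[OF x, of w] G_simps(7)[OF x] by auto
    then show "P x \<noteq> 0" using pos_G[OF x] by (metis less_irrefl)
  qed
  have d\<mu>: "dir_deriv \<mu> x v = 0" if "x \<in> W" for x v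
    using d\<mu>_parallel_dH[OF reg[OF that], of v w] H[OF that] \<mu>[OF that] by simp
  have h\<mu>: "(\<mu> has_derivative (\<lambda>v. 0)) (at x)" if "x \<in> W" for x
    using has_dir_deriv[OF \<mu>_differentiable[OF reg[OF that]]] d\<mu>[OF that] by (simp add: fun_eq_iff[symmetric])
  have 1: "\<mu> x * P x + 2 * \<phi> x * (\<phi> x + \<rho>) + 2 * ?c * (\<mu> x * \<phi> x) = 0" if "x \<in> W" for x
    using soliton_identity[OF reg[OF that]] d\<mu>[OF that] by (simp add: algebra_simps)
  \<comment> \<open>The equation \<open>1\<close> differentiated in direction \<open>w\<close>, with
    \<open>\<mu>\<close> constant and \<open>d\<phi> = \<mu> dH\<close>; the common factor is
    \<open>2 dH(w)\<close>.\<close>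
  have 2: "\<mu> x * (3 * \<phi> x + \<rho> + ?c * \<mu> x) = 0" if x: "x \<in> W" for x
  proof -
    have "((\<lambda>x. \<mu> x * P x + 2 * \<phi> x * (\<phi> x + \<rho>) + 2 * ?c * (\<mu> x * \<phi> x)) has_derivative
        (\<lambda>v. \<mu> x * (2 * \<phi> x * dir_deriv H x v) + 2 * (\<phi> x * d\<phi> x v + d\<phi> x v * (\<phi> x + \<rho>)) + 2 * ?c * (\<mu> x * d\<phi> x v))) (at x)"
      by (rule derivative_eq_intros h\<mu>[OF x] has_derivative_norm2 has_derivative_\<phi> reg[OF x] refl | simp add: algebra_simps)+
    then have "\<mu> x * (2 * \<phi> x * dir_deriv H x w) + 2 * (\<phi> x * d\<phi> x w + d\<phi> x w * (\<phi> x + \<rho>)) + 2 * ?c * (\<mu> x * d\<phi> x w)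
        = dir_deriv (\<lambda>x. \<mu> x * P x + 2 * \<phi> x * (\<phi> x + \<rho>) + 2 * ?c * (\<mu> x * \<phi> x)) x w"
      by (rule dir_deriv_eq[symmetric])
    also have "\<dots> = dir_deriv (\<lambda>x. 0) x w" by (rule dir_deriv_apply_cong[OF W(1) x 1])
    also have "\<dots> = 0" by (rule dir_deriv_eq) simp
    finally have "2 * dir_deriv H x w * (\<mu> x * (3 * \<phi> x + \<rho> + ?c * \<mu> x)) = 0"
      unfolding d\<phi>_\<mu>[OF reg[OF x]] by (simp add: algebra_simps)
    then show ?thesis using H[OF x] by simp
  qed
  \<comment> \<open>Only \<open>\<phi>\<close> still varies, so one more differentiation leaves
    \<open>3 \<mu>^2 dH(w) = 0\<close>.\<close>
  have "((\<lambda>x. \<mu> x * (3 * \<phi> x + \<rho> + ?c * \<mu> x)) has_derivative (\<lambda>v. \<mu> z * (3 * d\<phi> z v))) (at z)"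
    by (rule derivative_eq_intros h\<mu>[OF z] has_derivative_\<phi> reg[OF z] refl | simp add: algebra_simps)+
  then have "\<mu> z * (3 * d\<phi> z w) = dir_deriv (\<lambda>x. \<mu> x * (3 * \<phi> x + \<rho> + ?c * \<mu> x)) z w"
    by (rule dir_deriv_eq[symmetric])
  also have "\<dots> = dir_deriv (\<lambda>x. 0) z w" by (rule dir_deriv_apply_cong[OF W(1) z 2])
  also have "\<dots> = 0" by (rule dir_deriv_eq) simp
  finally show ?thesis using d\<phi>_\<mu>[OF reg[OF z], of w] H[OF z] by simp
qed

end

section \<open>The ordinary differential equation along a geodesic\<close>

lemma affine_positive_constant:
  fixes g :: "real \<Rightarrow> real"
  assumes "\<And>t. (g has_real_derivative k) (at t)" "\<And>t. g t > 0"
  shows "k = 0"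
proof (rule ccontr)
  assume k: "k \<noteq> 0"
  have "((\<lambda>t. g t - k * t) has_real_derivative 0) (at t)" for t
    by (auto intro!: derivative_eq_intros assms)
  from DERIV_isconst_all[OF allI[OF this], of "- g 0 / k" 0]
  have "g (- g 0 / k) = 0" using k by simp
  then show False using assms(2)[of "- g 0 / k"] by simp
qed

text \<open>The two sign conditions together give a vanishing derivative at an interior minimum; at
  an endpoint one of them remains available.\<close>

lemma minimum_on_interval:
  fixes f :: "real \<Rightarrow> real"
  assumes "a < b" "\<And>t. (f has_real_derivative f' t) (at t)"
  obtains s where "a \<le> s" "s \<le> b" "\<And>t. a \<le> t \<Longrightarrow> t \<le> b \<Longrightarrow> f s \<le> f t"
    "s < b \<Longrightarrow> f' s \<ge> 0" "a < s \<Longrightarrow> f' s \<le> 0"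
proof -
  have "continuous_on {a..b} f"
    using assms(2) by (meson DERIV_isCont continuous_at_imp_continuous_on)
  then obtain s where s: "s \<in> {a..b}" "\<And>t. t \<in> {a..b} \<Longrightarrow> f s \<le> f t"
    using continuous_attains_inf[of "{a..b}" f] assms(1) by fastforce
  have "f' s \<ge> 0" if "s < b"
  proof (rule ccontr)
    assume "\<not> 0 \<le> f' s"
    then obtain d where d: "d > 0" "\<And>h. h > 0 \<Longrightarrow> h < d \<Longrightarrow> f (s + h) < f s"
      using DERIV_neg_dec_right[OF assms(2)[of s]] by auto
    define h where "h = min (d / 2) (b - s)"
    have "h > 0" "h < d" "s + h \<le> b" using d that by (auto simp: h_def)
    then show False using d(2)[of h] s(2)[of "s + h"] s(1) by auto
  qed
  moreover have "f' s \<le> 0" if "a < s"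
  proof (rule ccontr)
    assume "\<not> f' s \<le> 0"
    then obtain d where d: "d > 0" "\<And>h. h > 0 \<Longrightarrow> h < d \<Longrightarrow> f (s - h) < f s"
      using DERIV_pos_inc_left[OF assms(2)[of s]] by auto
    define h where "h = min (d / 2) (s - a)"
    have "h > 0" "h < d" "s - h \<ge> a" using d that by (auto simp: h_def)
    then show False using d(2)[of h] s(2)[of "s - h"] s(1) by auto
  qed
  ultimately show thesis using that[of s] s by auto
qed

text \<open>\<open>K\<close> is a first integral of the equation; the hypothesis \<open>U' = Z \<ge> z > 0\<close> makes \<open>U\<close> large, and
  then the equation keeps \<open>U\<^sup>2 / Z\<close> bounded, so that \<open>U\<close> blows up in finite time.\<close>

lemma soliton_ode_blowup:
  fixes U Z M :: "real \<Rightarrow> real"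
  assumes p: "p > 0" and Upos: "\<And>s. U s > 0"
    and U: "\<And>s. (U has_real_derivative Z s) (at s)"
    and Z: "\<And>s. (Z has_real_derivative M s * U s) (at s)"
    and K: "\<And>s. 2 * p * (U s)\<^sup>2 * M s = K + (U s)\<^sup>2 * (Z s - \<rho>) - p * (p - 1) * (Z s)\<^sup>2"
    and z: "\<And>s. s \<ge> 0 \<Longrightarrow> Z s \<ge> z" "z > 0" "z > \<rho>"
  shows False
proof -
  \<comment> \<open>Chosen so that \<open>Z - \<rho> \<ge> \<kappa> Z\<close> whenever
    \<open>Z \<ge> z\<close>; for positive \<open>\<rho>\<close> it is positive because
    \<open>z > \<rho>\<close>.\<close>
  define \<kappa> where "\<kappa> = (if \<rho> \<le> 0 then 1 else 1 - \<rho> / z)"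
  have \<kappa>: "\<kappa> > 0" using z by (simp add: \<kappa>_def)
  have Z\<rho>: "Z s - \<rho> \<ge> \<kappa> * Z s" if "s \<ge> 0" for s
  proof (cases "\<rho> \<le> 0")
    case False
    then have "\<rho> * z \<le> \<rho> * Z s" using z(1)[OF that] by simp
    then show ?thesis using False z(2) by (simp add: \<kappa>_def field_simps)
  qed (simp add: \<kappa>_def)
  have Zpos: "Z s > 0" if "s \<ge> 0" for s using z(1)[OF that] z(2) by simp
  have Ugrow: "U s \<ge> z * s" if "s \<ge> 0" for s
  proof -
    have "U 0 - z * 0 \<le> U s - z * s"
    proof (rule DERIV_nonneg_imp_nondecreasing[OF that])
      fix r :: real assume "0 \<le> r"
      have "((\<lambda>s. U s - z * s) has_real_derivative Z r - z) (at r)"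
        by (auto intro!: derivative_eq_intros U)
      then show "\<exists>y. ((\<lambda>s. U s - z * s) has_real_derivative y) (at r) \<and> 0 \<le> y"
        using z(1)[OF \<open>0 \<le> r\<close>] by auto
    qed
    then show ?thesis using Upos[of 0] by simp
  qed
  define a where "a = \<kappa> / 2"
  \<comment> \<open>By \<open>Ugrow\<close>, from \<open>s0\<close> on \<open>U\<close> is at least
    1 and at least \<open>\<bar>K\<bar> / (a z)\<close>, hence so is \<open>U^2\<close>. Half of the
    term \<open>\<kappa> U^2 Z\<close> then absorbs \<open>K\<close>, and the other half is the
    coefficient \<open>a\<close> in \<open>large\<close>.\<close>
  define s0 where "s0 = 1 / z + \<bar>K\<bar> / (a * z\<^sup>2)"
  have a: "a > 0" using \<kappa> by (simp add: a_def)
  have s0: "s0 > 0" using z a by (simp add: s0_def add_pos_nonneg)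
  have large: "2 * p * (U s)\<^sup>2 * M s \<ge> a * (U s)\<^sup>2 * Z s - p * (p - 1) * (Z s)\<^sup>2" if "s \<ge> s0" for s
  proof -
    have s: "s \<ge> 0" using that s0 by simp
    have "z * s \<ge> z * s0" using that z by simp
    moreover have "z * s0 = 1 + \<bar>K\<bar> / (a * z)"
      using z a by (simp add: s0_def field_simps power2_eq_square)
    ultimately have U1: "U s \<ge> 1 + \<bar>K\<bar> / (a * z)" using Ugrow[OF s] by linarith
    then have "U s \<ge> 1" using a z by (smt (verit) divide_nonneg_pos mult_pos_pos abs_ge_zero)
    then have "(U s)\<^sup>2 \<ge> U s" by (simp add: power2_eq_square)
    then have "(U s)\<^sup>2 \<ge> \<bar>K\<bar> / (a * z)" using U1 by linarith
    then have "\<bar>K\<bar> \<le> a * z * (U s)\<^sup>2" using a z by (simp add: field_simps)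
    also have "\<dots> \<le> a * Z s * (U s)\<^sup>2" using a z(1)[OF s] by (intro mult_right_mono mult_left_mono) auto
    finally have "K \<ge> - (a * Z s * (U s)\<^sup>2)" by linarith
    moreover have "(U s)\<^sup>2 * (Z s - \<rho>) \<ge> (U s)\<^sup>2 * (\<kappa> * Z s)"
      by (intro mult_left_mono Z\<rho>[OF s]) auto
    ultimately show ?thesis unfolding K by (simp add: a_def field_simps)
  qed
  \<comment> \<open>The derivative of \<open>1 / U\<close> is \<open>- 1 / \<zeta>\<close>. An upper
    bound for \<open>\<zeta>\<close> therefore forces \<open>1 / U\<close> to zero in finite
    time.\<close>
  define \<zeta> where "\<zeta> s = (U s)\<^sup>2 / Z s" for s
  define \<zeta>' where "\<zeta>' s = (2 * U s * Z s * Z s - (U s)\<^sup>2 * (M s * U s)) / (Z s * Z s)" for s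
  have d\<zeta>: "(\<zeta> has_real_derivative \<zeta>' s) (at s)" if "s \<ge> 0" for s
    unfolding \<zeta>_def[abs_def] \<zeta>'_def using Zpos[OF that]
    by (auto intro!: derivative_eq_intros U Z simp: field_simps)
  \<comment> \<open>The threshold at which \<open>large\<close> yields \<open>U^2 M > 2 Z^2\<close>,
    the condition for \<open>\<zeta>' = U (2 Z^2 - U^2 M) / Z^2\<close> to be negative.\<close>
  define b where "b = 2 * p * (2 + (p - 1) / 2) / a"
  have neg: "\<zeta>' s < 0" if "s \<ge> s0" "\<zeta> s > b" for s
  proof -
    have Zs: "Z s > 0" using that s0 Zpos by simp
    have "2 * p * (2 + (p - 1) / 2) * Z s < a * (U s)\<^sup>2"
      using that(2) a Zs by (simp add: b_def \<zeta>_def field_simps)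
    then have "2 * p * (2 + (p - 1) / 2) * Z s * Z s < a * (U s)\<^sup>2 * Z s" using Zs by simp
    with large[OF that(1)] have "2 * p * (2 * (Z s * Z s)) < 2 * p * ((U s)\<^sup>2 * M s)"
      by (simp add: power2_eq_square field_simps)
    then have "2 * (Z s * Z s) < (U s)\<^sup>2 * M s" using p by (simp add: mult.commute[of "M s"])
    then have "U s * (2 * (Z s * Z s)) < U s * ((U s)\<^sup>2 * M s)" using Upos[of s] by simp
    then show ?thesis using Zs unfolding \<zeta>'_def by (simp add: divide_neg_pos algebra_simps)
  qed
  define D where "D = max (\<zeta> s0) b"
  have bound: "\<zeta> s \<le> D" if s: "s \<ge> s0" for s
  proof (rule ccontr)
    assume "\<not> \<zeta> s \<le> D"
    then have sD: "\<zeta> s > \<zeta> s0" "\<zeta> s > b" by (auto simp: D_def)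
    \<comment> \<open>A maximum over \<open>{s0..s}\<close> lies after \<open>s0\<close> and above
      the threshold, where \<open>\<zeta>\<close> decreases; slightly earlier values would then be
      larger.\<close>
    have "continuous_on {s0..s} \<zeta>"
      using s0 by (intro continuous_at_imp_continuous_on ballI DERIV_isCont[OF d\<zeta>]) auto
    then obtain r where r: "r \<in> {s0..s}" "\<And>t. t \<in> {s0..s} \<Longrightarrow> \<zeta> t \<le> \<zeta> r"
      using continuous_attains_sup[of "{s0..s}" \<zeta>] s by fastforce
    have "\<zeta> r \<ge> \<zeta> s" using r s by auto
    then have r0: "r > s0" "\<zeta> r > b" using sD r(1) by (auto simp: less_le)
    have "r \<ge> 0" using r0 s0 by simp
    obtain d where d: "d > 0" "\<And>h. h > 0 \<Longrightarrow> h < d \<Longrightarrow> \<zeta> r < \<zeta> (r - h)"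
      using DERIV_neg_dec_left[OF d\<zeta>[OF \<open>r \<ge> 0\<close>] neg] r0 by auto
    define h where "h = min (d / 2) (r - s0)"
    have "h > 0" "h < d" "r - h \<ge> s0" using d r0 by (auto simp: h_def)
    then show False using d(2)[of h] r(2)[of "r - h"] r(1) by auto
  qed
  have \<zeta>pos: "\<zeta> s > 0" if "s \<ge> 0" for s unfolding \<zeta>_def using Upos[of s] Zpos[OF that] by simp
  have D: "D > 0" using \<zeta>pos[of s0] s0 by (simp add: D_def less_max_iff_disj)
  \<comment> \<open>\<open>1 / U\<close> decreases at rate at least \<open>1 / D\<close>, so
    starting from \<open>1 / U s0\<close> it is used up after time \<open>D / U s0\<close>.\<close>
  define s1 where "s1 = s0 + D / U s0"
  have s1: "s0 \<le> s1" using D Upos[of s0] by (simp add: s1_def)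
  have "1 / U s0 + s0 / D \<ge> 1 / U s1 + s1 / D"
  proof (rule DERIV_nonpos_imp_nonincreasing[OF s1])
    fix r assume r: "s0 \<le> r"
    have "((\<lambda>s. 1 / U s + s / D) has_real_derivative - (Z r / (U r)\<^sup>2) + 1 / D) (at r)"
      using Upos[of r] D by (auto intro!: derivative_eq_intros U simp: power2_eq_square)
    moreover have "1 / D \<le> Z r / (U r)\<^sup>2"
      using bound[OF r] Zpos[of r] r s0 D Upos[of r] by (simp add: \<zeta>_def field_simps)
    ultimately show "\<exists>y. ((\<lambda>s. 1 / U s + s / D) has_real_derivative y) (at r) \<and> y \<le> 0"
      by (intro exI conjI) auto
  qed
  moreover have "s1 / D = s0 / D + 1 / U s0" using D by (simp add: s1_def add_divide_distrib)
  ultimately have "1 / U s1 \<le> 0" by simp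
  then show False using Upos[of s1] by (simp add: divide_le_0_iff)
qed

text \<open>Here \<open>p\<close> is the dimension minus one. The sign of \<open>\<mu>\<close>
  decides between the two contradictions: if \<open>\<mu> \<le> 0\<close> at some time with
  \<open>\<phi> \<le> \<phi> t\<close>, then \<open>\<phi>\<close> stays negative and
  \<open>u\<close> reaches zero in forward time; if \<open>\<mu> > 0\<close> at all such times, then
  \<open>\<phi> \<le> \<phi> t\<close> throughout the past and the blow-up occurs there.\<close>

lemma soliton_ode_lower_bound:
  fixes u \<phi> \<mu> :: "real \<Rightarrow> real"
  assumes p: "p > 0" and upos: "\<And>t. u t > 0"
    and u: "\<And>t. (u has_real_derivative \<phi> t) (at t)"
    and \<phi>: "\<And>t. (\<phi> has_real_derivative \<mu> t * u t) (at t)"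
    and \<mu>: "\<And>t. \<exists>m. (\<mu> has_real_derivative m) (at t) \<and>
      \<mu> t * (u t)\<^sup>2 = - 2 * \<phi> t * (\<phi> t + \<rho>) - 2 * p * (u t * m + (p + 1) * \<mu> t * \<phi> t)"
  shows "\<phi> t \<ge> min 0 (- \<rho>)"
proof (rule ccontr)
  assume "\<not> \<phi> t \<ge> min 0 (- \<rho>)"
  then have t: "\<phi> t < 0" "\<phi> t + \<rho> < 0" by auto
  obtain m where m: "\<And>t. (\<mu> has_real_derivative m t) (at t)"
    and ode: "\<And>t. \<mu> t * (u t)\<^sup>2 = - 2 * \<phi> t * (\<phi> t + \<rho>) - 2 * p * (u t * m t + (p + 1) * \<mu> t * \<phi> t)"
    using \<mu> by metis
  have \<mu>pos: "\<mu> a > 0" if a: "\<phi> a \<le> \<phi> t" for a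
  proof (rule ccontr)
    assume "\<not> \<mu> a > 0"
    then have \<mu>a: "\<mu> a * u a \<le> 0" using upos[of a] by (simp add: mult_le_0_iff)
    have le: "\<phi> b \<le> \<phi> a" if "a \<le> b" for b
    proof (rule ccontr)
      assume b: "\<not> \<phi> b \<le> \<phi> a"
      then have "a < b" using that by (cases "a = b") auto
      obtain s where s: "a \<le> s" "s \<le> b" "\<And>t. a \<le> t \<Longrightarrow> t \<le> b \<Longrightarrow> \<phi> s \<le> \<phi> t"
        "s < b \<Longrightarrow> \<mu> s * u s \<ge> 0" "a < s \<Longrightarrow> \<mu> s * u s \<le> 0"
        using minimum_on_interval[OF \<open>a < b\<close> \<phi>] by metis
      have \<phi>s: "\<phi> s \<le> \<phi> a" using s \<open>a < b\<close> by auto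
      then have "s < b" using b s(2) by (cases "s = b") auto
      have "\<mu> s * u s = 0" using s(4)[OF \<open>s < b\<close>] s(1,5) \<mu>a by (cases "a = s") auto
      then have "\<mu> s = 0" using upos[of s] by simp
      have "\<phi> s < 0" "\<phi> s + \<rho> < 0" using \<phi>s a t by auto
      \<comment> \<open>At a zero of \<open>\<mu>\<close> the equation reduces to
        \<open>p u \<mu>' = - \<phi> (\<phi> + \<rho>)\<close>. Both factors on the right are
        negative, so \<open>\<mu>\<close> and with it \<open>\<phi>'\<close> turn negative just
        after \<open>s\<close>, below the supposed minimum.\<close>
      then have "\<phi> s * (\<phi> s + \<rho>) > 0" by (simp add: mult_neg_neg)
      then have "p * (u s * m s) < 0" using ode[of s] \<open>\<mu> s = 0\<close> by (simp add: mult.commute[of "u s"])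
      then have "m s < 0" using p upos[of s] by (simp add: mult_less_0_iff zero_less_mult_iff)
      then obtain d where d: "d > 0" "\<And>h. h > 0 \<Longrightarrow> h < d \<Longrightarrow> \<mu> (s + h) < \<mu> s"
        using DERIV_neg_dec_right[OF m[of s]] by auto
      define r where "r = s + min (d / 2) (b - s)"
      have r: "s < r" "r \<le> b" "r - s < d" using d \<open>s < b\<close> by (auto simp: r_def)
      obtain c where c: "s < c" "c < r" "\<phi> r - \<phi> s = (r - s) * (\<mu> c * u c)"
        using MVT2[OF r(1), of \<phi> "\<lambda>c. \<mu> c * u c"] \<phi> by auto
      have "\<mu> c < 0" using d(2)[of "c - s"] c r \<open>\<mu> s = 0\<close> by auto
      then have "(r - s) * (\<mu> c * u c) < 0" using r(1) upos[of c] by (simp add: mult_less_0_iff zero_less_mult_iff)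
      then show False using c(3) s(3)[of r] r s(1) by auto
    qed
    \<comment> \<open>The zero of the tangent line of \<open>u\<close> at \<open>a\<close>; since
      \<open>\<phi>\<close> never rises above \<open>\<phi> a\<close> afterwards, \<open>u\<close>
      stays below this line.\<close>
    define b where "b = a + u a / (- \<phi> a)"
    have \<phi>a: "\<phi> a < 0" using a t by simp
    have ab: "a \<le> b" using \<phi>a upos[of a] by (simp add: b_def divide_nonneg_neg)
    have "u a - \<phi> a * a \<ge> u b - \<phi> a * b"
    proof (rule DERIV_nonpos_imp_nonincreasing[OF ab])
      fix r assume "a \<le> r"
      have "((\<lambda>s. u s - \<phi> a * s) has_real_derivative \<phi> r - \<phi> a) (at r)"
        by (auto intro!: derivative_eq_intros u)
      then show "\<exists>y. ((\<lambda>s. u s - \<phi> a * s) has_real_derivative y) (at r) \<and> y \<le> 0"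
        using le[OF \<open>a \<le> r\<close>] by auto
    qed
    moreover have "\<phi> a * b = \<phi> a * a - u a" using \<phi>a by (simp add: b_def field_simps)
    ultimately show False using upos[of b] by simp
  qed
  \<comment> \<open>The minimum over \<open>{a..t}\<close> cannot lie after \<open>a\<close>: it is
    at most \<open>\<phi> t\<close>, so \<open>\<mu> > 0\<close> there and \<open>\<phi>\<close> is
    strictly increasing.\<close>
  have le_t: "\<phi> a \<le> \<phi> t" if "a \<le> t" for a
  proof (rule ccontr)
    assume a: "\<not> \<phi> a \<le> \<phi> t"
    then have "a < t" using that by (cases "a = t") auto
    obtain s where s: "a \<le> s" "s \<le> t" "\<And>r. a \<le> r \<Longrightarrow> r \<le> t \<Longrightarrow> \<phi> s \<le> \<phi> r"
      "a < s \<Longrightarrow> \<mu> s * u s \<le> 0"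
      using minimum_on_interval[OF \<open>a < t\<close> \<phi>] by metis
    have \<phi>s: "\<phi> s \<le> \<phi> t" using s \<open>a < t\<close> by auto
    then have "a < s" using a s(1) by (cases "a = s") auto
    moreover have "\<mu> s * u s > 0" using \<mu>pos[OF \<phi>s] upos[of s] by simp
    ultimately show False using s(4) by simp
  qed
  \<comment> \<open>From the scalar curvature of \<open>dt^2 + u^2 g_N\<close>, solved for that of
    \<open>g_N\<close>, with \<open>u' = \<phi>\<close> and \<open>u'' = \<mu> u\<close>. Its
    derivative is \<open>u\<close> times the equation.\<close>
  define k where "k r = (u r)\<^sup>2 * (\<phi> r + \<rho>) + 2 * p * (u r)\<^sup>2 * \<mu> r + p * (p - 1) * (\<phi> r)\<^sup>2" for r
  have k: "(k has_real_derivative 0) (at r)" for r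
  proof -
    have "(k has_real_derivative u r * (2 * \<phi> r * (\<phi> r + \<rho>) + \<mu> r * (u r)\<^sup>2
        + 2 * p * (u r * m r + (p + 1) * \<mu> r * \<phi> r))) (at r)"
      unfolding k_def[abs_def]
      by (rule derivative_eq_intros u \<phi> m refl | simp add: power2_eq_square algebra_simps)+
    then show ?thesis using ode[of r] by (simp add: algebra_simps)
  qed
  have kc: "k r = k 0" for r
    using DERIV_isconst_all[of k] k by blast
  show False
  \<comment> \<open>Time is reversed about \<open>t\<close>, which changes the sign of
    \<open>\<phi> = u'\<close> but not of \<open>\<mu> = u'' / u\<close>.\<close>
  proof (rule soliton_ode_blowup[of p "\<lambda>s. u (t - s)" "\<lambda>s. - \<phi> (t - s)" "\<lambda>s. \<mu> (t - s)" "k 0" \<rho> "- \<phi> t"])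
    fix s :: real
    have d: "((\<lambda>s. t - s) has_real_derivative - 1) (at s)" by (auto intro!: derivative_eq_intros)
    show "((\<lambda>s. u (t - s)) has_real_derivative - \<phi> (t - s)) (at s)"
      using DERIV_chain2[OF u d] by simp
    show "((\<lambda>s. - \<phi> (t - s)) has_real_derivative \<mu> (t - s) * u (t - s)) (at s)"
      using DERIV_minus[OF DERIV_chain2[OF \<phi> d]] by simp
    show "2 * p * (u (t - s))\<^sup>2 * \<mu> (t - s)
        = k 0 + (u (t - s))\<^sup>2 * (- \<phi> (t - s) - \<rho>) - p * (p - 1) * (- \<phi> (t - s))\<^sup>2"
      using kc[of "t - s"] by (simp add: k_def algebra_simps)
    show "- \<phi> (t - s) \<ge> - \<phi> t" if "s \<ge> 0" using le_t[of "t - s"] that by simp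
  qed (use p upos t in auto)
qed

section \<open>Change of coordinates\<close>

text \<open>A local isometry in coordinates; no inverse of \<open>\<Phi>\<close> is assumed.
  Surjectivity of its differential is enough to test equalities on vectors \<open>D x z\<close>, and
  in equal dimensions it makes \<open>D x\<close> invertible.\<close>

locale coordinate_change = N: metric_on V G' + metric_on U G
  for V :: "'e::euclidean_space set" and G' and U :: "'e set" and G +
  fixes \<Phi> :: "'e \<Rightarrow> 'e"
  assumes smooth_\<Phi>: "smooth_on V \<Phi>" and \<Phi>_V: "\<Phi> ` V \<subseteq> U"
    and surj_d\<Phi>: "x \<in> V \<Longrightarrow> surj (dir_deriv \<Phi> x)"
    and pullback: "x \<in> V \<Longrightarrow> G' x v w = G (\<Phi> x) (dir_deriv \<Phi> x v) (dir_deriv \<Phi> x w)"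
begin

abbreviation D :: "'e \<Rightarrow> 'e \<Rightarrow> 'e" where "D \<equiv> dir_deriv \<Phi>"
abbreviation D2 :: "'e \<Rightarrow> 'e \<Rightarrow> 'e \<Rightarrow> 'e" where "D2 x v w \<equiv> dir_deriv (\<lambda>y. D y w) x v"

lemma \<Phi>_U: "x \<in> V \<Longrightarrow> \<Phi> x \<in> U" using \<Phi>_V by auto

lemma has_derivative_\<Phi>: "x \<in> V \<Longrightarrow> (\<Phi> has_derivative D x) (at x)"
  by (rule smooth_on_has_derivative[OF smooth_\<Phi>])

lemma has_derivative_D: "x \<in> V \<Longrightarrow> ((\<lambda>y. D y w) has_derivative (\<lambda>v. D2 x v w)) (at x)"
  by (rule smooth_on_has_derivative[OF smooth_on_dir_deriv[OF smooth_\<Phi>]])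

lemma linear_D: "x \<in> V \<Longrightarrow> linear (D x)"
  by (rule linear_dir_deriv[OF smooth_on_differentiable[OF smooth_\<Phi>]])

lemma D_simps:
  assumes "x \<in> V"
  shows "D x (a + b) = D x a + D x b" "D x (a - b) = D x a - D x b" "D x (r *\<^sub>R a) = r *\<^sub>R D x a"
  using linear_D[OF assms, THEN linear_add] linear_D[OF assms, THEN linear_diff] linear_D[OF assms, THEN linear_cmul]
  by auto

lemma D2_sym: "x \<in> V \<Longrightarrow> D2 x v w = D2 x w v"
  by (rule dir_deriv_commute[OF smooth_\<Phi>])

lemma has_derivative_compose_\<Phi>:
  "x \<in> V \<Longrightarrow> (F has_derivative F') (at (\<Phi> x)) \<Longrightarrow> ((\<lambda>y. F (\<Phi> y)) has_derivative (\<lambda>v. F' (D x v))) (at x)"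
  by (rule has_derivative_compose[OF has_derivative_\<Phi>])

lemma dG_pullback:
  assumes x: "x \<in> V"
  shows "N.dG x u v w = dG (\<Phi> x) (D x u) (D x v) (D x w) + G (\<Phi> x) (D2 x u v) (D x w) + G (\<Phi> x) (D x v) (D2 x u w)"
proof -
  have "N.dG x u v w = dir_deriv (\<lambda>y. G (\<Phi> y) (D y v) (D y w)) x u"
    by (rule dir_deriv_apply_cong[OF N.open_U x]) (rule pullback)
  also have "\<dots> = dG (\<Phi> x) (D x u) (D x v) (D x w) + G (\<Phi> x) (D2 x u v) (D x w) + G (\<Phi> x) (D x v) (D2 x u w)"
    by (rule dir_deriv_eq[OF has_derivative_bilinear_apply[where T = "\<lambda>y. G (\<Phi> y)", OF N.open_U x bilinear_G[OF \<Phi>_U]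
        has_derivative_compose_\<Phi>[OF x has_dir_deriv[OF G_differentiable[OF \<Phi>_U[OF x]]]]
        has_derivative_D[OF x] has_derivative_D[OF x]]])
  finally show ?thesis .
qed

lemma eq_by_D:
  assumes x: "x \<in> V" and "\<And>z. G (\<Phi> x) a (D x z) = G (\<Phi> x) b (D x z)"
  shows "a = b"
proof (rule nondegenerate[OF \<Phi>_U[OF x]])
  fix w
  obtain z where "w = D x z" using surj_d\<Phi>[OF x] by (metis surjD)
  then show "G (\<Phi> x) a w = G (\<Phi> x) b w" using assms(2) by simp
qed

text \<open>Of the six second derivative terms in Koszul's formula for the pulled back metric, four
  cancel by symmetry of \<open>D2\<close> and \<open>G\<close>; the remaining two combine into the
  inhomogeneous term of the transformation law.\<close>

lemma christoffel_pullback: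
  assumes x: "x \<in> V"
  shows "D x (N.\<Gamma> x v w) = \<Gamma> (\<Phi> x) (D x v) (D x w) + D2 x v w"
proof (rule eq_by_D[OF x])
  fix z
  have "G (\<Phi> x) (D x (N.\<Gamma> x v w)) (D x z) = N.koszul x v w z"
    using N.G_christoffel[OF x] pullback[OF x] by simp
  also have "\<dots> = koszul (\<Phi> x) (D x v) (D x w) (D x z) + G (\<Phi> x) (D2 x v w) (D x z)"
    by (simp add: N.koszul_def koszul_def dG_pullback[OF x] D2_sym[OF x, of w v] D2_sym[OF x, of z]
        sym_G[OF \<Phi>_U[OF x], of "D x v"] sym_G[OF \<Phi>_U[OF x], of "D x w"] field_simps)
  finally show "G (\<Phi> x) (D x (N.\<Gamma> x v w)) (D x z)
      = G (\<Phi> x) (\<Gamma> (\<Phi> x) (D x v) (D x w) + D2 x v w) (D x z)"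
    by (simp add: G_simps[OF \<Phi>_U[OF x]] G_christoffel[OF \<Phi>_U[OF x]])
qed

text \<open>Differentiating the law for \<open>\<Gamma>\<close> brings in third derivatives of
  \<open>\<Phi>\<close>, which are symmetric in \<open>u\<close> and \<open>v\<close>. The other
  inhomogeneous terms cancel against those of the quadratic part of the curvature.\<close>

lemma riemann_pullback:
  assumes x: "x \<in> V"
  shows "D x (N.R x u v w) = R (\<Phi> x) (D x u) (D x v) (D x w)"
proof -
  note \<Phi>x = \<Phi>_U[OF x]
  have *: "D2 x u (N.\<Gamma> x v w) + D x (N.d\<Gamma> x u v w) = d\<Gamma> (\<Phi> x) (D x u) (D x v) (D x w)
      + \<Gamma> (\<Phi> x) (D2 x u v) (D x w) + \<Gamma> (\<Phi> x) (D x v) (D2 x u w) + dir_deriv (\<lambda>y. D2 y v w) x u" for u v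
  proof -
    have "D2 x u (N.\<Gamma> x v w) + D x (N.d\<Gamma> x u v w) = dir_deriv (\<lambda>y. D y (N.\<Gamma> y v w)) x u"
      by (rule dir_deriv_eq[symmetric, OF has_derivative_linear_apply[where T = D, OF N.open_U x linear_D
            has_derivative_D[OF x] has_dir_deriv[OF N.christoffel_differentiable[OF x]]]])
    also have "\<dots> = dir_deriv (\<lambda>y. \<Gamma> (\<Phi> y) (D y v) (D y w) + D2 y v w) x u"
      by (rule dir_deriv_apply_cong[OF N.open_U x]) (rule christoffel_pullback)
    also have "\<dots> = d\<Gamma> (\<Phi> x) (D x u) (D x v) (D x w)
      + \<Gamma> (\<Phi> x) (D2 x u v) (D x w) + \<Gamma> (\<Phi> x) (D x v) (D2 x u w) + dir_deriv (\<lambda>y. D2 y v w) x u"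
      by (rule dir_deriv_eq[OF has_derivative_add[OF has_derivative_bilinear_apply[where T = "\<lambda>y. \<Gamma> (\<Phi> y)",
              OF N.open_U x bilinear_christoffel[OF \<Phi>_U]
              has_derivative_compose_\<Phi>[OF x has_dir_deriv[OF christoffel_differentiable[OF \<Phi>x]]]
              has_derivative_D[OF x] has_derivative_D[OF x]]
            smooth_on_has_derivative[OF smooth_on_dir_deriv[OF smooth_on_dir_deriv[OF smooth_\<Phi>]] x]]])
    finally show ?thesis .
  qed
  have 3: "dir_deriv (\<lambda>y. D2 y v w) x u = dir_deriv (\<lambda>y. D2 y u w) x v"
    by (rule dir_deriv_commute[OF smooth_on_dir_deriv[OF smooth_\<Phi>] x])
  have 4: "D x (N.\<Gamma> x u (N.\<Gamma> x v w)) = \<Gamma> (\<Phi> x) (D x u) (\<Gamma> (\<Phi> x) (D x v) (D x w)) + \<Gamma> (\<Phi> x) (D x u) (D2 x v w)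
      + D2 x u (N.\<Gamma> x v w)" for u v
    by (simp add: christoffel_pullback[OF x] christoffel_simps[OF \<Phi>x])
  have 5: "D x (N.d\<Gamma> x u v w) = d\<Gamma> (\<Phi> x) (D x u) (D x v) (D x w)
      + \<Gamma> (\<Phi> x) (D2 x u v) (D x w) + \<Gamma> (\<Phi> x) (D x v) (D2 x u w) + dir_deriv (\<lambda>y. D2 y v w) x u - D2 x u (N.\<Gamma> x v w)" for u v
    using *[where u = u and v = v] by (simp add: algebra_simps)
  show ?thesis
    unfolding riemann_def D_simps[OF x] 4 5
    by (simp add: 3 D2_sym[OF x, of u v])
qed

text \<open>\<open>L\<close> and \<open>L'\<close> are conjugate by the invertible map
  \<open>D x\<close>.\<close>

lemma tr_pullback:
  assumes x: "x \<in> V" and "linear L" "linear L'" and DL: "\<And>v. D x (L v) = L' (D x v)"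
  shows "tr L = tr L'"
proof -
  have inj: "inj (D x)" by (rule linear_surjective_imp_injective[OF linear_D[OF x] surj_d\<Phi>[OF x] refl])
  obtain E where E: "linear E" "E \<circ> D x = id"
    using linear_injective_left_inverse[OF linear_D[OF x] inj] by auto
  have ED: "E (D x v) = v" for v using E(2) by (metis comp_apply id_apply)
  have DE: "D x (E v) = v" for v using ED surj_d\<Phi>[OF x] by (metis surjD)
  have "tr L = tr (\<lambda>v. E (L' (D x v)))" by (rule tr_cong) (simp add: ED flip: DL)
  also have "\<dots> = tr (\<lambda>v. L' (D x (E v)))"
    by (rule tr_commute[of E "\<lambda>v. L' (D x v)"])
      (use E(1) linear_compose[OF linear_D[OF x] assms(3)] in \<open>simp_all add: o_def\<close>)
  finally show ?thesis by (simp add: DE)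
qed

lemma ricci_pullback:
  assumes x: "x \<in> V"
  shows "ricci G' x v w = ricci G (\<Phi> x) (D x v) (D x w)"
  unfolding N.ricci_tr ricci_tr
  by (rule tr_pullback[OF x N.linear_riemann(1)[OF x] linear_riemann(1)[OF \<Phi>_U[OF x]]]) (rule riemann_pullback[OF x])

lemma scalar_pullback:
  assumes x: "x \<in> V"
  shows "scalar G' x = scalar G (\<Phi> x)"
  unfolding N.scalar_tr scalar_tr
proof (rule tr_pullback[OF x N.linear_ricci_op[OF x] linear_ricci_op[OF \<Phi>_U[OF x]]])
  show "D x (N.ricci_op x v) = ricci_op (\<Phi> x) (D x v)" for v
    by (rule eq_by_D[OF x]) (simp add: N.G_ricci_op[OF x] G_ricci_op[OF \<Phi>_U[OF x]] ricci_pullback[OF x] flip: pullback[OF x])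
qed

lemma dir_deriv_pullback:
  assumes "smooth_on U H" "x \<in> V"
  shows "dir_deriv (\<lambda>y. H (\<Phi> y)) x v = dir_deriv H (\<Phi> x) (D x v)"
  by (rule dir_deriv_eq[OF has_derivative_compose_\<Phi>[OF assms(2) smooth_on_has_derivative[OF assms(1) \<Phi>_U[OF assms(2)]]]])

lemma gradient_pullback:
  assumes H: "smooth_on U H" and H': "smooth_on V (\<lambda>y. H (\<Phi> y))" and x: "x \<in> V"
  shows "D x (gradient G' (\<lambda>y. H (\<Phi> y)) x) = gradient G H (\<Phi> x)"
  by (rule eq_by_D[OF x])
    (simp add: N.G_gradient[OF H' x] G_gradient[OF H \<Phi>_U[OF x]] dir_deriv_pullback[OF H x] flip: pullback[OF x])

lemma hessian_pullback:
  assumes H: "smooth_on U H" and x: "x \<in> V"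
  shows "hessian G' (\<lambda>y. H (\<Phi> y)) x v w = hessian G H (\<Phi> x) (D x v) (D x w)"
proof -
  have "dir_deriv (\<lambda>y. dir_deriv (\<lambda>y. H (\<Phi> y)) y w) x v = dir_deriv (\<lambda>y. dir_deriv H (\<Phi> y) (D y w)) x v"
    by (rule dir_deriv_apply_cong[OF N.open_U x]) (rule dir_deriv_pullback[OF H])
  also have "\<dots> = dir_deriv (\<lambda>z. dir_deriv H z (D x w)) (\<Phi> x) (D x v) + dir_deriv H (\<Phi> x) (D2 x v w)"
    by (rule dir_deriv_eq[OF has_derivative_linear_apply[where T = "\<lambda>y. dir_deriv H (\<Phi> y)", OF N.open_U x
          linear_dir_deriv[OF smooth_on_differentiable[OF H \<Phi>_U]]
          has_derivative_compose_\<Phi>[OF x smooth_on_has_derivative[OF smooth_on_dir_deriv[OF H] \<Phi>_U[OF x]]]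
          has_derivative_D[OF x]]])
  finally show ?thesis
    unfolding hessian_def dir_deriv_pullback[OF H x] christoffel_pullback[OF x]
    using linear_dir_deriv[OF smooth_on_differentiable[OF H \<Phi>_U[OF x]], THEN linear_add]
    by simp
qed

end

section \<open>Riemannian manifolds\<close>

lemma metric_on_subset: "metric_on U G \<Longrightarrow> V \<subseteq> U \<Longrightarrow> open V \<Longrightarrow> metric_on V G"
  unfolding metric_on_def by (auto intro: smooth_on_subset)

lemma hessian_cong:
  assumes "open V" "x \<in> V" "\<And>y. y \<in> V \<Longrightarrow> H y = K y"
  shows "hessian G H x v w = hessian G K x v w"
proof -
  have 1: "dir_deriv H y w = dir_deriv K y w" if "y \<in> V" for y w
    by (rule dir_deriv_apply_cong[OF assms(1) that assms(3)])
  show ?thesis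
    unfolding hessian_def using dir_deriv_apply_cong[OF assms(1,2) 1] 1[OF assms(2)] by simp
qed

lemma gradient_cong:
  assumes "open V" "x \<in> V" "\<And>y. y \<in> V \<Longrightarrow> H y = K y"
  shows "gradient G H x = gradient G K x"
  by (simp add: gradient_def dir_deriv_cong[OF assms])

section \<open>Charts and transition maps\<close>

locale manifold =
  fixes M :: "('a::{t2_space, second_countable_topology}, 'e::euclidean_space) riem"
  assumes smooth_M: "smooth_manifold M"
begin

lemma chart: "p \<in> chart_dom M p" "open (chart_dom M p)" "open (chart_img M p)"
    "homeomorphism (chart_dom M p) (chart_img M p) (chart_map M p) (param M p)"
  using smooth_M by (auto simp: smooth_manifold_def)

lemma param_chart: "q \<in> chart_dom M p \<Longrightarrow> param M p (chart_map M p q) = q"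
  using chart(4) homeomorphism_apply1 by metis

lemma chart_param: "x \<in> chart_img M p \<Longrightarrow> chart_map M p (param M p x) = x"
  using chart(4) homeomorphism_apply2 by metis

lemma param_dom: "x \<in> chart_img M p \<Longrightarrow> param M p x \<in> chart_dom M p"
  using homeomorphism_image2[OF chart(4)[of p]] by blast

lemma chart_in_img: "q \<in> chart_dom M p \<Longrightarrow> chart_map M p q \<in> chart_img M p"
  by (simp add: chart_img_def)

definition overlap :: "'a \<Rightarrow> 'a \<Rightarrow> 'e set"
  where "overlap p q = chart_map M p ` (chart_dom M p \<inter> chart_dom M q)"

definition transition :: "'a \<Rightarrow> 'a \<Rightarrow> 'e \<Rightarrow> 'e"
  where "transition p q = chart_map M q \<circ> param M p"

lemma smooth_transition: "smooth_on (overlap p q) (transition p q)"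
  using smooth_M by (simp add: smooth_manifold_def overlap_def transition_def)

lemma open_overlap: "open (overlap p q)"
  by (rule smooth_on_open[OF smooth_transition])

lemma overlap_iff: "x \<in> overlap p q \<longleftrightarrow> x \<in> chart_img M p \<and> param M p x \<in> chart_dom M q"
  by (force simp: overlap_def param_chart chart_param chart_in_img intro: param_dom)

lemma overlap_subset: "overlap p q \<subseteq> chart_img M p"
  by (auto simp: overlap_iff)

lemma in_overlap: "x \<in> chart_img M p \<Longrightarrow> x \<in> overlap p (param M p x)"
  by (simp add: overlap_iff chart)

lemma param_transition: "x \<in> overlap p q \<Longrightarrow> param M q (transition p q x) = param M p x"
  by (simp add: transition_def overlap_iff param_chart)

lemma transition_overlap: "x \<in> overlap p q \<Longrightarrow> transition p q x \<in> overlap q p"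
  by (simp add: overlap_iff transition_def param_chart chart_in_img param_dom)

lemma has_derivative_transition:
  "x \<in> overlap p q \<Longrightarrow> (transition p q has_derivative dir_deriv (transition p q) x) (at x)"
  by (rule smooth_on_has_derivative[OF smooth_transition])

lemma linear_dtransition: "x \<in> overlap p q \<Longrightarrow> linear (dir_deriv (transition p q) x)"
  by (rule linear_dir_deriv[OF smooth_on_differentiable[OF smooth_transition]])

lemma dtransition_compose:
  assumes x: "x \<in> overlap p q" "x \<in> overlap p r"
  shows "dir_deriv (transition q r) (transition p q x) (dir_deriv (transition p q) x v) = dir_deriv (transition p r) x v"
proof -
  have r: "transition p q x \<in> overlap q r"
    using x transition_overlap[OF x(1)] by (simp add: overlap_iff[of _ q r] overlap_iff[of _ q p] param_transition overlap_iff[of x p r])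
  have "dir_deriv (transition p r) x v = dir_deriv (\<lambda>y. transition q r (transition p q y)) x v"
    by (rule dir_deriv_apply_cong[OF open_overlap x(1)]) (simp add: transition_def overlap_iff param_chart)
  also have "\<dots> = dir_deriv (transition q r) (transition p q x) (dir_deriv (transition p q) x v)"
    by (rule dir_deriv_eq[OF has_derivative_compose[OF has_derivative_transition[OF x(1)] has_derivative_transition[OF r]]])
  finally show ?thesis by simp
qed

lemma dtransition_id:
  assumes "x \<in> chart_img M p"
  shows "dir_deriv (transition p p) x v = v"
proof -
  have "dir_deriv (transition p p) x v = dir_deriv (\<lambda>y. y) x v"
    by (rule dir_deriv_apply_cong[OF chart(3) assms]) (simp add: transition_def chart_param)
  also have "\<dots> = v" by (rule dir_deriv_eq) simp
  finally show ?thesis .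
qed

lemma dtransition_inverse:
  assumes x: "x \<in> overlap p q"
  shows "dir_deriv (transition q p) (transition p q x) (dir_deriv (transition p q) x v) = v"
proof -
  have "x \<in> overlap p p" "x \<in> chart_img M p" using x by (auto simp: overlap_iff param_dom)
  then show ?thesis using dtransition_compose[OF x] dtransition_id by simp
qed

lemma surj_dtransition:
  assumes x: "x \<in> overlap p q"
  shows "surj (dir_deriv (transition p q) x)"
proof (rule surjI)
  fix v
  have "transition q p (transition p q x) = x"
    using x by (simp add: transition_def overlap_iff param_chart chart_param)
  then show "dir_deriv (transition p q) x (dir_deriv (transition q p) (transition p q x) v) = v"
    using dtransition_inverse[OF transition_overlap[OF x], of v] by simp
qed

lemma coord_metric_eq:
  "coord_metric M p x v w = metric M (param M p x)
     (dir_deriv (transition p (param M p x)) x v) (dir_deriv (transition p (param M p x)) x w)"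
  by (simp add: coord_metric_def transition_def Let_def)

lemma coord_metric_pullback:
  assumes x: "x \<in> overlap p q"
  shows "coord_metric M p x v w = coord_metric M q (transition p q x)
    (dir_deriv (transition p q) x v) (dir_deriv (transition p q) x w)"
proof -
  have "x \<in> overlap p (param M p x)" using x overlap_subset in_overlap by blast
  then show ?thesis
    by (simp add: coord_metric_eq param_transition[OF x] dtransition_compose[OF x])
qed

text \<open>The hypothesis concerns each point in its own chart only. The chain rule with a
  transition map spreads it over a whole chart image, where a ball gives local constancy.\<close>

lemma locally_constant_chart:
  fixes u :: "'a \<Rightarrow> real"
  assumes u: "\<And>p. ((u \<circ> param M p) has_derivative (\<lambda>v. 0)) (at (chart_map M p p))"
    and conn: "connected (UNIV :: 'a set)"
  shows "u constant_on UNIV"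
proof (rule locally_constant_imp_constant[OF conn])
  fix p :: 'a
  have d0: "((u \<circ> param M p) has_derivative (\<lambda>v. 0)) (at x)" if x: "x \<in> chart_img M p" for x
  proof -
    let ?q = "param M p x"
    note o = in_overlap[OF x]
    have "transition p ?q x = chart_map M ?q ?q" by (simp add: transition_def)
    then have "((\<lambda>y. (u \<circ> param M ?q) (transition p ?q y)) has_derivative (\<lambda>v. 0)) (at x)"
      using has_derivative_compose[OF has_derivative_transition[OF o], of "u \<circ> param M ?q" "\<lambda>v. 0"] u[of ?q]
      by (simp only:)
    then show ?thesis
      by (rule has_derivative_transform_within_open[OF _ open_overlap o]) (simp add: param_transition)
  qed
  obtain r where r: "r > 0" "ball (chart_map M p p) r \<subseteq> chart_img M p"
    using openE[OF chart(3) chart_in_img[OF chart(1)]] by metis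
  let ?b = "ball (chart_map M p p) r"
  define T where "T = chart_dom M p \<inter> chart_map M p -` ?b"
  have "open T"
    unfolding T_def
    by (rule continuous_open_preimage[OF homeomorphism_cont1[OF chart(4)] chart(2) open_ball])
  moreover have "p \<in> T" using r chart(1) by (simp add: T_def)
  moreover have "\<forall>x\<in>T. u x = u p"
  proof
    fix x assume "x \<in> T"
    then have x: "x \<in> chart_dom M p" "chart_map M p x \<in> ?b" by (auto simp: T_def)
    have "(u \<circ> param M p) (chart_map M p x) = (u \<circ> param M p) (chart_map M p p)"
    proof (rule has_derivative_zero_unique_connected[where s = ?b])
      show "((u \<circ> param M p) has_derivative (\<lambda>v. 0)) (at y)" if "y \<in> ?b" for y
        by (rule d0) (use r that in blast)
    qed (use x r in simp_all)
    then show "u x = u p" using x chart(1) by (simp add: param_chart)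
  qed
  ultimately show "\<exists>T. openin (top_of_set UNIV) T \<and> p \<in> T \<and> (\<forall>x\<in>T. u x = u p)"
    unfolding subtopology_UNIV open_openin[symmetric] by blast
qed

lemma curve_in_chart:
  assumes S: "open S" "t \<in> S" "\<And>s. s \<in> S \<Longrightarrow> \<kappa> s \<in> chart_dom M p"
    and q: "\<kappa> t \<in> chart_dom M q"
    and c: "((chart_map M p \<circ> \<kappa>) has_vector_derivative c) (at t)"
  shows "((chart_map M q \<circ> \<kappa>) has_vector_derivative dir_deriv (transition p q) (chart_map M p (\<kappa> t)) c) (at t)"
proof -
  let ?x = "chart_map M p (\<kappa> t)"
  have x: "?x \<in> overlap p q" using q S by (simp add: overlap_def)
  have "((\<lambda>s. transition p q ((chart_map M p \<circ> \<kappa>) s)) has_vector_derivative dir_deriv (transition p q) ?x c) (at t)"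
    by (rule along_curve[OF _ c]) (simp add: has_derivative_transition[OF x])
  then show ?thesis
    by (rule has_vector_derivative_transform_within_open[OF _ S(1,2)]) (simp add: transition_def param_chart S(3))
qed

end

section \<open>Invariance of the geometric quantities under change of chart\<close>

locale riemannian = manifold +
  assumes riemannian_M: "riemannian_manifold M"
begin

lemma metric_simps:
  "bilinear (metric M p)" "metric M p v w = metric M p w v" "v \<noteq> 0 \<Longrightarrow> metric M p v v > 0"
  using riemannian_M by (auto simp: riemannian_manifold_def)

lemma metric_on_chart: "metric_on (chart_img M p) (coord_metric M p)"
proof
  show "open (chart_img M p)" by (rule chart)
  show "smooth_on (chart_img M p) (\<lambda>x. coord_metric M p x v w)" for v w
    using riemannian_M by (auto simp: riemannian_manifold_def)
  fix x assume x: "x \<in> chart_img M p"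
  let ?q = "param M p x"
  let ?D = "dir_deriv (transition p ?q) x"
  note o = in_overlap[OF x]
  show "bilinear (coord_metric M p x)"
    using linear_compose[OF linear_dtransition[OF o], unfolded o_def] metric_simps(1)[of ?q]
    by (auto simp: bilinear_def coord_metric_eq[abs_def])
  show "coord_metric M p x v w = coord_metric M p x w v" for v w
    unfolding coord_metric_eq by (rule metric_simps)
  fix v :: 'b assume "v \<noteq> 0"
  then have "?D v \<noteq> 0"
    using dtransition_inverse[OF o, of v] linear_dtransition[OF transition_overlap[OF o]] linear_0 by metis
  then show "coord_metric M p x v v > 0" unfolding coord_metric_eq by (rule metric_simps)
qed

lemma coordinate_change_chart:
  "coordinate_change (overlap p q) (coord_metric M p) (chart_img M q) (coord_metric M q) (transition p q)"
proof (intro coordinate_change.intro coordinate_change_axioms.intro metric_on_chart)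
  show "metric_on (overlap p q) (coord_metric M p)"
    by (rule metric_on_subset[OF metric_on_chart overlap_subset open_overlap])
  show "transition p q ` overlap p q \<subseteq> chart_img M q"
    using transition_overlap overlap_subset by blast
qed (rule smooth_transition surj_dtransition coord_metric_pullback; assumption)+

text \<open>\<open>scalar_curvature M q\<close> is defined in the chart of \<open>q\<close>. This
  lemma and its analogues for gradient and Hessian allow one fixed chart to serve all points of its
  domain.\<close>

lemma scalar_coord: 
  assumes x: "x \<in> chart_img M p"
  shows "scalar (coord_metric M p) x = scalar_curvature M (param M p x)"
  using coordinate_change.scalar_pullback[OF coordinate_change_chart in_overlap[OF x]]
  by (simp add: scalar_curvature_def transition_def)

lemma gradient_coord:
  assumes h: "smooth_fun M h" and x: "x \<in> chart_img M p"
  shows "dir_deriv (transition p (param M p x)) x (gradient (coord_metric M p) (h \<circ> param M p) x) = grad M h (param M p x)"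
proof -
  let ?q = "param M p x"
  note o = in_overlap[OF x]
  have eq: "(h \<circ> param M p) y = (h \<circ> param M ?q) (transition p ?q y)" if "y \<in> overlap p ?q" for y
    using that by (simp add: param_transition)
  have hs: "smooth_on (chart_img M r) (h \<circ> param M r)" for r using h by (simp add: smooth_fun_def)
  have "smooth_on (overlap p ?q) (\<lambda>y. (h \<circ> param M ?q) (transition p ?q y))"
    by (rule smooth_on_cong[OF smooth_on_subset[OF hs overlap_subset open_overlap] eq])
  note pb = coordinate_change.gradient_pullback[OF coordinate_change_chart hs this o]
  have "transition p ?q x = chart_map M ?q ?q" by (simp add: transition_def)
  with pb gradient_cong[OF open_overlap o eq] show ?thesis by (simp only: grad_def)
qed

lemma hessian_coord:
  assumes h: "smooth_fun M h" and x: "x \<in> chart_img M p"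
  shows "hessian (coord_metric M p) (h \<circ> param M p) x v w = Hess M h (param M p x)
     (dir_deriv (transition p (param M p x)) x v) (dir_deriv (transition p (param M p x)) x w)"
proof -
  let ?q = "param M p x"
  note o = in_overlap[OF x]
  have eq: "(h \<circ> param M p) y = (h \<circ> param M ?q) (transition p ?q y)" if "y \<in> overlap p ?q" for y
    using that by (simp add: param_transition)
  have hs: "smooth_on (chart_img M ?q) (h \<circ> param M ?q)" using h by (simp add: smooth_fun_def)
  note pb = coordinate_change.hessian_pullback[OF coordinate_change_chart hs o]
  have "transition p ?q x = chart_map M ?q ?q" by (simp add: transition_def)
  with pb hessian_cong[OF open_overlap o eq] show ?thesis by (simp only: Hess_def)
qed

text \<open>\<open>vector_derivative\<close> has some value even where no derivative exists.
  Smoothness of the curve turns the defining equation into a genuine system of first order around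
  \<open>t\<close>, with \<open>c\<close> as velocity.\<close>

lemma geodesic_in_chart:
  assumes "geodesic M \<gamma>"
  shows "\<exists>S c. open S \<and> t \<in> S \<and> (\<forall>s\<in>S. \<gamma> s \<in> chart_dom M (\<gamma> t) \<and>
      ((chart_map M (\<gamma> t) \<circ> \<gamma>) has_vector_derivative c s) (at s) \<and>
      (c has_vector_derivative - christoffel (coord_metric M (\<gamma> t)) (chart_map M (\<gamma> t) (\<gamma> s)) (c s) (c s)) (at s))"
proof -
  let ?c = "chart_map M (\<gamma> t) \<circ> \<gamma>" and ?S = "\<gamma> -` chart_dom M (\<gamma> t)"
  let ?c' = "\<lambda>s. vector_derivative ?c (at s)"
  have sm: "smooth_on ?S ?c"
    and eq: "vector_derivative ?c' (at s) + christoffel (coord_metric M (\<gamma> t)) (?c s) (?c' s) (?c' s) = 0" if "s \<in> ?S" for s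
    using assms that unfolding geodesic_def Let_def by auto
  have t: "t \<in> ?S" using chart(1) by simp
  note sm = sm[OF t]
  have c': "(?c has_vector_derivative ?c' s) (at s)" if "s \<in> ?S" for s
    using smooth_on_differentiable[OF sm that] vector_derivative_works by blast
  have dd: "dir_deriv ?c s 1 = ?c' s" if "s \<in> ?S" for s
    using dir_deriv_eq[OF c'[OF that, unfolded has_vector_derivative_def], of 1] by simp
  have "smooth_on ?S ?c'"
    by (rule smooth_on_cong[OF smooth_on_dir_deriv[OF sm] dd])
  then have c'': "(?c' has_vector_derivative vector_derivative ?c' (at s)) (at s)" if "s \<in> ?S" for s
    using smooth_on_differentiable[of ?S ?c' s] that vector_derivative_works by blast
  show ?thesis
  proof (intro exI[of _ ?S] exI[of _ ?c'] conjI ballI)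
    show "open ?S" by (rule smooth_on_open[OF sm])
    fix s assume s: "s \<in> ?S"
    show "(?c' has_vector_derivative - christoffel (coord_metric M (\<gamma> t)) (chart_map M (\<gamma> t) (\<gamma> s)) (?c' s) (?c' s)) (at s)"
      using c''[OF s] eq[OF s] by (simp add: eq_neg_iff_add_eq_0[symmetric])
  qed (use t c' in auto)
qed

lemma velocity_in_chart:
  assumes "geodesic M \<gamma>"
  shows "((chart_map M (\<gamma> t) \<circ> \<gamma>) has_vector_derivative
    vector_derivative (chart_map M (\<gamma> t) \<circ> \<gamma>) (at t)) (at t)"
  using geodesic_in_chart[OF assms, of t] vector_derivative_at by metis

end

section \<open>Solitons on manifolds\<close>

locale soliton = riemannian +
  fixes h :: "'a \<Rightarrow> real" and \<rho> :: real
  assumes soliton_M: "yamabe_gradient_soliton M h \<rho>"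
begin

definition \<phi> :: "'a \<Rightarrow> real" where "\<phi> p = scalar_curvature M p - \<rho>"

lemma smooth_h: "smooth_fun M h" using soliton_M by (simp add: yamabe_gradient_soliton_def)

lemma coordinate_soliton_chart:
  "coordinate_soliton (chart_img M p) (coord_metric M p) (h \<circ> param M p) (\<phi> \<circ> param M p) \<rho>"
proof -
  interpret metric_on "chart_img M p" "coord_metric M p" by (rule metric_on_chart)
  show ?thesis
  proof
    show "smooth_on (chart_img M p) (h \<circ> param M p)" using smooth_h by (simp add: smooth_fun_def)
    have "smooth_on (chart_img M p) (\<lambda>x. scalar (coord_metric M p) x - \<rho>)"
      by (intro smooth_on_diff smooth_scalar smooth_on_const open_U)
    then show "smooth_on (chart_img M p) (\<phi> \<circ> param M p)"
      by (rule smooth_on_cong) (simp add: scalar_coord \<phi>_def)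
    show "hessian (coord_metric M p) (h \<circ> param M p) x v w = (\<phi> \<circ> param M p) x * coord_metric M p x v w"
      if "x \<in> chart_img M p" for x v w
      using soliton_M
      by (simp add: hessian_coord[OF smooth_h that] coord_metric_eq yamabe_gradient_soliton_def \<phi>_def)
    show "scalar (coord_metric M p) x = (\<phi> \<circ> param M p) x + \<rho>" if "x \<in> chart_img M p" for x
      using that by (simp add: scalar_coord \<phi>_def)
  qed
qed

definition velocity :: "(real \<Rightarrow> 'a) \<Rightarrow> real \<Rightarrow> 'b"
  where "velocity \<kappa> t = vector_derivative (chart_map M (\<kappa> t) \<circ> \<kappa>) (at t)"

text \<open>The function \<open>f\<close> stands for the warping function along the curve, but only
  positivity and the relation \<open>r f' = \<phi> f\<close> enter. The geodesic equation is
  required near each \<open>t\<close> in the chart of \<open>\<kappa> t\<close> alone, which is the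
  form in which it is checked for a lifted curve.\<close>

theorem lower_bound_along_geodesic:
  fixes \<kappa> :: "real \<Rightarrow> 'a" and f :: "real \<Rightarrow> real"
  assumes dim: "DIM('b) \<ge> 2"
    and geod: "\<And>t. \<exists>S c. open S \<and> t \<in> S \<and> (\<forall>s\<in>S. \<kappa> s \<in> chart_dom M (\<kappa> t) \<and>
      ((chart_map M (\<kappa> t) \<circ> \<kappa>) has_vector_derivative c s) (at s) \<and>
      (c has_vector_derivative - christoffel (coord_metric M (\<kappa> t)) (chart_map M (\<kappa> t) (\<kappa> s)) (c s) (c s)) (at s))"
    and unit: "metric M (\<kappa> 0) (velocity \<kappa> 0) (velocity \<kappa> 0) = 1"
    and init: "grad M h (\<kappa> 0) = a *\<^sub>R velocity \<kappa> 0" "a > 0"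
    and fpos: "\<And>t. f t > 0"
    and f: "\<And>t r. grad M h (\<kappa> t) = r *\<^sub>R velocity \<kappa> t \<Longrightarrow>
       \<exists>f'. (f has_real_derivative f') (at t) \<and> r * f' = \<phi> (\<kappa> t) * f t"
  shows "\<phi> (\<kappa> t) \<ge> min 0 (- \<rho>)"
proof -
  \<comment> \<open>\<open>u\<close> is the component of the gradient along the velocity and
    \<open>W\<close> the remainder. For unit speed, both the gradient and \<open>u\<close> times the
    velocity have covariant derivative \<open>\<phi>\<close> times the velocity, so \<open>W\<close>
    is parallel, and it vanishes at time 0.\<close>
  define u where "u t = metric M (\<kappa> t) (grad M h (\<kappa> t)) (velocity \<kappa> t)" for t
  define W where "W t = grad M h (\<kappa> t) - u t *\<^sub>R velocity \<kappa> t" for t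
  \<comment> \<open>An elimination rule that describes all quantities at times near \<open>t\<close>
    in the single chart of \<open>\<kappa> t\<close>; four computations below start from it.\<close>
  have local: thesis
    if local: "\<And>S c. open S \<Longrightarrow> t \<in> S \<Longrightarrow>
      (\<And>s. s \<in> S \<Longrightarrow> chart_map M (\<kappa> t) (\<kappa> s) \<in> chart_img M (\<kappa> t)) \<Longrightarrow>
      (\<And>s. s \<in> S \<Longrightarrow> param M (\<kappa> t) (chart_map M (\<kappa> t) (\<kappa> s)) = \<kappa> s) \<Longrightarrow>
      (\<And>s. s \<in> S \<Longrightarrow> ((\<lambda>s. chart_map M (\<kappa> t) (\<kappa> s)) has_vector_derivative c s) (at s)) \<Longrightarrow>
      (\<And>s. s \<in> S \<Longrightarrow> (c has_vector_derivative
          - christoffel (coord_metric M (\<kappa> t)) (chart_map M (\<kappa> t) (\<kappa> s)) (c s) (c s)) (at s)) \<Longrightarrow>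
      (\<And>s. s \<in> S \<Longrightarrow> metric M (\<kappa> s) (velocity \<kappa> s) (velocity \<kappa> s)
          = coord_metric M (\<kappa> t) (chart_map M (\<kappa> t) (\<kappa> s)) (c s) (c s)) \<Longrightarrow>
      (\<And>s. s \<in> S \<Longrightarrow> u s = coord_metric M (\<kappa> t) (chart_map M (\<kappa> t) (\<kappa> s))
          (gradient (coord_metric M (\<kappa> t)) (h \<circ> param M (\<kappa> t)) (chart_map M (\<kappa> t) (\<kappa> s))) (c s)) \<Longrightarrow>
      (\<And>s. s \<in> S \<Longrightarrow> metric M (\<kappa> s) (W s) (W s) = coord_metric M (\<kappa> t) (chart_map M (\<kappa> t) (\<kappa> s))
          (gradient (coord_metric M (\<kappa> t)) (h \<circ> param M (\<kappa> t)) (chart_map M (\<kappa> t) (\<kappa> s)) - u s *\<^sub>R c s)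
          (gradient (coord_metric M (\<kappa> t)) (h \<circ> param M (\<kappa> t)) (chart_map M (\<kappa> t) (\<kappa> s)) - u s *\<^sub>R c s)) \<Longrightarrow> thesis"
    for t thesis
  proof -
    let ?p = "\<kappa> t"
    obtain S c where S: "open S" "t \<in> S" and Sc: "\<And>s. s \<in> S \<Longrightarrow> \<kappa> s \<in> chart_dom M ?p"
      "\<And>s. s \<in> S \<Longrightarrow> ((chart_map M ?p \<circ> \<kappa>) has_vector_derivative c s) (at s)"
      "\<And>s. s \<in> S \<Longrightarrow> (c has_vector_derivative - christoffel (coord_metric M ?p) (chart_map M ?p (\<kappa> s)) (c s) (c s)) (at s)"
      using geod[of t] by blast
    show ?thesis
    proof (rule local[OF S])
      fix s assume s: "s \<in> S"
      let ?x = "chart_map M ?p (\<kappa> s)" and ?G = "coord_metric M ?p"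
      let ?X = "gradient ?G (h \<circ> param M ?p) ?x" and ?D = "dir_deriv (transition ?p (\<kappa> s)) ?x"
      show x: "?x \<in> chart_img M ?p" and px: "param M ?p ?x = \<kappa> s"
        using Sc(1)[OF s] by (auto simp: chart_in_img param_chart)
      show "((\<lambda>s. chart_map M ?p (\<kappa> s)) has_vector_derivative c s) (at s)"
        using Sc(2)[OF s] by (simp add: o_def)
      show "(c has_vector_derivative - christoffel ?G ?x (c s) (c s)) (at s)" by (rule Sc(3)[OF s])
      have vel: "velocity \<kappa> s = ?D (c s)"
        unfolding velocity_def
        by (rule vector_derivative_at[OF curve_in_chart[OF S(1) s Sc(1) chart(1) Sc(2)[OF s]]])
      have gr: "grad M h (\<kappa> s) = ?D ?X"
        using gradient_coord[OF smooth_h x] px by simp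
      have G: "?G ?x v w = metric M (\<kappa> s) (?D v) (?D w)" for v w
        using coord_metric_eq[of ?p ?x] px by simp
      have lin: "linear ?D" using linear_dtransition[OF in_overlap[OF x]] px by simp
      show "metric M (\<kappa> s) (velocity \<kappa> s) (velocity \<kappa> s) = ?G ?x (c s) (c s)"
        "u s = ?G ?x ?X (c s)"
        by (simp_all add: u_def vel gr G)
      show "metric M (\<kappa> s) (W s) (W s) = ?G ?x (?X - u s *\<^sub>R c s) (?X - u s *\<^sub>R c s)"
        by (simp add: W_def vel gr G linear_diff[OF lin] linear_cmul[OF lin])
    qed
  qed
  have E: "metric M (\<kappa> t) (velocity \<kappa> t) (velocity \<kappa> t) = 1" for t
  proof -
    have d: "((\<lambda>t. metric M (\<kappa> t) (velocity \<kappa> t) (velocity \<kappa> t)) has_real_derivative 0) (at t)" for t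
    proof -
      interpret coordinate_soliton "chart_img M (\<kappa> t)" "coord_metric M (\<kappa> t)" "h \<circ> param M (\<kappa> t)" "\<phi> \<circ> param M (\<kappa> t)" \<rho>
        by (rule coordinate_soliton_chart)
    let ?C = "\<lambda>s. chart_map M (\<kappa> t) (\<kappa> s)"
    obtain S c where S: "open S" "t \<in> S" and c: "\<And>s. s \<in> S \<Longrightarrow> ?C s \<in> chart_img M (\<kappa> t)"
      "\<And>s. s \<in> S \<Longrightarrow> param M (\<kappa> t) (?C s) = \<kappa> s"
      "\<And>s. s \<in> S \<Longrightarrow> (?C has_vector_derivative c s) (at s)"
      "\<And>s. s \<in> S \<Longrightarrow> (c has_vector_derivative - \<Gamma> (?C s) (c s) (c s)) (at s)"
      "\<And>s. s \<in> S \<Longrightarrow> metric M (\<kappa> s) (velocity \<kappa> s) (velocity \<kappa> s) = coord_metric M (\<kappa> t) (?C s) (c s) (c s)"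
      "\<And>s. s \<in> S \<Longrightarrow> u s = coord_metric M (\<kappa> t) (?C s) (X (?C s)) (c s)"
      "\<And>s. s \<in> S \<Longrightarrow> metric M (\<kappa> s) (W s) (W s) = coord_metric M (\<kappa> t) (?C s) (X (?C s) - u s *\<^sub>R c s) (X (?C s) - u s *\<^sub>R c s)"
      by (fact local)
      show ?thesis
        by (rule has_field_derivative_transform_within_open[OF norm2_parallel[OF c(1,3,4)[OF S(2)]] S]) (simp add: c(5))
    qed
    show ?thesis using DERIV_isconst_all[OF allI[OF d], of t 0] unit by simp
  qed
  have u': "(u has_real_derivative \<phi> (\<kappa> t)) (at t)" for t
  proof -
    interpret coordinate_soliton "chart_img M (\<kappa> t)" "coord_metric M (\<kappa> t)" "h \<circ> param M (\<kappa> t)" "\<phi> \<circ> param M (\<kappa> t)" \<rho>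
      by (rule coordinate_soliton_chart)
    let ?C = "\<lambda>s. chart_map M (\<kappa> t) (\<kappa> s)"
    obtain S c where S: "open S" "t \<in> S" and c: "\<And>s. s \<in> S \<Longrightarrow> ?C s \<in> chart_img M (\<kappa> t)"
      "\<And>s. s \<in> S \<Longrightarrow> param M (\<kappa> t) (?C s) = \<kappa> s"
      "\<And>s. s \<in> S \<Longrightarrow> (?C has_vector_derivative c s) (at s)"
      "\<And>s. s \<in> S \<Longrightarrow> (c has_vector_derivative - \<Gamma> (?C s) (c s) (c s)) (at s)"
      "\<And>s. s \<in> S \<Longrightarrow> metric M (\<kappa> s) (velocity \<kappa> s) (velocity \<kappa> s) = coord_metric M (\<kappa> t) (?C s) (c s) (c s)"
      "\<And>s. s \<in> S \<Longrightarrow> u s = coord_metric M (\<kappa> t) (?C s) (X (?C s)) (c s)"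
      "\<And>s. s \<in> S \<Longrightarrow> metric M (\<kappa> s) (W s) (W s) = coord_metric M (\<kappa> t) (?C s) (X (?C s) - u s *\<^sub>R c s) (X (?C s) - u s *\<^sub>R c s)"
      by (fact local)
    have "((\<lambda>s. coord_metric M (\<kappa> t) (?C s) (X (?C s)) (c s)) has_real_derivative \<phi> (\<kappa> t)) (at t)"
      using dH_parallel[OF c(1,3,4)[OF S(2)]] c(5)[OF S(2)] E[of t] c(2)[OF S(2)] by simp
    then show ?thesis
      by (rule has_field_derivative_transform_within_open[OF _ S]) (simp add: c(6))
  qed
  have W: "W t = 0" for t
  proof -
    have d: "((\<lambda>t. metric M (\<kappa> t) (W t) (W t)) has_real_derivative 0) (at t)" for t
    proof -
      interpret coordinate_soliton "chart_img M (\<kappa> t)" "coord_metric M (\<kappa> t)" "h \<circ> param M (\<kappa> t)" "\<phi> \<circ> param M (\<kappa> t)" \<rho>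
        by (rule coordinate_soliton_chart)
    let ?C = "\<lambda>s. chart_map M (\<kappa> t) (\<kappa> s)"
    obtain S c where S: "open S" "t \<in> S" and c: "\<And>s. s \<in> S \<Longrightarrow> ?C s \<in> chart_img M (\<kappa> t)"
      "\<And>s. s \<in> S \<Longrightarrow> param M (\<kappa> t) (?C s) = \<kappa> s"
      "\<And>s. s \<in> S \<Longrightarrow> (?C has_vector_derivative c s) (at s)"
      "\<And>s. s \<in> S \<Longrightarrow> (c has_vector_derivative - \<Gamma> (?C s) (c s) (c s)) (at s)"
      "\<And>s. s \<in> S \<Longrightarrow> metric M (\<kappa> s) (velocity \<kappa> s) (velocity \<kappa> s) = coord_metric M (\<kappa> t) (?C s) (c s) (c s)"
      "\<And>s. s \<in> S \<Longrightarrow> u s = coord_metric M (\<kappa> t) (?C s) (X (?C s)) (c s)"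
      "\<And>s. s \<in> S \<Longrightarrow> metric M (\<kappa> s) (W s) (W s) = coord_metric M (\<kappa> t) (?C s) (X (?C s) - u s *\<^sub>R c s) (X (?C s) - u s *\<^sub>R c s)"
      by (fact local)
      note x = c(1)[OF S(2)]
      have "((\<lambda>s. X (?C s) - u s *\<^sub>R c s) has_vector_derivative
          (\<phi> (\<kappa> t) *\<^sub>R c t - \<Gamma> (?C t) (c t) (X (?C t))) - (u t *\<^sub>R (- \<Gamma> (?C t) (c t) (c t)) + \<phi> (\<kappa> t) *\<^sub>R c t)) (at t)"
        using has_vector_derivative_diff[OF along_curve[OF has_derivative_X[OF x] c(3)[OF S(2)]]
           has_vector_derivative_scaleR[OF u' c(4)[OF S(2)]]] c(2)[OF S(2)] by simp
      then have "((\<lambda>s. X (?C s) - u s *\<^sub>R c s) has_vector_derivative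
          - \<Gamma> (?C t) (c t) (X (?C t) - u t *\<^sub>R c t)) (at t)"
        by (simp add: christoffel_diff[OF x] christoffel_simps[OF x])
      from norm2_parallel[OF x c(3)[OF S(2)] this] show ?thesis
        by (rule has_field_derivative_transform_within_open[OF _ S]) (simp add: c(7))
    qed
    have "u 0 = a" using init unit metric_simps(1)[of "\<kappa> 0"] by (simp add: u_def bilinear_def linear_cmul[of "\<lambda>v. metric M (\<kappa> 0) v _"])
    then have "W 0 = 0" using init by (simp add: W_def)
    then have "metric M (\<kappa> 0) (W 0) (W 0) = 0"
      using metric_simps(1)[of "\<kappa> 0"] by (simp add: bilinear_def linear_0)
    then have "metric M (\<kappa> t) (W t) (W t) = 0" using DERIV_isconst_all[OF allI[OF d], of t 0] by simp
    then show ?thesis using metric_simps(3)[of "W t" "\<kappa> t"] by (metis less_irrefl)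
  qed
  have upos: "u t > 0" for t
  proof -
    \<comment> \<open>\<open>u\<close> and \<open>f\<close> both solve the linear equation
      \<open>u y' = \<phi> y\<close>. Their quotient is constant, so positivity of \<open>f\<close>
      at all times passes to \<open>u\<close>.\<close>
    have d: "((\<lambda>t. u t / f t) has_real_derivative 0) (at t)" for t
    proof -
      have "grad M h (\<kappa> t) = u t *\<^sub>R velocity \<kappa> t" using W[of t] by (simp add: W_def)
      from f[OF this] obtain f' where f': "(f has_real_derivative f') (at t)" "u t * f' = \<phi> (\<kappa> t) * f t" by auto
      have "((\<lambda>t. u t / f t) has_real_derivative (\<phi> (\<kappa> t) * f t - u t * f') / (f t * f t)) (at t)"
        using fpos[of t] by (intro DERIV_divide u' f') simp
      then show ?thesis by (simp add: f')
    qed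
    have "u t / f t = u 0 / f 0" using DERIV_isconst_all[OF allI[OF d], of t 0] by simp
    moreover have "u 0 = a" using init unit metric_simps(1)[of "\<kappa> 0"] by (simp add: u_def bilinear_def linear_cmul[of "\<lambda>v. metric M (\<kappa> 0) v _"])
    ultimately have "u t / f t > 0" using init fpos[of 0] by simp
    then show ?thesis using fpos[of t] by (simp add: zero_less_divide_iff)
  qed
  \<comment> \<open>\<open>\<mu>\<close> is defined chart by chart; solving
    \<open>\<phi>' = \<mu> u\<close> for it gives one function on the whole line.\<close>
  define m where "m t = deriv (\<lambda>t. \<phi> (\<kappa> t)) t / u t" for t
  have ode: "((\<lambda>t. \<phi> (\<kappa> t)) has_real_derivative m t * u t) (at t) \<and>
     (\<exists>m'. (m has_real_derivative m') (at t) \<and> m t * (u t)\<^sup>2 = - 2 * \<phi> (\<kappa> t) * (\<phi> (\<kappa> t) + \<rho>)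
        - 2 * (real DIM('b) - 1) * (u t * m' + ((real DIM('b) - 1) + 1) * m t * \<phi> (\<kappa> t)))" for t
  proof -
    interpret coordinate_soliton "chart_img M (\<kappa> t)" "coord_metric M (\<kappa> t)" "h \<circ> param M (\<kappa> t)" "\<phi> \<circ> param M (\<kappa> t)" \<rho>
      by (rule coordinate_soliton_chart)
    let ?C = "\<lambda>s. chart_map M (\<kappa> t) (\<kappa> s)"
    obtain S c where S: "open S" "t \<in> S" and c: "\<And>s. s \<in> S \<Longrightarrow> ?C s \<in> chart_img M (\<kappa> t)"
      "\<And>s. s \<in> S \<Longrightarrow> param M (\<kappa> t) (?C s) = \<kappa> s"
      "\<And>s. s \<in> S \<Longrightarrow> (?C has_vector_derivative c s) (at s)"
      "\<And>s. s \<in> S \<Longrightarrow> (c has_vector_derivative - \<Gamma> (?C s) (c s) (c s)) (at s)"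
      "\<And>s. s \<in> S \<Longrightarrow> metric M (\<kappa> s) (velocity \<kappa> s) (velocity \<kappa> s) = coord_metric M (\<kappa> t) (?C s) (c s) (c s)"
      "\<And>s. s \<in> S \<Longrightarrow> u s = coord_metric M (\<kappa> t) (?C s) (X (?C s)) (c s)"
      "\<And>s. s \<in> S \<Longrightarrow> metric M (\<kappa> s) (W s) (W s) = coord_metric M (\<kappa> t) (?C s) (X (?C s) - u s *\<^sub>R c s) (X (?C s) - u s *\<^sub>R c s)"
      by (fact local)
    have Xc: "X (?C s) = u s *\<^sub>R c s" if "s \<in> S" for s
    proof (rule ccontr)
      assume "X (?C s) \<noteq> u s *\<^sub>R c s"
      then have "metric M (\<kappa> s) (W s) (W s) > 0" using pos_G[OF c(1)[OF that]] c(7)[OF that] by simp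
      then show False using W[of s] metric_simps(1)[of "\<kappa> s"] by (simp add: bilinear_def linear_0)
    qed
    have G1: "coord_metric M (\<kappa> t) (?C s) (c s) (c s) = 1" if "s \<in> S" for s using c(5)[OF that] E by simp
    have u0: "u s \<noteq> 0" for s using upos[of s] by simp
    have 1: "((\<lambda>s. \<phi> (\<kappa> s)) has_real_derivative \<mu> (?C s) * u s) (at s)" if "s \<in> S" for s
      by (rule has_field_derivative_transform_within_open[OF soliton_ode(1)[OF c(1,3)[OF that] Xc[OF that] G1[OF that] u0] S(1) that])
        (simp add: c(2))
    have m: "m s = \<mu> (?C s)" if "s \<in> S" for s
      unfolding m_def using DERIV_imp_deriv[OF 1[OF that]] u0[of s] by simp
    obtain m' where m': "((\<lambda>s. \<mu> (?C s)) has_real_derivative m') (at t)"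
      "\<mu> (?C t) * (u t)\<^sup>2 = - 2 * (\<phi> \<circ> param M (\<kappa> t)) (?C t) * ((\<phi> \<circ> param M (\<kappa> t)) (?C t) + \<rho>)
        - 2 * (real DIM('b) - 1) * (u t * m' + real DIM('b) * \<mu> (?C t) * (\<phi> \<circ> param M (\<kappa> t)) (?C t))"
      using soliton_ode(2)[OF c(1,3)[OF S(2)] Xc[OF S(2)] G1[OF S(2)] u0] by blast
    have "(m has_real_derivative m') (at t)"
      by (rule has_field_derivative_transform_within_open[OF m'(1) S]) (simp add: m)
    then show ?thesis using 1[OF S(2)] m'(2) m[OF S(2)] c(2)[OF S(2)] by auto
  qed
  show ?thesis
    by (rule soliton_ode_lower_bound[where u = u and \<mu> = m and \<phi> = "\<lambda>t. \<phi> (\<kappa> t)" and p = "real DIM('b) - 1"])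
      (use dim upos u' ode in auto)
qed

end

section \<open>Warped products in coordinates\<close>

locale warped_coordinates =
  B: metric_on UB GB + F: metric_on UF GF +
  coordinate_soliton "UB \<times> UF" G H \<phi> \<rho>
  for UB :: "'e::euclidean_space set" and GB and UF :: "'d::euclidean_space set" and GF
    and G and H \<phi> :: "'e \<times> 'd \<Rightarrow> real" and \<rho> +
  fixes f :: "'e \<Rightarrow> real"
  assumes smooth_f: "smooth_on UB f" and f_pos: "x \<in> UB \<Longrightarrow> f x > 0"
    and G_eq: "x \<in> UB \<Longrightarrow> y \<in> UF \<Longrightarrow>
      G (x, y) (v, v') (w, w') = GB x v w + (f x)\<^sup>2 * GF y v' w'"
begin

abbreviation df :: "'e \<Rightarrow> 'e \<Rightarrow> real" where "df \<equiv> dir_deriv f"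

lemma has_derivative_f: "x \<in> UB \<Longrightarrow> (f has_derivative df x) (at x)"
  by (rule smooth_on_has_derivative[OF smooth_f])

lemma linear_df: "x \<in> UB \<Longrightarrow> linear (df x)"
  by (rule linear_dir_deriv[OF smooth_on_differentiable[OF smooth_f]])

lemma mem_U: "x \<in> UB \<Longrightarrow> y \<in> UF \<Longrightarrow> (x, y) \<in> UB \<times> UF" by simp

lemma has_derivative_fst_compose:
  "(k has_derivative k') (at x) \<Longrightarrow> ((\<lambda>z. k (fst z)) has_derivative (\<lambda>h. k' (fst h))) (at (x, y))"
  by (rule has_derivative_compose[OF has_derivative_fst[OF has_derivative_ident]]) simp

lemma has_derivative_snd_compose:
  "(k has_derivative k') (at y) \<Longrightarrow> ((\<lambda>z. k (snd z)) has_derivative (\<lambda>h. k' (snd h))) (at (x, y))"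
  by (rule has_derivative_compose[OF has_derivative_snd[OF has_derivative_ident]]) simp

lemma dG_warped:
  assumes x: "x \<in> UB" and y: "y \<in> UF"
  shows "dG (x, y) (u, u') (v, v') (w, w')
    = B.dG x u v w + 2 * f x * df x u * GF y v' w' + (f x)\<^sup>2 * F.dG y u' v' w'"
proof -
  have "dG (x, y) (u, u') (v, v') (w, w')
      = dir_deriv (\<lambda>z. GB (fst z) v w + (f (fst z))\<^sup>2 * GF (snd z) v' w') (x, y) (u, u')"
    by (rule dir_deriv_apply_cong[OF open_U mem_U[OF x y]]) (auto simp: G_eq)
  also have "\<dots> = B.dG x u v w + ((f x)\<^sup>2 * F.dG y u' v' w' + (of_nat 2 * df x u * f x ^ (2 - 1)) * GF y v' w')"
    using dir_deriv_eq[OF has_derivative_add[OF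
        has_derivative_fst_compose[OF has_dir_deriv[OF B.G_differentiable[OF x]]]
        has_derivative_mult[OF has_derivative_power[OF has_derivative_fst_compose[OF has_derivative_f[OF x]], of 2]
          has_derivative_snd_compose[OF has_dir_deriv[OF F.G_differentiable[OF y]]]]],
        of v w v' w' "(u, u')"] by simp
  finally show ?thesis by (simp add: algebra_simps)
qed

lemma zero_simps:
  assumes "x \<in> UB" "y \<in> UF"
  shows "B.dG x u 0 w = 0" "B.dG x u v 0 = 0" "B.dG x 0 v w = 0"
    "F.dG y u' 0 w' = 0" "F.dG y u' v' 0 = 0" "F.dG y 0 v' w' = 0" "df x 0 = 0"
  using B.linear_dG[OF assms(1), THEN linear_0] F.linear_dG[OF assms(2), THEN linear_0]
    linear_df[OF assms(1), THEN linear_0] by auto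

text \<open>The components behind the horizontal, mixed and vertical parts of the Hessian. The last
  one is stated for horizontal \<open>z\<close> because \<open>X\<close> is already horizontal where
  it is used.\<close>

lemma koszul_warped:
  assumes "x \<in> UB" "y \<in> UF"
  shows "koszul (x, y) (v, 0) (w, 0) (z, z') = B.koszul x v w z"
    "koszul (x, y) (v, 0) (0, w') (z, z') = f x * df x v * GF y w' z'"
    "koszul (x, y) (0, w') (0, w') (z, 0) = - (f x * df x z * GF y w' w')"
  using assms by (simp_all add: koszul_def B.koszul_def dG_warped zero_simps F.G_simps)

text \<open>Horizontal slices are totally geodesic. This lifts geodesics of the base to geodesics of
  the product.\<close>

lemma christoffel_horizontal:
  assumes "x \<in> UB" "y \<in> UF"
  shows "\<Gamma> (x, y) (v, 0) (w, 0) = (B.\<Gamma> x v w, 0)"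
proof (rule christoffel_eq[OF mem_U[OF assms]])
  fix z :: "'e \<times> 'd"
  show "G (x, y) (B.\<Gamma> x v w, 0) z = koszul (x, y) (v, 0) (w, 0) z"
    by (cases z) (simp add: koszul_warped assms G_eq F.G_simps B.G_christoffel)
qed

lemma dH_christoffel: "z \<in> UB \<times> UF \<Longrightarrow> dir_deriv H z (\<Gamma> z v w) = koszul z v w (X z)"
  using G_X[of z "\<Gamma> z v w"] G_christoffel[of z v w "X z"] sym_G[of z] by simp

lemma dH_vertical:
  assumes "x \<in> UB" "y \<in> UF"
  shows "dir_deriv H (x, y) (0, w') = (f x)\<^sup>2 * GF y (snd (X (x, y))) w'"
  using G_X[OF mem_U[OF assms], of "(0, w')"] G_eq[OF assms, of "fst (X (x, y))" "snd (X (x, y))" 0 w']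
  by (simp add: B.G_simps assms)

text \<open>The metric has no mixed part, so the mixed Hessian of \<open>H\<close> vanishes and the
  second derivative equals its Christoffel term.\<close>

lemma mixed_hessian:
  assumes x: "x \<in> UB" and y: "y \<in> UF"
  shows "dir_deriv (\<lambda>z. dir_deriv H z (0, w')) (x, y) (v, 0) = df x v / f x * dir_deriv H (x, y) (0, w')"
proof -
  obtain XB XF where X: "X (x, y) = (XB, XF)" by (cases "X (x, y)")
  have "dir_deriv (\<lambda>z. dir_deriv H z (0, w')) (x, y) (v, 0) = koszul (x, y) (v, 0) (0, w') (X (x, y))"
    using hessian_H[OF mem_U[OF x y], of "(v, 0)" "(0, w')"]
    by (simp add: hessian_def dH_christoffel x y G_eq B.G_simps F.G_simps)
  then show ?thesis
    using f_pos[OF x] F.sym_G[OF y]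
    by (simp add: X koszul_warped x y dH_vertical power2_eq_square)
qed

text \<open>Without vertical derivatives of \<open>H\<close>, the vertical Hessian consists of its
  Christoffel term \<open>f df(X) GF\<close>. It must equal \<open>\<phi> f^2 GF\<close>, and any
  nonzero vertical vector allows the division.\<close>

lemma df_X:
  assumes x: "x \<in> UB" and y: "y \<in> UF"
    and H: "\<And>z w'. z \<in> UB \<times> UF \<Longrightarrow> dir_deriv H z (0, w') = 0"
  shows "snd (X (x, y)) = 0" "df x (fst (X (x, y))) = \<phi> (x, y) * f x"
proof -
  show XF: "snd (X (x, y)) = 0"
    using H[OF mem_U[OF x y]] f_pos[OF x]
    by (intro F.nondegenerate[OF y]) (simp add: dH_vertical x y F.G_simps)
  then obtain XB where X: "X (x, y) = (XB, 0)" by (cases "X (x, y)") simp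
  obtain w' :: 'd where w': "w' \<in> Basis" using nonempty_Basis by blast
  then have pos: "GF y w' w' > 0" by (intro F.pos_G[OF y] nonzero_Basis)
  have "dir_deriv (\<lambda>z. dir_deriv H z (0, w')) (x, y) (0, w') = dir_deriv (\<lambda>z. 0) (x, y) (0, w')"
    by (rule dir_deriv_apply_cong[OF open_U mem_U[OF x y] H])
  also have "\<dots> = 0" by (rule dir_deriv_eq) simp
  finally have "- koszul (x, y) (0, w') (0, w') (XB, 0) = \<phi> (x, y) * ((f x)\<^sup>2 * GF y w' w')"
    using hessian_H[OF mem_U[OF x y], of "(0, w')" "(0, w')"]
    by (simp add: hessian_def dH_christoffel x y G_eq B.G_simps X)
  then have "f x * GF y w' w' * df x XB = f x * GF y w' w' * (\<phi> (x, y) * f x)"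
    by (simp add: koszul_warped x y power2_eq_square algebra_simps)
  then show "df x (fst (X (x, y))) = \<phi> (x, y) * f x"
    using pos f_pos[OF x] by (simp add: X)
qed

text \<open>\<open>mixed_hessian\<close> is the linear equation
  \<open>d\<tau> = (df / f) \<tau>\<close> for the vertical derivative \<open>\<tau>\<close> on a
  horizontal slice; its solutions are locally constant multiples of \<open>f\<close>.\<close>

lemma vertical_derivative_proportional_f:
  assumes x: "x \<in> UB" and y: "y \<in> UF"
  shows "((\<lambda>a. dir_deriv H (a, y) (0, w') / f a) has_derivative (\<lambda>v. 0)) (at x)"
proof -
  have "((\<lambda>z. dir_deriv H z (0, w')) has_derivative dir_deriv (\<lambda>z. dir_deriv H z (0, w')) (x, y)) (at (x, y))"
    by (rule smooth_on_has_derivative[OF smooth_on_dir_deriv[OF smooth_H] mem_U[OF x y]])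
  from has_derivative_compose[OF has_derivative_Pair[OF has_derivative_ident has_derivative_const] this]
  have "((\<lambda>a. dir_deriv H (a, y) (0, w')) has_derivative (\<lambda>v. df x v / f x * dir_deriv H (x, y) (0, w'))) (at x)"
    by (simp add: mixed_hessian x y)
  from has_derivative_divide'[OF this has_derivative_f[OF x]] f_pos[OF x] show ?thesis by simp
qed

text \<open>Differentiating the horizontal part of \<open>Hess H = \<phi> G\<close> in a vertical direction: by the mixed part,
  a vertical derivative of \<open>H\<close> is a multiple of \<open>f\<close> on every horizontal slice.\<close>

lemma hessian_f_vertical:
  assumes x: "x \<in> UB" and y: "y \<in> UF"
  shows "dir_deriv H (x, y) (0, w') * hessian GB f x v v = f x * d\<phi> (x, y) (0, w') * GB x v v"
proof -
  let ?z = "(x, y)"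
  note z = mem_U[OF x y]
  define \<tau> where "\<tau> z = dir_deriv H z (0, w')" for z
  have d\<tau>: "dir_deriv \<tau> z (u, 0) = df (fst z) u / f (fst z) * \<tau> z" if "z \<in> UB \<times> UF" for z u
    using that mixed_hessian[of "fst z" "snd z" w' u] by (auto simp: \<tau>_def[abs_def])
  have smooth_dH: "smooth_on (UB \<times> UF) (\<lambda>z. dir_deriv H z u)" for u by (rule smooth_on_dir_deriv[OF smooth_H])
  have h\<tau>: "(\<tau> has_derivative dir_deriv \<tau> ?z) (at ?z)"
    unfolding \<tau>_def[abs_def] by (rule smooth_on_has_derivative[OF smooth_dH z])
  have swap: "dir_deriv (\<lambda>z. dir_deriv H z (u, 0)) z' (0, w') = dir_deriv \<tau> z' (u, 0)" if "z' \<in> UB \<times> UF" for z' u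
    unfolding \<tau>_def[abs_def] by (rule dir_deriv_commute[OF smooth_H that])
  let ?k = "B.\<Gamma> x v v"
  have hH: "(\<lambda>z. dir_deriv H z u) differentiable (at ?z)" for u
    by (rule smooth_on_differentiable[OF smooth_dH z])
  let ?L = "\<lambda>z. dir_deriv (\<lambda>z. dir_deriv H z (v, 0)) z (v, 0) - dir_deriv H z (B.\<Gamma> (fst z) v v, 0)"
  have eq: "?L z = \<phi> z * GB (fst z) v v" if "z \<in> UB \<times> UF" for z
    using hessian_H[OF that, of "(v, 0)" "(v, 0)"] that
    by (auto simp: hessian_def christoffel_horizontal G_eq F.G_simps)
  have 1: "((\<lambda>z. dir_deriv H z (B.\<Gamma> (fst z) v v, 0)) has_derivative
      (\<lambda>h. dir_deriv (\<lambda>z. dir_deriv H z (?k, 0)) ?z h + dir_deriv H ?z (B.d\<Gamma> x (fst h) v v, 0))) (at ?z)"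
    using has_derivative_linear_apply[where T = "dir_deriv H" and Y = "\<lambda>z. (B.\<Gamma> (fst z) v v, 0)",
        OF open_U z linear_dir_deriv[OF smooth_on_differentiable[OF smooth_H]] has_dir_deriv[OF hH]
        has_derivative_Pair[OF has_derivative_fst_compose[OF has_dir_deriv[OF B.christoffel_differentiable[OF x]]]
          has_derivative_const]] by simp
  have "dir_deriv ?L ?z (0, w') = dir_deriv (\<lambda>z. dir_deriv (\<lambda>z. dir_deriv H z (v, 0)) z (v, 0)) ?z (0, w')
      - (dir_deriv (\<lambda>z. dir_deriv H z (?k, 0)) ?z (0, w') + dir_deriv H ?z (B.d\<Gamma> x (fst (0 :: 'e, w')) v v, 0))"
    by (rule dir_deriv_eq[OF has_derivative_diff[OF smooth_on_has_derivative[OF smooth_on_dir_deriv[OF smooth_dH] z] 1]])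
  also have "dir_deriv H ?z (B.d\<Gamma> x (fst (0 :: 'e, w')) v v, 0) = 0"
    using B.linear_d\<Gamma>(1)[OF x, THEN linear_0] linear_dir_deriv[OF smooth_on_differentiable[OF smooth_H z], THEN linear_0]
    by (simp add: zero_prod_def)
  also have "dir_deriv (\<lambda>z. dir_deriv H z (?k, 0)) ?z (0, w') = df x ?k / f x * \<tau> ?z"
    using swap[OF z] d\<tau>[OF z] by simp
  \<comment> \<open>The vertical derivative is moved innermost, so that both horizontal derivatives
    act on \<open>\<tau>\<close>. By \<open>d\<tau>\<close> they act as on \<open>f\<close>, the
    squares of \<open>df(v)\<close> cancelling.\<close>
  also have "dir_deriv (\<lambda>z. dir_deriv (\<lambda>z. dir_deriv H z (v, 0)) z (v, 0)) ?z (0, w')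
      = dir_deriv (\<lambda>z. dir_deriv (\<lambda>z. dir_deriv H z (v, 0)) z (0, w')) ?z (v, 0)"
    by (rule dir_deriv_commute[OF smooth_dH z])
  also have "\<dots> = dir_deriv (\<lambda>z. df (fst z) v / f (fst z) * \<tau> z) ?z (v, 0)"
    by (rule dir_deriv_apply_cong[OF open_U z]) (use swap d\<tau> in simp)
  also have "\<dots> = dir_deriv (\<lambda>x. df x v) x v / f x * \<tau> ?z"
  proof -
    have hf: "((\<lambda>z. f (fst z)) has_derivative (\<lambda>h. df x (fst h))) (at ?z)"
      by (rule has_derivative_fst_compose[OF has_derivative_f[OF x]])
    have hdf: "((\<lambda>z. df (fst z) v) has_derivative (\<lambda>h. dir_deriv (\<lambda>x. df x v) x (fst h))) (at ?z)"
      by (rule has_derivative_fst_compose[OF smooth_on_has_derivative[OF smooth_on_dir_deriv[OF smooth_f] x]])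
    have "((\<lambda>z. df (fst z) v / f (fst z) * \<tau> z) has_derivative
       (\<lambda>h. df x v / f x * dir_deriv \<tau> ?z h
         + (dir_deriv (\<lambda>x. df x v) x (fst h) * f x - df x v * df x (fst h)) / (f x * f x) * \<tau> ?z)) (at ?z)"
      using has_derivative_mult[OF has_derivative_divide'[OF hdf hf] h\<tau>] f_pos[OF x] by simp
    from dir_deriv_eq[OF this, of "(v, 0)"] show ?thesis
      using d\<tau>[OF z, of v] f_pos[OF x] by (simp add: field_simps)
  qed
  finally have "dir_deriv ?L ?z (0, w') = \<tau> ?z * hessian GB f x v v / f x"
    by (simp add: hessian_def diff_divide_distrib algebra_simps)
  moreover have "dir_deriv ?L ?z (0, w') = dir_deriv (\<lambda>z. \<phi> z * GB (fst z) v v) ?z (0, w')"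
    by (rule dir_deriv_apply_cong[OF open_U z eq])
  moreover have "\<dots> = \<phi> ?z * B.dG x (fst (0 :: 'e, w')) v v + d\<phi> ?z (0, w') * GB (fst ?z) v v"
    by (rule dir_deriv_eq[OF has_derivative_mult[OF has_derivative_\<phi>[OF z]
        has_derivative_fst_compose[OF has_dir_deriv[OF B.G_differentiable[OF x]]]]])
  ultimately show ?thesis
    using f_pos[OF x] by (simp add: \<tau>_def zero_simps[OF x y] field_simps)
qed

text \<open>Where the vertical derivative of \<open>H\<close> is nonzero,
  \<open>hessian_f_vertical\<close> writes \<open>\<mu>\<close> through base quantities alone, so
  \<open>\<mu>\<close> is constant vertically while \<open>H\<close> is not. Then
  \<open>\<mu>_eq_0\<close> applies, \<open>d\<phi>\<close> vanishes in the vertical direction, and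
  the same identity returns the claim.\<close>

lemma hessian_f_eq_0:
  assumes x: "x \<in> UB" and y: "y \<in> UF" and H: "dir_deriv H (x, y) (0, w') \<noteq> 0"
  shows "hessian GB f x v v = 0"
proof -
  define W where "W = {z \<in> UB \<times> UF. dir_deriv H z (0, w') \<noteq> 0}"
  have "open ((UB \<times> UF) \<inter> (\<lambda>z. dir_deriv H z (0, w')) -` (- {0}))"
    by (rule continuous_open_preimage[OF smooth_on_continuous[OF smooth_on_dir_deriv[OF smooth_H]] open_U])
      (simp add: open_Compl)
  then have W: "open W" by (simp add: W_def vimage_def Int_def)
  obtain e :: 'e where e: "e \<in> Basis" using nonempty_Basis by blast
  have reg: "z \<in> UB \<times> UF" "P z \<noteq> 0" if "z \<in> W" for z
  proof -
    show z: "z \<in> UB \<times> UF" using that by (simp add: W_def)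
    have "X z \<noteq> 0" using that G_X[OF z, of "(0, w')"] G_simps(7)[OF z] by (auto simp: W_def)
    then show "P z \<noteq> 0" using pos_G[OF z] by (metis less_irrefl)
  qed
  have \<mu>: "\<mu> z = hessian GB f (fst z) e e / (f (fst z) * GB (fst z) e e)" if "z \<in> W" for z
  proof -
    obtain a b where z: "z = (a, b)" by (cases z)
    have ab: "a \<in> UB" "b \<in> UF" and \<tau>: "dir_deriv H (a, b) (0, w') \<noteq> 0" using that z by (auto simp: W_def)
    have "GB a e e > 0" using e by (intro B.pos_G ab nonzero_Basis)
    moreover have "dir_deriv H (a, b) (0, w') * hessian GB f a e e
        = dir_deriv H (a, b) (0, w') * (\<mu> (a, b) * (f a * GB a e e))"
      using hessian_f_vertical[OF ab, of w' e] d\<phi>_\<mu>[OF reg[OF that], of "(0, w')"] z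
      by (simp add: mult.left_commute)
    ultimately show ?thesis using \<tau> f_pos[OF ab(1)] z by (simp add: field_simps)
  qed
  \<comment> \<open>The formula for \<open>\<mu>\<close> does not change along the vertical line
    through \<open>z\<close>, as long as that line stays in the open set \<open>W\<close>.\<close>
  have d\<mu>: "dir_deriv \<mu> z (0, w') = 0" if z: "z \<in> W" for z
  proof -
    have c: "((\<lambda>s :: real. z + s *\<^sub>R (0, w')) has_vector_derivative (0, w')) (at 0)"
      by (auto intro!: derivative_eq_intros simp: has_vector_derivative_def)
    have d: "((\<lambda>s. \<mu> (z + s *\<^sub>R (0, w'))) has_vector_derivative dir_deriv \<mu> z (0, w')) (at 0)"
      by (rule along_curve[OF _ c]) (simp add: has_dir_deriv[OF \<mu>_differentiable[OF reg[OF z]]] flip: zero_prod_def)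
    have S: "open ((\<lambda>s :: real. z + s *\<^sub>R (0, w')) -` W)"
      by (intro open_vimage W continuous_intros)
    have "((\<lambda>s. \<mu> z) has_vector_derivative dir_deriv \<mu> z (0, w')) (at 0)"
      by (rule has_vector_derivative_transform_within_open[OF d S]) (use z \<mu> in \<open>auto simp flip: zero_prod_def\<close>)
    then show ?thesis using vector_derivative_unique_at has_vector_derivative_const by blast
  qed
  have zW: "(x, y) \<in> W" using x y H by (simp add: W_def)
  have "\<mu> (x, y) = 0"
    by (rule \<mu>_eq_0[OF W _ zW _ d\<mu>]) (auto simp: W_def)
  then have "d\<phi> (x, y) (0, w') = 0" using d\<phi>_\<mu>[OF reg[OF zW], of "(0, w')"] by simp
  then show ?thesis using hessian_f_vertical[OF x y, of w' v] H by simp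
qed

end

section \<open>Warped product solitons\<close>

locale warped_soliton = B: riemannian B + F: riemannian F + soliton "warped_product B f F" h \<rho>
  for B :: "('a::{t2_space, second_countable_topology}, 'e::euclidean_space) riem"
    and F :: "('b::{t2_space, second_countable_topology}, 'd::euclidean_space) riem"
    and f :: "'a \<Rightarrow> real" and h \<rho> +
  assumes warping: "warping_function B f" and complete: "complete_manifold B"
begin

abbreviation M where "M \<equiv> warped_product B f F"

lemma chart_dom_M: "chart_dom M (x, y) = chart_dom B x \<times> chart_dom F y"
  and chart_map_M: "chart_map M (x, y) (x', y') = (chart_map B x x', chart_map F y y')"
  and metric_M: "metric M (x, y) (v, v') (w, w') = metric B x v w + (f x)\<^sup>2 * metric F y v' w'"
  by (simp_all add: warped_product_def)

lemma chart_img_M: "chart_img M (x, y) = chart_img B x \<times> chart_img F y"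
  by (auto simp: chart_img_def warped_product_def image_iff)

lemma param_M:
  assumes "a \<in> chart_img B x" "b \<in> chart_img F y"
  shows "param M (x, y) (a, b) = (param B x a, param F y b)"
  using param_chart[of "(param B x a, param F y b)" "(x, y)"] assms
  by (simp add: chart_dom_M chart_map_M B.param_dom F.param_dom B.chart_param F.chart_param)

lemma f_pos: "f x > 0" using warping by (simp add: warping_function_def)

lemma smooth_f: "smooth_on (chart_img B x) (f \<circ> param B x)"
  using warping by (simp add: warping_function_def smooth_fun_def)

lemma coord_metric_M:
  assumes a: "a \<in> chart_img B x" and b: "b \<in> chart_img F y"
  shows "coord_metric M (x, y) (a, b) (v, v') (w, w')
    = coord_metric B x a v w + ((f \<circ> param B x) a)\<^sup>2 * coord_metric F y b v' w'"
proof -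
  let ?x = "param B x a" and ?y = "param F y b"
  let ?T = "transition (x, y) (?x, ?y)"
  have z: "(a, b) \<in> overlap (x, y) (?x, ?y)"
    using in_overlap[of "(a, b)" "(x, y)"] a b by (simp add: chart_img_M param_M)
  have D: "dir_deriv ?T (a, b) (v, v') = (dir_deriv (B.transition x ?x) a v, dir_deriv (F.transition y ?y) b v')" for v v'
  proof -
    have "((\<lambda>z. (B.transition x ?x (fst z), F.transition y ?y (snd z))) has_derivative
       (\<lambda>h. (dir_deriv (B.transition x ?x) a (fst h), dir_deriv (F.transition y ?y) b (snd h)))) (at (a, b))"
      by (intro has_derivative_Pair has_derivative_compose[OF has_derivative_fst[OF has_derivative_ident]]
          has_derivative_compose[OF has_derivative_snd[OF has_derivative_ident]])
        (simp_all add: B.has_derivative_transition[OF B.in_overlap[OF a]] F.has_derivative_transition[OF F.in_overlap[OF b]])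
    then have "(?T has_derivative
       (\<lambda>h. (dir_deriv (B.transition x ?x) a (fst h), dir_deriv (F.transition y ?y) b (snd h)))) (at (a, b))"
    proof (rule has_derivative_transform_within_open[OF _ open_overlap z])
      fix z' assume "z' \<in> overlap (x, y) (?x, ?y)"
      then show "(B.transition x ?x (fst z'), F.transition y ?y (snd z')) = ?T z'"
        using overlap_subset[of "(x, y)" "(?x, ?y)"]
        by (cases z') (auto simp: transition_def B.transition_def F.transition_def chart_img_M param_M chart_map_M)
    qed
    from dir_deriv_eq[OF this, of "(v, v')"] show ?thesis by simp
  qed
  show ?thesis
    using coord_metric_eq[of "(x, y)" "(a, b)"]
    by (simp add: param_M[OF a b] D metric_M B.coord_metric_eq F.coord_metric_eq)
qed

lemma warped_coordinates_chart:
  "warped_coordinates (chart_img B x) (coord_metric B x) (chart_img F y) (coord_metric F y)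
     (coord_metric M (x, y)) (h \<circ> param M (x, y)) (\<phi> \<circ> param M (x, y)) \<rho> (f \<circ> param B x)"
proof (intro warped_coordinates.intro warped_coordinates_axioms.intro B.metric_on_chart F.metric_on_chart)
  show "coordinate_soliton (chart_img B x \<times> chart_img F y) (coord_metric M (x, y))
      (h \<circ> param M (x, y)) (\<phi> \<circ> param M (x, y)) \<rho>"
    using coordinate_soliton_chart[of "(x, y)"] by (simp add: chart_img_M)
qed (simp_all add: smooth_f f_pos coord_metric_M del: o_apply, simp add: f_pos)

lemma connected_base: "connected (UNIV :: 'a set)"
proof -
  have "connected (UNIV :: ('a \<times> 'b) set)" using soliton_M by (simp add: yamabe_gradient_soliton_def)
  then have "connected (fst ` (UNIV :: ('a \<times> 'b) set))"
    by (intro connected_continuous_image continuous_on_fst continuous_on_id)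
  then show ?thesis by simp
qed

text \<open>No chart map of the base is differentiated on the right-hand side, so vertical
  derivatives over different base charts can be compared for a fixed fibre chart.\<close>

lemma vertical_derivative:
  assumes a: "a \<in> chart_img B x" and b: "b \<in> chart_img F y"
  shows "dir_deriv (h \<circ> param M (x, y)) (a, b) (0, w') = dir_deriv (\<lambda>b. h (param B x a, param F y b)) b w'"
proof -
  interpret warped_coordinates "chart_img B x" "coord_metric B x" "chart_img F y" "coord_metric F y"
    "coord_metric M (x, y)" "h \<circ> param M (x, y)" "\<phi> \<circ> param M (x, y)" \<rho> "f \<circ> param B x"
    by (rule warped_coordinates_chart)
  have "((\<lambda>b. (h \<circ> param M (x, y)) (a, b)) has_derivative
      (\<lambda>w'. dir_deriv (h \<circ> param M (x, y)) (a, b) (0, w'))) (at b)"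
    by (rule has_derivative_compose[OF has_derivative_Pair[OF has_derivative_const has_derivative_ident]
          smooth_on_has_derivative[OF smooth_H mem_U[OF a b]]])
  then have "((\<lambda>b. h (param B x a, param F y b)) has_derivative
      (\<lambda>w'. dir_deriv (h \<circ> param M (x, y)) (a, b) (0, w'))) (at b)"
    by (rule has_derivative_transform_within_open[OF _ F.chart(3) b]) (simp add: param_M a)
  from dir_deriv_eq[OF this] show ?thesis by simp
qed

text \<open>A nonzero vertical derivative of \<open>h\<close> would persist along the whole base, so that \<open>f\<close> would be
  affine on all geodesics of \<open>B\<close>; being positive, it would be constant.\<close>

lemma vertical_derivative_eq_0:
  assumes a: "a \<in> chart_img B x" and b: "b \<in> chart_img F y"
  shows "dir_deriv (h \<circ> param M (x, y)) (a, b) (0, w') = 0"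
proof (rule ccontr)
  assume ne: "dir_deriv (h \<circ> param M (x, y)) (a, b) (0, w') \<noteq> 0"
  \<comment> \<open>The constant multiple of \<open>f\<close> on one slice. It is constant over the
    connected base, so being nonzero at one point it is nonzero everywhere.\<close>
  define Q where "Q x = dir_deriv (\<lambda>b. h (x, param F y b)) b w' / f x" for x
  have "((Q \<circ> param B p) has_derivative (\<lambda>v. 0)) (at (chart_map B p p))" for p
  proof -
    interpret warped_coordinates "chart_img B p" "coord_metric B p" "chart_img F y" "coord_metric F y"
      "coord_metric M (p, y)" "h \<circ> param M (p, y)" "\<phi> \<circ> param M (p, y)" \<rho> "f \<circ> param B p"
      by (rule warped_coordinates_chart)
    note p = B.chart_in_img[OF B.chart(1)[of p]]
    show ?thesis
      by (rule has_derivative_transform_within_open[OF vertical_derivative_proportional_f[OF p b, of w'] B.chart(3) p])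
        (simp add: vertical_derivative b del: o_apply, simp add: Q_def)
  qed
  from B.locally_constant_chart[OF this connected_base]
  have "Q x' = Q (param B x a)" for x' by (auto simp: constant_on_def)
  moreover have "Q (param B x a) \<noteq> 0"
    using ne f_pos[of "param B x a"] by (simp add: Q_def vertical_derivative a b)
  ultimately have Q0: "dir_deriv (\<lambda>b. h (x', param F y b)) b w' \<noteq> 0" for x'
    unfolding Q_def by (metis div_0)
  have hess: "hessian (coord_metric B p) (f \<circ> param B p) a' v v = 0" if a': "a' \<in> chart_img B p" for p a' v
  proof -
    interpret warped_coordinates "chart_img B p" "coord_metric B p" "chart_img F y" "coord_metric F y"
      "coord_metric M (p, y)" "h \<circ> param M (p, y)" "\<phi> \<circ> param M (p, y)" \<rho> "f \<circ> param B p"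
      by (rule warped_coordinates_chart)
    show ?thesis by (rule hessian_f_eq_0[OF a' b, of w']) (simp add: vertical_derivative a' b Q0 del: o_apply)
  qed
  have "((f \<circ> param B p) has_derivative (\<lambda>v. 0)) (at (chart_map B p p))" for p
  proof -
    note p = B.chart_in_img[OF B.chart(1)[of p]]
    have "dir_deriv (f \<circ> param B p) (chart_map B p p) v = 0" for v
    proof -
      obtain \<gamma> where \<gamma>: "geodesic B \<gamma>" "\<gamma> 0 = p" "vector_derivative (chart_map B p \<circ> \<gamma>) (at 0) = v"
        using complete unfolding complete_manifold_def by blast
      \<comment> \<open>Along the geodesic \<open>g'' = Hess f(c, c) = 0\<close>. A positive affine
        function on the whole line is constant, so \<open>df(v) = 0\<close> for the arbitrary
        initial velocity \<open>v\<close>.\<close>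
      define g where "g t = f (\<gamma> t)" for t
      have g: "(g has_real_derivative dir_deriv (f \<circ> param B (\<gamma> t)) (chart_map B (\<gamma> t) (\<gamma> t))
            (vector_derivative (chart_map B (\<gamma> t) \<circ> \<gamma>) (at t))) (at t)
          \<and> (deriv g has_real_derivative 0) (at t)" for t
      proof -
        let ?C = "\<lambda>s. chart_map B (\<gamma> t) (\<gamma> s)" and ?G = "coord_metric B (\<gamma> t)" and ?f = "f \<circ> param B (\<gamma> t)"
        interpret metric_on "chart_img B (\<gamma> t)" ?G by (rule B.metric_on_chart)
        obtain S c where S: "open S" "t \<in> S" and dom: "\<And>s. s \<in> S \<Longrightarrow> \<gamma> s \<in> chart_dom B (\<gamma> t)"
          and C: "\<And>s. s \<in> S \<Longrightarrow> (?C has_vector_derivative c s) (at s)"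
          and c: "\<And>s. s \<in> S \<Longrightarrow> (c has_vector_derivative - \<Gamma> (?C s) (c s) (c s)) (at s)"
          using B.geodesic_in_chart[OF \<gamma>(1), of t] unfolding o_def by blast
        have C_in: "?C s \<in> chart_img B (\<gamma> t)" if "s \<in> S" for s by (rule B.chart_in_img[OF dom[OF that]])
        have g': "(g has_real_derivative dir_deriv ?f (?C s) (c s)) (at s)" if s: "s \<in> S" for s
        proof -
          have "((\<lambda>s. ?f (?C s)) has_vector_derivative dir_deriv ?f (?C s) (c s)) (at s)"
            by (rule along_curve[OF smooth_on_has_derivative[OF smooth_f C_in[OF s]] C[OF s]])
          then have "(g has_vector_derivative dir_deriv ?f (?C s) (c s)) (at s)"
            by (rule has_vector_derivative_transform_within_open[OF _ S(1) s]) (simp add: g_def B.param_chart dom)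
          then show ?thesis by (simp add: has_real_derivative_iff_has_vector_derivative)
        qed
        have "((\<lambda>s. ?G (?C s) (gradient ?G ?f (?C s)) (c s)) has_real_derivative 0) (at t)"
          using second_derivative_along_geodesic[OF smooth_f C_in[OF S(2)] C[OF S(2)] c[OF S(2)]]
          by (simp only: hess[OF C_in[OF S(2)]])
        then have "(deriv g has_real_derivative 0) (at t)"
          by (rule has_field_derivative_transform_within_open[OF _ S])
            (simp add: G_gradient[OF smooth_f C_in] DERIV_imp_deriv[OF g'])
        moreover have "c t = vector_derivative (chart_map B (\<gamma> t) \<circ> \<gamma>) (at t)"
          using vector_derivative_at[OF C[OF S(2)]] by (simp add: o_def)
        ultimately show ?thesis using g'[OF S(2)] by simp
      qed
      have "(g has_real_derivative deriv g 0) (at t)" for t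
      proof -
        have "deriv g t = deriv g 0"
          by (rule DERIV_isconst_all) (use g in blast)
        then show ?thesis using DERIV_imp_deriv[OF conjunct1[OF g[of t]]] g[of t] by simp
      qed
      then have "deriv g 0 = 0"
        by (rule affine_positive_constant) (simp add: g_def f_pos)
      then show ?thesis using DERIV_imp_deriv[OF conjunct1[OF g[of 0]]] \<gamma> by simp
    qed
    then show ?thesis
      using smooth_on_has_derivative[OF smooth_f p] by (simp add: fun_eq_iff[symmetric])
  qed
  from B.locally_constant_chart[OF this connected_base] show False
    using warping by (simp add: warping_function_def)
qed

theorem curvature_lower_bound:
  assumes dim: "DIM('e) \<ge> 2"
  shows "\<phi> p \<ge> min 0 (- \<rho>)"
proof -
  obtain x y where p: "p = (x, y)" by (cases p)
  have X: "snd (grad M h (x, y)) = 0"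
    "dir_deriv (f \<circ> param B x) (chart_map B x x) (fst (grad M h (x, y))) = \<phi> (x, y) * f x" for x
  proof -
    interpret warped_coordinates "chart_img B x" "coord_metric B x" "chart_img F y" "coord_metric F y"
      "coord_metric M (x, y)" "h \<circ> param M (x, y)" "\<phi> \<circ> param M (x, y)" \<rho> "f \<circ> param B x"
      by (rule warped_coordinates_chart)
    note x = B.chart_in_img[OF B.chart(1)[of x]] and y = F.chart_in_img[OF F.chart(1)[of y]]
    have g: "grad M h (x, y) = X (chart_map B x x, chart_map F y y)" by (simp add: grad_def chart_map_M)
    have v: "dir_deriv (h \<circ> param M (x, y)) z (0, w') = 0" if "z \<in> chart_img B x \<times> chart_img F y" for z w'
      using that vertical_derivative_eq_0[of "fst z" x "snd z" y w'] by auto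
    show "snd (grad M h (x, y)) = 0" unfolding g by (rule df_X(1)[OF x y v])
    show "dir_deriv (f \<circ> param B x) (chart_map B x x) (fst (grad M h (x, y))) = \<phi> (x, y) * f x"
      using df_X(2)[OF x y v] by (simp add: g param_M x y B.param_chart B.chart F.param_chart F.chart)
  qed
  define XB where "XB = fst (grad M h (x, y))"
  have gr: "grad M h (x, y) = (XB, 0)" using X(1)[of x] by (simp add: XB_def prod_eq_iff)
  show ?thesis
  proof (cases "XB = 0")
    case True
    have "linear (dir_deriv (f \<circ> param B x) (chart_map B x x))"
      by (rule linear_dir_deriv[OF smooth_on_differentiable[OF smooth_f B.chart_in_img[OF B.chart(1)]]])
    then have "\<phi> (x, y) * f x = 0" using X(2)[of x] True by (simp add: gr linear_0)
    then show ?thesis using f_pos[of x] p by simp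
  next
    case False
    \<comment> \<open>The initial velocity must have unit length in the product, and a horizontal
      vector has the same length there as in the base.\<close>
    define a where "a = sqrt (metric B x XB XB)"
    have a: "a > 0" "a * a = metric B x XB XB"
      using B.metric_simps(3)[OF False, of x] by (simp_all add: a_def)
    define v where "v = XB /\<^sub>R a"
    have XBv: "XB = a *\<^sub>R v" using a by (simp add: v_def)
    obtain \<gamma> where \<gamma>: "geodesic B \<gamma>" "\<gamma> 0 = x" "vector_derivative (chart_map B x \<circ> \<gamma>) (at 0) = v"
      using complete unfolding complete_manifold_def by blast
    \<comment> \<open>The lift of \<open>\<gamma>\<close> to the horizontal slice through
      \<open>y\<close>. It is a geodesic of the product that exists for all time, by completeness of
      the base.\<close>
    define \<kappa> where "\<kappa> t = (\<gamma> t, y)" for t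
    have \<kappa>0: "\<kappa> 0 = (x, y)" by (simp add: \<kappa>_def \<gamma>)
    have F0: "metric F y 0 0 = 0" using F.metric_simps(1)[of y] by (simp add: bilinear_def linear_0)
    have chart\<kappa>: "(chart_map M (\<kappa> t) \<circ> \<kappa>) = (\<lambda>s. ((chart_map B (\<gamma> t) \<circ> \<gamma>) s, chart_map F y y))" for t
      by (simp add: fun_eq_iff \<kappa>_def chart_map_M)
    have vel: "velocity \<kappa> t = (vector_derivative (chart_map B (\<gamma> t) \<circ> \<gamma>) (at t), 0)" for t
      unfolding velocity_def chart\<kappa>
      by (intro vector_derivative_at has_vector_derivative_Pair B.velocity_in_chart \<gamma> has_vector_derivative_const)
    have "\<phi> (\<kappa> 0) \<ge> min 0 (- \<rho>)"
    proof (rule lower_bound_along_geodesic[where a = a and f = "\<lambda>t. f (\<gamma> t)"])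
      show "2 \<le> DIM('e \<times> 'd)" using dim by simp
      show "metric M (\<kappa> 0) (velocity \<kappa> 0) (velocity \<kappa> 0) = 1"
      proof -
        have "a * a * metric B x v v = a * a"
          using a(2) B.metric_simps(1)[of x]
          by (simp add: XBv bilinear_def linear_cmul[of "metric B x _"] linear_cmul[of "\<lambda>w. metric B x w _"])
        then show ?thesis using a(1) \<gamma> by (simp add: vel \<kappa>0 metric_M F0)
      qed
      show "grad M h (\<kappa> 0) = a *\<^sub>R velocity \<kappa> 0" using \<gamma> by (simp add: \<kappa>0 gr vel XBv)
      fix t
      show "\<exists>S c. open S \<and> t \<in> S \<and> (\<forall>s\<in>S. \<kappa> s \<in> chart_dom M (\<kappa> t) \<and>
        ((chart_map M (\<kappa> t) \<circ> \<kappa>) has_vector_derivative c s) (at s) \<and>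
        (c has_vector_derivative - christoffel (coord_metric M (\<kappa> t)) (chart_map M (\<kappa> t) (\<kappa> s)) (c s) (c s)) (at s))"
      proof -
        interpret warped_coordinates "chart_img B (\<gamma> t)" "coord_metric B (\<gamma> t)" "chart_img F y" "coord_metric F y"
          "coord_metric M (\<gamma> t, y)" "h \<circ> param M (\<gamma> t, y)" "\<phi> \<circ> param M (\<gamma> t, y)" \<rho> "f \<circ> param B (\<gamma> t)"
          by (rule warped_coordinates_chart)
        obtain S c where S: "open S" "t \<in> S" and dom: "\<And>s. s \<in> S \<Longrightarrow> \<gamma> s \<in> chart_dom B (\<gamma> t)"
          and C: "\<And>s. s \<in> S \<Longrightarrow> ((chart_map B (\<gamma> t) \<circ> \<gamma>) has_vector_derivative c s) (at s)"
          and c: "\<And>s. s \<in> S \<Longrightarrow> (c has_vector_derivative - B.\<Gamma> (chart_map B (\<gamma> t) (\<gamma> s)) (c s) (c s)) (at s)"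
          using B.geodesic_in_chart[OF \<gamma>(1), of t] by blast
        show ?thesis
        proof (intro exI[of _ S] exI[of _ "\<lambda>s. (c s, 0)"] conjI ballI S)
          fix s assume s: "s \<in> S"
          show "\<kappa> s \<in> chart_dom M (\<kappa> t)" using dom[OF s] F.chart(1) by (simp add: \<kappa>_def chart_dom_M)
          show "((chart_map M (\<kappa> t) \<circ> \<kappa>) has_vector_derivative (c s, 0)) (at s)"
            unfolding chart\<kappa> by (intro has_vector_derivative_Pair C[OF s] has_vector_derivative_const)
          have "((\<lambda>s. (c s, 0 :: 'd)) has_vector_derivative (- B.\<Gamma> (chart_map B (\<gamma> t) (\<gamma> s)) (c s) (c s), 0)) (at s)"
            by (intro has_vector_derivative_Pair c[OF s] has_vector_derivative_const)
          then show "((\<lambda>s. (c s, 0)) has_vector_derivative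
             - christoffel (coord_metric M (\<kappa> t)) (chart_map M (\<kappa> t) (\<kappa> s)) (c s, 0) (c s, 0)) (at s)"
            by (simp add: \<kappa>_def chart_map_M christoffel_horizontal B.chart_in_img[OF dom[OF s]] F.chart_in_img F.chart)
        qed
      qed
      fix r assume g: "grad M h (\<kappa> t) = r *\<^sub>R velocity \<kappa> t"
      let ?f = "f \<circ> param B (\<gamma> t)" and ?x = "chart_map B (\<gamma> t) (\<gamma> t)"
      let ?v = "vector_derivative (chart_map B (\<gamma> t) \<circ> \<gamma>) (at t)"
      have f': "(?f has_derivative dir_deriv ?f ?x) (at ?x)"
        by (rule smooth_on_has_derivative[OF smooth_f B.chart_in_img[OF B.chart(1)]])
      obtain S c where S: "open S" "t \<in> S" and dom: "\<And>s. s \<in> S \<Longrightarrow> \<gamma> s \<in> chart_dom B (\<gamma> t)"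
        using B.geodesic_in_chart[OF \<gamma>(1), of t] by blast
      have "((\<lambda>s. ?f ((chart_map B (\<gamma> t) \<circ> \<gamma>) s)) has_vector_derivative dir_deriv ?f ?x ?v) (at t)"
        using f' by (intro along_curve[OF _ B.velocity_in_chart[OF \<gamma>(1)]])
          (simp only: o_apply[of "chart_map B (\<gamma> t)" \<gamma> t])
      then have "((\<lambda>t. f (\<gamma> t)) has_vector_derivative dir_deriv ?f ?x ?v) (at t)"
        by (rule has_vector_derivative_transform_within_open[OF _ S]) (simp add: B.param_chart dom)
      moreover have "r * dir_deriv ?f ?x ?v = \<phi> (\<kappa> t) * f (\<gamma> t)"
        using X(2)[of "\<gamma> t"] g linear_cmul[OF bounded_linear.linear[OF has_derivative_bounded_linear[OF f']], of r ?v]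
        by (simp add: \<kappa>_def vel del: o_apply)
      ultimately show "\<exists>f'. ((\<lambda>t. f (\<gamma> t)) has_real_derivative f') (at t) \<and> r * f' = \<phi> (\<kappa> t) * f (\<gamma> t)"
        by (auto simp: has_real_derivative_iff_has_vector_derivative)
    qed (use a f_pos in auto)
    then show ?thesis by (simp add: p \<kappa>0)
  qed
qed

end

theorem theorem4p2:
  fixes B :: "('a::{t2_space, second_countable_topology}, 'e::euclidean_space) riem"
    and F :: "('b::{t2_space, second_countable_topology}, 'd::euclidean_space) riem"
    and f :: "'a \<Rightarrow> real" and h :: "'a \<times> 'b \<Rightarrow> real"
    and \<rho> A :: real and n m :: nat and y\<^sub>0 :: 'b
    and M :: "('a \<times> 'b, 'e \<times> 'd) riem" and h\<^sub>B :: "'a \<Rightarrow> real"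
  assumes "n = DIM('e)" and "m = DIM('d)" and "n \<ge> 2"
    and "riemannian_manifold B" and "riemannian_manifold F"
    and "warping_function B f"
    and "M = warped_product B f F"
    and "yamabe_gradient_soliton M h \<rho>" and "\<not> trivial_soliton h"
    and "complete_manifold B"
    and "h\<^sub>B = base_function h y\<^sub>0"
    and "(INF x \<in> {x. tnorm B x (grad B h\<^sub>B x) \<noteq> 0}.
            ereal ((real n + real m - 1) / (real n - 1)
                     * Ric B x (unit_grad B h\<^sub>B x) (unit_grad B h\<^sub>B x)
                   - 1 / (2 * (real n + real m - 1))
                     * Hess B h\<^sub>B x (unit_grad B h\<^sub>B x) (unit_grad B h\<^sub>B x))) = ereal A"
  shows "bdd_below (range (scalar_curvature M)) \<and>
    (\<exists>C>0.
       (\<rho> \<ge> 0 \<longrightarrow> (\<forall>p. scalar_curvature M p \<ge> - (real n + real m - 1) * C * \<bar>A\<bar>)) \<and>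
       (\<rho> < 0 \<longrightarrow> (\<forall>p. scalar_curvature M p \<ge> - (real n + real m - 1) * C * \<bar>A\<bar> + \<rho>)))"
proof -
  have "riemannian_manifold M" using assms(8) by (simp add: yamabe_gradient_soliton_def)
  then interpret warped_soliton B F f h \<rho>
    using assms by unfold_locales (auto simp: riemannian_manifold_def)
  have lower: "scalar_curvature M p \<ge> min \<rho> 0" for p
    using curvature_lower_bound[of p] assms(1,3) by (auto simp: \<phi>_def assms(7))
  \<comment> \<open>\<open>C = 1\<close> serves: the term containing \<open>A\<close> is at most 0,
    so the two required bounds are at most 0 and at most \<open>\<rho>\<close> respectively.\<close>
  have "(real n + real m - 1) * \<bar>A\<bar> \<ge> 0" using assms(3) by simp
  then have C: "- (real n + real m - 1) * 1 * \<bar>A\<bar> \<le> 0"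
    by (simp only: mult_minus_left mult_1_right neg_le_0_iff_le)
  have "\<rho> \<ge> 0 \<Longrightarrow> scalar_curvature M p \<ge> - (real n + real m - 1) * 1 * \<bar>A\<bar>" for p
    using lower[of p] C by linarith
  moreover have "\<rho> < 0 \<Longrightarrow> scalar_curvature M p \<ge> - (real n + real m - 1) * 1 * \<bar>A\<bar> + \<rho>" for p
    using lower[of p] C by linarith
  moreover have "bdd_below (range (scalar_curvature M))"
    using lower by (intro bdd_belowI[of _ "min \<rho> 0"]) auto
  ultimately show ?thesis using zero_less_one by blast
qed

end
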